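(* For all integers $n\ge2$ and $r\ge2$, $$\deg\left(\Sigma_{2,r}^n\right)=\binom{2n-3}{n-1}\left[r^{2n-2}-(2r-1)^{n-1}\right],$$ where $\deg$ denotes the degree in the Plücker embedding of $\mathrm{Gr}_2(S_r)$.
   Context: Everything is over $\mathbb{C}$. Let $V$ be a vector space of dimension $n$ and $S_r=\mathrm{Sym}^r(V^\vee)$. $\Sigma_{2,r}^n\subseteq\mathrm{Gr}_2(S_r)$ is the Zariski closure, with reduced structure, of the set of $2$-dimensional subspaces $\langle\ell_1^r,\ell_2^r\rangle$ with $\ell_1,\ell_2\in V^\vee$ and $\ell_1^r,\ell_2^r$ linearly independent. *)

theory Defs
  imports Complex_Main "HOL-Library.Function_Algebras" "HOL-Computational_Algebra.Polynomial"
begin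

definition fscale :: "complex \<Rightarrow> ('x \<Rightarrow> complex) \<Rightarrow> 'x \<Rightarrow> complex" where
  "fscale c f = (\<lambda>x. c * f x)"

global_interpretation fs: vector_space "fscale :: complex \<Rightarrow> ('x \<Rightarrow> complex) \<Rightarrow> 'x \<Rightarrow> complex"
  by unfold_locales (simp_all add: fscale_def fun_eq_iff algebra_simps)

text \<open>Vector spaces are subspaces \<open>V\<close> of an ambient type. A functional on \<open>V\<close> is represented by its
  extension by zero outside \<open>V\<close>, so that equality of functions is equality on \<open>V\<close>.\<close>

definition dual_space :: "(complex \<Rightarrow> 'a \<Rightarrow> 'a) \<Rightarrow> 'a::ab_group_add set \<Rightarrow> ('a \<Rightarrow> complex) set" where
  "dual_space scale V = {l. (\<forall>u\<in>V. \<forall>v\<in>V. l (u + v) = l u + l v) \<and>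
     (\<forall>c. \<forall>u\<in>V. l (scale c u) = c * l u) \<and> (\<forall>u. u \<notin> V \<longrightarrow> l u = 0)}"

text \<open>\<open>Sym\<^sup>k(V\<^sup>\<or>)\<close>, realised as the space of homogeneous polynomial functions of degree \<open>k\<close> on \<open>V\<close>:
  for finite-dimensional \<open>V\<close> the map from the symmetric power to functions is injective, because the
  field is infinite. For \<open>k = 0\<close> these are the constants.\<close>

definition sym_dual :: "(complex \<Rightarrow> 'a \<Rightarrow> 'a) \<Rightarrow> 'a::ab_group_add set \<Rightarrow> nat \<Rightarrow> ('a \<Rightarrow> complex) set" where
  "sym_dual scale V k =
     fs.span {(\<lambda>v. \<Prod>i<k. l i v) | l. \<forall>i<k. l i \<in> dual_space scale V}"

definition Gr :: "nat \<Rightarrow> ('x \<Rightarrow> complex) set \<Rightarrow> ('x \<Rightarrow> complex) set set" where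
  "Gr d W = {L. fs.subspace L \<and> L \<subseteq> W \<and> fs.dim L = d}"

text \<open>For a space \<open>W\<close> of functions on \<open>X\<close>, the map from \<open>W \<otimes> W\<close> to functions on \<open>X \<times> X\<close> is injective;
  the exterior square of \<open>W\<close> is its image under \<open>f \<and> g = f \<otimes> g - g \<otimes> f\<close>.\<close>

definition wedge :: "('x \<Rightarrow> complex) \<Rightarrow> ('x \<Rightarrow> complex) \<Rightarrow> 'x \<times> 'x \<Rightarrow> complex" where
  "wedge f g = (\<lambda>(x, y). f x * g y - g x * f y)"

definition ext_square :: "('x \<Rightarrow> complex) set \<Rightarrow> ('x \<times> 'x \<Rightarrow> complex) set" where
  "ext_square W = fs.span {wedge f g | f g. f \<in> W \<and> g \<in> W}"

text \<open>The line \<open>\<Lambda>\<^sup>2 L\<close> in \<open>\<Lambda>\<^sup>2 W\<close>, for \<open>L \<in> Gr 2 W\<close>. Points of a projective space are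
  one-dimensional subspaces, i.e. \<open>\<P>(U) = Gr 1 U\<close>.\<close>

definition plucker :: "('x \<Rightarrow> complex) set \<Rightarrow> ('x \<times> 'x \<Rightarrow> complex) set" where
  "plucker L = ext_square L"

definition gr2_closed :: "('x \<Rightarrow> complex) set \<Rightarrow> ('x \<Rightarrow> complex) set set \<Rightarrow> bool" where
  "gr2_closed W Z \<longleftrightarrow> (\<exists>\<F> \<subseteq> (\<Union>k. sym_dual fscale (ext_square W) k).
     Z = {L \<in> Gr 2 W. \<forall>F\<in>\<F>. \<forall>w\<in>plucker L. F w = 0})"

definition Sigma2 :: "(complex \<Rightarrow> 'v \<Rightarrow> 'v) \<Rightarrow> 'v::ab_group_add set \<Rightarrow> nat \<Rightarrow> ('v \<Rightarrow> complex) set set" where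
  "Sigma2 scale V r = gr2_closed (sym_dual scale V r) hull
     {L \<in> Gr 2 (sym_dual scale V r). \<exists>l1\<in>dual_space scale V. \<exists>l2\<in>dual_space scale V.
        L = fs.span {\<lambda>v. l1 v ^ r, \<lambda>v. l2 v ^ r}}"

text \<open>Graded pieces of the homogeneous ideal of \<open>X \<subseteq> \<P>(U)\<close>, the Hilbert function of the reduced
  homogeneous coordinate ring, and the degree read off from the Hilbert polynomial, which exists by
  the Hilbert--Serre theorem when \<open>U\<close> is finite-dimensional.\<close>

definition vanishing_forms :: "('x \<Rightarrow> complex) set \<Rightarrow> ('x \<Rightarrow> complex) set set \<Rightarrow> nat \<Rightarrow> (('x \<Rightarrow> complex) \<Rightarrow> complex) set" where
  "vanishing_forms U X k = {F \<in> sym_dual fscale U k. \<forall>p\<in>X. \<forall>u\<in>p. F u = 0}"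

definition hilbert_function :: "('x \<Rightarrow> complex) set \<Rightarrow> ('x \<Rightarrow> complex) set set \<Rightarrow> nat \<Rightarrow> nat" where
  "hilbert_function U X k = fs.dim (sym_dual fscale U k) - fs.dim (vanishing_forms U X k)"

definition hilbert_poly :: "('x \<Rightarrow> complex) set \<Rightarrow> ('x \<Rightarrow> complex) set set \<Rightarrow> real poly" where
  "hilbert_poly U X = (THE p. \<exists>N. \<forall>k\<ge>N. poly p (real k) = real (hilbert_function U X k))"

definition proj_degree :: "('x \<Rightarrow> complex) set \<Rightarrow> ('x \<Rightarrow> complex) set set \<Rightarrow> real" where
  "proj_degree U X = fact (degree (hilbert_poly U X)) * lead_coeff (hilbert_poly U X)"

definition plucker_degree :: "('x \<Rightarrow> complex) set \<Rightarrow> ('x \<Rightarrow> complex) set set \<Rightarrow> real" where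
  "plucker_degree W Z = proj_degree (ext_square W) (plucker ` Z)"

end

theory Submission
  imports Defs "HOL-Library.Multiset" "HOL-Library.FuncSet"
begin

text \<open>Pulling forms back along \<open>(l\<^sub>1, l\<^sub>2) \<mapsto> l\<^sub>1\<^sup>r \<and> l\<^sub>2\<^sup>r\<close> identifies the homogeneous coordinate ring of
  the variety with the algebra generated by the antisymmetric polynomials of bidegree \<open>(r, r)\<close> in the
  coordinates \<open>x\<close>, \<open>y\<close> of two linear forms. Its piece of degree \<open>k\<close> is spanned by the products of \<open>k\<close> minors
  \<open>x\<^sub>i y\<^sub>j - x\<^sub>j y\<^sub>i\<close> and \<open>k (r - 1)\<close> sums \<open>x\<^sub>i y\<^sub>j + x\<^sub>j y\<^sub>i\<close>. The polarization operators
  \<open>E = \<Sum> x\<^sub>i \<partial>/\<partial>y\<^sub>i\<close> and \<open>F = \<Sum> y\<^sub>i \<partial>/\<partial>x\<^sub>i\<close> generate an action of \<open>sl\<^sub>2\<close>, and Capelli's identity shows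
  that the kernel of \<open>E\<close> in bidegree \<open>(a, b)\<close> is spanned by \<open>b\<close>-fold products of minors times
  polynomials in \<open>x\<close>. Filtering by the kernels of the powers of \<open>E\<close>, that is, by the order of vanishing
  along the diagonal, the piece of degree \<open>k\<close> gets the graded pieces \<open>ker E\<close> in bidegrees
  \<open>(k r + i, k r - i)\<close> with \<open>0 \<le> i \<le> k (r - 1)\<close> and \<open>i \<equiv> k (r - 1)\<close> modulo 2. The dimension of each is
  a difference of products of binomial coefficients, so the Hilbert function is an alternating sum,
  which is summed with Euler-type polynomials: it is a polynomial whose leading coefficient comes
  from the two end terms \<open>i = 0\<close> and \<open>i = k (r - 1) + 1\<close> only.\<close>

section \<open>Linear algebra\<close>

text \<open>The Hilbert function depends only on which forms vanish, so the Zariski closure never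
  has to be described, and the degree becomes a dimension count. The obstacle is an intrinsic
  description of the products of k antisymmetric polynomials. They have sign (-1)^k under the
  exchange of x and y and vanish to order at least k on the diagonal; the core of the proof is that
  these conditions also suffice. Two facts give this. The exchange multiplies a leading term of
  order j along the diagonal by (-1)^j, so every other layer is empty. A product of two minors is a
  combination of products of two sums, so the remaining layers can be filled by lifting. For N = n -
  1 let f(i) be the product of the numbers of monomials of degrees k r + i and k r - i, about ((k
  r)^2 - i^2)^N / N!^2. A layer has dimension f(i) - f(i + 1). Since every second layer occurs, the
  sum is about half of f(0) - f(k (r - 1)), which explains r^(2N) and (r^2 - (r - 1)^2)^N = (2 r -
  1)^N. The factor (2N)! / (2 N!^2) is half a central binomial coefficient.\<close>

lemma (in vector_space) span_Int_span_disjoint: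
  assumes "independent (A \<union> B)" "A \<inter> B = {}" "x \<in> span A" "x \<in> span B"
  shows "x = 0"
proof -
  have A: "representation (A \<union> B) x = representation A x"
    by (rule representation_extend[OF assms(1,3)]) auto
  have B: "representation (A \<union> B) x = representation B x"
    by (rule representation_extend[OF assms(1,4)]) auto
  have "representation (A \<union> B) x b = 0" for b
    using A B assms(2) representation_ne_zero[of A x b] representation_ne_zero[of B x b]
    by (metis disjoint_iff)
  then show ?thesis
    using sum_nonzero_representation_eq[OF assms(1), of x] assms(3) span_mono[of A "A \<union> B"] by auto
qed

text \<open>The function spaces in use may be infinite-dimensional, so rank-nullity is stated for a
  subspace of a finite span. A basis of the kernel is extended to one of \<open>S\<close>, and the
  added vectors \<open>C\<close> map injectively onto a basis of the image.\<close>

lemma (in vector_space_pair) dim_eq_dim_kernel_plus_dim_image: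
  assumes f: "Vector_Spaces.linear s1 s2 f" and S: "vs1.subspace S" and A: "finite A" "S \<subseteq> vs1.span A"
  shows "vs1.dim S = vs1.dim {x \<in> S. f x = 0} + vs2.dim (f ` S)"
proof -
  let ?Z = "{x \<in> S. f x = 0}"
  obtain B1 where B1: "B1 \<subseteq> ?Z" "vs1.independent B1" "?Z \<subseteq> vs1.span B1" "card B1 = vs1.dim ?Z"
    using vs1.basis_exists[of ?Z] by blast
  obtain B where B: "B1 \<subseteq> B" "B \<subseteq> S" "vs1.independent B" "S \<subseteq> vs1.span B"
    using vs1.maximal_independent_subset_extend[of B1 S] B1 by auto
  define C where "C = B - B1"
  have fin: "finite B"
    using vs1.independent_span_bound[OF A(1) B(3)] B(2) A(2) by blast
  have spS: "vs1.span B = S"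
    using B S by (meson vs1.span_minimal subset_antisym)
  have C: "C \<subseteq> B" "vs1.independent C"
    using vs1.independent_mono[OF B(3)] by (auto simp: C_def)
  have inj: "inj_on f (vs1.span C)"
  proof (rule linear_inj_on_iff_eq_0[OF f, THEN iffD2])
    show "vs1.subspace (vs1.span C)" by simp
    show "\<forall>x\<in>vs1.span C. f x = 0 \<longrightarrow> x = 0"
    proof (intro ballI impI)
      fix x assume x: "x \<in> vs1.span C" "f x = 0"
      have "x \<in> S" using x(1) C(1) spS vs1.span_mono by blast
      then have "x \<in> vs1.span B1" using x(2) B1(3) by auto
      then show "x = 0"
        using x(1) vs1.span_Int_span_disjoint[of B1 C x] B(1,3) C_def
        by (metis Diff_disjoint Un_Diff_cancel subset_Un_eq)
    qed
  qed
  have ind: "vs2.independent (f ` C)"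
    by (rule linear_independent_injective_image[OF f C(2) inj])
  have sp: "f ` S = vs2.span (f ` C)"
  proof -
    have "f ` S = vs2.span (f ` B)" using linear_span_image[OF f, of B] spS by simp
    also have "\<dots> = vs2.span (f ` C)"
    proof (rule vs2.span_eq[THEN iffD2], intro conjI)
      show "f ` B \<subseteq> vs2.span (f ` C)"
      proof
        fix y assume "y \<in> f ` B"
        then obtain b where b: "b \<in> B" "y = f b" by auto
        show "y \<in> vs2.span (f ` C)"
          using b B1(1) by (cases "b \<in> B1") (auto simp: C_def vs2.span_zero intro: vs2.span_base)
      qed
      show "f ` C \<subseteq> vs2.span (f ` B)" using C(1) vs2.span_base by blast
    qed
    finally show ?thesis .
  qed
  have "vs2.dim (f ` S) = card (f ` C)" using sp vs2.dim_span_eq_card_independent[OF ind] by simp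
  also have "\<dots> = card C"
    by (rule card_image) (rule inj_on_subset[OF inj vs1.span_superset])
  finally have "vs2.dim (f ` S) = card C" .
  moreover have "vs1.dim S = card B" using vs1.dim_span_eq_card_independent[OF B(3)] spS by simp
  moreover have "card B = card B1 + card C"
    using fin B(1) by (simp add: C_def card_Diff_subset card_mono finite_subset)
  ultimately show ?thesis using B1(4) by simp
qed

global_interpretation fs_pair: vector_space_pair
  "fscale :: complex \<Rightarrow> ('x \<Rightarrow> complex) \<Rightarrow> 'x \<Rightarrow> complex"
  "fscale :: complex \<Rightarrow> ('y \<Rightarrow> complex) \<Rightarrow> 'y \<Rightarrow> complex"
  by unfold_locales

abbreviation lin :: "(('x \<Rightarrow> complex) \<Rightarrow> ('y \<Rightarrow> complex)) \<Rightarrow> bool" where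
  "lin \<equiv> Vector_Spaces.linear fscale fscale"

lemma linI:
  assumes "\<And>a b. f (a + b) = f a + f b" "\<And>c a. f (fscale c a) = fscale c (f a)"
  shows "lin f"
  by unfold_locales (simp_all add: assms)

lemmas lin_add = fs_pair.linear_add
lemmas lin_scale = fs_pair.linear_scale
lemmas lin_zero = fs_pair.linear_0
lemmas lin_diff = fs_pair.linear_diff
lemmas lin_sum = fs_pair.linear_sum

lemma lin_funpow:
  fixes f :: "('x \<Rightarrow> complex) \<Rightarrow> 'x \<Rightarrow> complex"
  assumes "lin f"
  shows "lin (f ^^ k)"
proof (induction k)
  case 0
  show "lin (f ^^ 0)" by (rule linI) simp_all
next
  case (Suc k)
  then have IH: "lin (f ^^ k)" .
  show "lin (f ^^ Suc k)"
    by (rule linI) (simp_all add: lin_add[OF assms] lin_scale[OF assms] lin_add[OF IH] lin_scale[OF IH])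
qed

lemma fscale_apply: "fscale c f x = c * f x"
  by (simp add: fscale_def)

text \<open>The induction methods eta-expand operators between function spaces, after which these rules
  would destroy the expressions inside them.\<close>

declare plus_fun_apply [simp del] zero_fun_apply [simp del] times_fun_apply [simp del]
  one_fun_apply [simp del] minus_apply [simp del] uminus_apply [simp del]

lemmas pointwise = fun_eq_iff fscale_apply plus_fun_apply zero_fun_apply times_fun_apply
  one_fun_apply minus_apply uminus_apply

lemma sum_fun_apply: "(\<Sum>i\<in>A. f i) x = (\<Sum>i\<in>A. (f i x :: 'b :: comm_monoid_add))"
  by (induction A rule: infinite_finite_induct) (auto simp: pointwise)

lemma prod_fun_apply: "(\<Prod>i\<in>A. f i) x = (\<Prod>i\<in>A. (f i x :: 'b :: comm_monoid_mult))"
  by (induction A rule: infinite_finite_induct) (auto simp: pointwise)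

text \<open>Each step is rank-nullity for \<open>f ^^ N\<close> on the kernel of
  \<open>f ^^ Suc N\<close>. A layer is recorded by its image under \<open>f ^^ i\<close>, which
  lies in the kernel of \<open>f\<close> and so can be compared with highest weight vectors.\<close>

lemma dim_funpow_filtration:
  fixes f :: "('x \<Rightarrow> complex) \<Rightarrow> 'x \<Rightarrow> complex"
  assumes f: "lin f" and S: "fs.subspace S" and A: "finite A" "S \<subseteq> fs.span A"
  shows "fs.dim {c \<in> S. (f ^^ N) c = 0} = (\<Sum>i<N. fs.dim ((f ^^ i) ` {c \<in> S. (f ^^ Suc i) c = 0}))"
proof (induction N)
  case 0
  have "{c \<in> S. c = 0} = fs.span {}" using fs.subspace_0[OF S] by auto
  then have "fs.dim {c \<in> S. c = 0} = 0"
    using fs.dim_span_eq_card_independent[OF fs.independent_empty] by (metis card.empty)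
  then show "fs.dim {c \<in> S. (f ^^ 0) c = 0} = (\<Sum>i<0. fs.dim ((f ^^ i) ` {c \<in> S. (f ^^ Suc i) c = 0}))" by simp
next
  case (Suc N)
  then have IH: "fs.dim {c \<in> S. (f ^^ N) c = 0} = (\<Sum>i<N. fs.dim ((f ^^ i) ` {c \<in> S. (f ^^ Suc i) c = 0}))" .
  let ?S = "{c \<in> S. (f ^^ Suc N) c = 0}"
  have g: "lin (f ^^ Suc N)" "lin (f ^^ N)" using lin_funpow[OF f] by blast+
  have sub: "fs.subspace ?S"
    using S by (auto simp: fs.subspace_def lin_add[OF g(1)] lin_scale[OF g(1)] lin_zero[OF g(1)]
        simp del: funpow.simps)
  have eq: "{c \<in> ?S. (f ^^ N) c = 0} = {c \<in> S. (f ^^ N) c = 0}"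
    using lin_zero[OF f] by auto
  have "fs.dim ?S = fs.dim {c \<in> ?S. (f ^^ N) c = 0} + fs.dim ((f ^^ N) ` ?S)"
    by (rule fs_pair.dim_eq_dim_kernel_plus_dim_image[OF g(2) sub A(1)]) (use A(2) in auto)
  then show "fs.dim {c \<in> S. (f ^^ Suc N) c = 0} = (\<Sum>i<Suc N. fs.dim ((f ^^ i) ` {c \<in> S. (f ^^ Suc i) c = 0}))" unfolding eq IH by simp
qed

lemma span_bilinear:
  assumes "\<And>a. lin (m a)" "\<And>b. lin (\<lambda>a. m a b)"
    and "f \<in> fs.span S" "g \<in> fs.span T"
  shows "m f g \<in> fs.span {m s t | s t. s \<in> S \<and> t \<in> T}"
proof -
  have 1: "m s g \<in> fs.span {m s t | s t. s \<in> S \<and> t \<in> T}" if "s \<in> S" for s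
  proof -
    have "m s g \<in> fs.span (m s ` T)"
      using assms(4) fs_pair.linear_span_image[OF assms(1)[of s], of T] by auto
    also have "\<dots> \<subseteq> fs.span {m s t | s t. s \<in> S \<and> t \<in> T}"
      by (rule fs.span_mono) (use that in auto)
    finally show ?thesis .
  qed
  have "m f g \<in> fs.span ((\<lambda>a. m a g) ` S)"
    using assms(3) fs_pair.linear_span_image[OF assms(2)[of g], of S] by auto
  also have "\<dots> \<subseteq> fs.span {m s t | s t. s \<in> S \<and> t \<in> T}"
    by (rule fs.span_minimal) (use 1 in auto)
  finally show ?thesis .
qed

lemma lin_times: "lin ((*) a)" "lin (\<lambda>b. b * a)"
  by (auto intro!: linI simp: pointwise algebra_simps)

text \<open>The coefficients of a polynomial are recovered from \<open>p (2 t) - 2 ^ d * p t\<close>, which has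
  degree less than \<open>d\<close>.\<close>

lemma coeff_in_subspace:
  assumes S: "fs.subspace S" and "\<And>t::complex. (\<Sum>j\<le>d. fscale (t ^ j) (c j)) \<in> S" and "j \<le> d"
  shows "c j \<in> S"
  using assms(2,3)
proof (induction d arbitrary: c j)
  case 0
  show ?case using "0.prems"(1)[of 1] "0.prems"(2) by simp
next
  case (Suc d)
  define c' where "c' j = fscale (2 ^ j - 2 ^ Suc d) (c j)" for j
  have "(\<Sum>j\<le>d. fscale (t ^ j) (c' j)) \<in> S" for t
  proof -
    have "(\<Sum>j\<le>d. fscale (t ^ j) (c' j)) = (\<Sum>j\<le>Suc d. fscale (t ^ j) (c' j))"
      by (simp add: c'_def)
    also have "\<dots> = (\<Sum>j\<le>Suc d. fscale ((2 * t) ^ j) (c j)) - fscale (2 ^ Suc d) (\<Sum>j\<le>Suc d. fscale (t ^ j) (c j))"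
      unfolding c'_def fs.scale_sum_right sum_subtractf[symmetric]
      by (rule sum.cong) (auto simp: pointwise algebra_simps)
    also have "\<dots> \<in> S"
      by (intro fs.subspace_diff fs.subspace_scale S Suc.prems)
    finally show ?thesis .
  qed
  then have c': "c' j \<in> S" if "j \<le> d" for j using Suc.IH that by blast
  have c: "c j \<in> S" if "j \<le> d" for j
  proof -
    have ne: "(2::complex) ^ j \<noteq> 2 ^ Suc d"
    proof
      assume "(2::complex) ^ j = 2 ^ Suc d"
      then have "of_nat (2 ^ j) = (of_nat (2 ^ Suc d) :: complex)" by simp
      then have "(2::nat) ^ j = 2 ^ Suc d" using of_nat_eq_iff by blast
      then show False using that power_inject_exp[of "2::nat" j "Suc d"] by simp
    qed
    have "fscale (inverse (2 ^ j - 2 ^ Suc d)) (c' j) = c j"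
      using ne by (auto simp: c'_def pointwise)
    then show ?thesis using fs.subspace_scale[OF S c'[OF that]] by metis
  qed
  show ?case
  proof (cases "j \<le> d")
    case True then show ?thesis by (rule c)
  next
    case False
    then have j: "j = Suc d" using Suc.prems by simp
    have "(\<Sum>j\<le>Suc d. c j) \<in> S" using Suc.prems(1)[of 1] by (simp only: power_one fs.scale_one)
    moreover have "(\<Sum>j\<le>d. c j) \<in> S" by (rule fs.subspace_sum[OF S]) (use c in auto)
    ultimately have "(\<Sum>j\<le>Suc d. c j) - (\<Sum>j\<le>d. c j) \<in> S" by (rule fs.subspace_diff[OF S])
    then show ?thesis using j by simp
  qed
qed

section \<open>Multiplication and differentiation of polynomials\<close>

text \<open>A polynomial is the function sending an exponent to its coefficient. The ring of such
  functions is not needed, only the Weyl algebra acting on them, and for its relations the supports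
  are irrelevant.\<close>

definition mul :: "'w \<Rightarrow> (('w \<Rightarrow> nat) \<Rightarrow> complex) \<Rightarrow> ('w \<Rightarrow> nat) \<Rightarrow> complex" where
  "mul w c = (\<lambda>\<alpha>. if \<alpha> w = 0 then 0 else c (\<alpha>(w := \<alpha> w - 1)))"

definition der :: "'w \<Rightarrow> (('w \<Rightarrow> nat) \<Rightarrow> complex) \<Rightarrow> ('w \<Rightarrow> nat) \<Rightarrow> complex" where
  "der w c = (\<lambda>\<alpha>. of_nat (\<alpha> w + 1) * c (\<alpha>(w := \<alpha> w + 1)))"

text \<open>The type \<open>'i + 'i\<close> indexes two groups of variables: \<open>Inl i\<close> is
  x_i, a coordinate of the first linear form, and \<open>Inr i\<close> is y_i, a coordinate of the
  second.\<close>

definition swap_vars :: "(('i + 'i \<Rightarrow> nat) \<Rightarrow> complex) \<Rightarrow> ('i + 'i \<Rightarrow> nat) \<Rightarrow> complex" where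
  "swap_vars c = (\<lambda>\<alpha>. c (\<alpha> \<circ> case_sum Inr Inl))"

lemma lin_mul: "lin (mul w)"
  by (rule linI) (auto simp: mul_def pointwise)

lemma lin_der: "lin (der w)"
  by (rule linI) (auto simp: der_def pointwise algebra_simps)

lemma lin_swap_vars: "lin swap_vars"
  by (rule linI) (auto simp: swap_vars_def pointwise)

lemma mul_mul: "mul w (mul v c) = mul v (mul w c)"
  by (cases "w = v") (auto simp: mul_def pointwise fun_upd_twist)

lemma der_der: "der w (der v c) = der v (der w c)"
  by (cases "w = v") (auto simp: der_def pointwise fun_upd_twist)

lemma der_mul: "w \<noteq> v \<Longrightarrow> der w (mul v c) = mul v (der w c)"
  by (auto simp: der_def mul_def pointwise fun_upd_twist)

lemma der_mul_same: "der w (mul w c) = mul w (der w c) + c"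
  by (auto simp: der_def mul_def pointwise algebra_simps of_nat_diff)

lemma mul_der_apply: "mul w (der w c) \<alpha> = of_nat (\<alpha> w) * c \<alpha>"
  by (auto simp: der_def mul_def pointwise algebra_simps of_nat_diff)

lemma case_sum_swap_upd:
  "(\<alpha>(Inl i := k)) \<circ> case_sum Inr Inl = (\<alpha> \<circ> case_sum Inr Inl)(Inr i := k)"
  "(\<alpha>(Inr i := k)) \<circ> case_sum Inr Inl = (\<alpha> \<circ> case_sum Inr Inl)(Inl i := k)"
  by (auto simp: pointwise split: sum.split)

lemma swap_vars_mul:
  "swap_vars (mul (Inl i) c) = mul (Inr i) (swap_vars c)"
  "swap_vars (mul (Inr i) c) = mul (Inl i) (swap_vars c)"
  by (auto simp: swap_vars_def mul_def pointwise case_sum_swap_upd)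

lemma swap_vars_swap_vars [simp]:
  fixes c :: "('i + 'i \<Rightarrow> nat) \<Rightarrow> complex"
  shows "swap_vars (swap_vars c) = c"
proof -
  have "\<alpha> \<circ> case_sum Inr Inl \<circ> case_sum Inr Inl = \<alpha>" for \<alpha> :: "'i + 'i \<Rightarrow> nat"
    by (auto simp: pointwise split: sum.split)
  then show ?thesis by (simp add: swap_vars_def)
qed

section \<open>Minors, sums and the differential operator dual to a minor\<close>

abbreviation "X i \<equiv> mul (Inl i)"
abbreviation "Y i \<equiv> mul (Inr i)"
abbreviation "DX i \<equiv> der (Inl i)"
abbreviation "DY i \<equiv> der (Inr i)"

definition Del :: "'i \<Rightarrow> 'i \<Rightarrow> (('i + 'i \<Rightarrow> nat) \<Rightarrow> complex) \<Rightarrow> ('i + 'i \<Rightarrow> nat) \<Rightarrow> complex" where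
  "Del i j c = X i (Y j c) - X j (Y i c)"

definition Sm :: "'i \<Rightarrow> 'i \<Rightarrow> (('i + 'i \<Rightarrow> nat) \<Rightarrow> complex) \<Rightarrow> ('i + 'i \<Rightarrow> nat) \<Rightarrow> complex" where
  "Sm i j c = X i (Y j c) + X j (Y i c)"

text \<open>Cayley's Omega operator, a minor in the partial derivatives. It undoes a multiplication
  by minors in Capelli's identity.\<close>

definition Om :: "'i \<Rightarrow> 'i \<Rightarrow> (('i + 'i \<Rightarrow> nat) \<Rightarrow> complex) \<Rightarrow> ('i + 'i \<Rightarrow> nat) \<Rightarrow> complex" where
  "Om i j c = DX i (DY j c) - DX j (DY i c)"

lemmas mul_lin = lin_add[OF lin_mul] lin_diff[OF lin_mul] lin_scale[OF lin_mul] lin_zero[OF lin_mul]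
lemmas der_lin = lin_add[OF lin_der] lin_diff[OF lin_der] lin_scale[OF lin_der] lin_zero[OF lin_der]
lemmas swap_lin = lin_add[OF lin_swap_vars] lin_diff[OF lin_swap_vars] lin_scale[OF lin_swap_vars]
  lin_zero[OF lin_swap_vars]
lemmas scale_simps = fs.scale_right_distrib fs.scale_right_diff_distrib fs.scale_scale

lemma lin_Del: "lin (Del i j)"
  by (rule linI) (simp_all add: Del_def mul_lin scale_simps)

lemma lin_Sm: "lin (Sm i j)"
  by (rule linI) (simp_all add: Sm_def mul_lin scale_simps)

lemma lin_Om: "lin (Om i j)"
  by (rule linI) (simp_all add: Om_def der_lin scale_simps)

lemma swap_vars_Del: "swap_vars (Del i j c) = - Del i j (swap_vars c)"
  by (simp add: Del_def swap_lin swap_vars_mul mul_mul[of "Inr _"])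

lemma swap_vars_Sm: "swap_vars (Sm i j c) = Sm i j (swap_vars c)"
  by (simp add: Sm_def swap_lin swap_vars_mul mul_mul[of "Inr _"])

lemma Del_Sm: "Del a b (Sm c d f) = Sm c d (Del a b f)"
  by (simp add: Del_def Sm_def mul_lin mul_mul)

text \<open>This identity is what allows minors to be traded for sums, two at a time.\<close>

lemma Del_Del: "Del a b (Del c d f) = Sm a d (Sm c b f) - Sm a c (Sm d b f)"
  by (simp add: Del_def Sm_def mul_lin mul_mul)

section \<open>The polarization operators and their commutators\<close>

locale coords =
  fixes I :: "'i set"
  assumes finite_I: "finite I"
begin

definition E :: "(('i + 'i \<Rightarrow> nat) \<Rightarrow> complex) \<Rightarrow> ('i + 'i \<Rightarrow> nat) \<Rightarrow> complex" where
  "E c = (\<Sum>i\<in>I. X i (DY i c))"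

definition F :: "(('i + 'i \<Rightarrow> nat) \<Rightarrow> complex) \<Rightarrow> ('i + 'i \<Rightarrow> nat) \<Rightarrow> complex" where
  "F c = (\<Sum>i\<in>I. Y i (DX i c))"

lemma lin_E: "lin E"
  by (rule linI) (simp_all add: E_def mul_lin der_lin sum.distrib fs.scale_sum_right)

lemma lin_F: "lin F"
  by (rule linI) (simp_all add: F_def mul_lin der_lin sum.distrib fs.scale_sum_right)

lemmas E_lin = lin_add[OF lin_E] lin_diff[OF lin_E] lin_scale[OF lin_E] lin_zero[OF lin_E]
lemmas F_lin = lin_add[OF lin_F] lin_diff[OF lin_F] lin_scale[OF lin_F] lin_zero[OF lin_F]

lemma der_mul_Kronecker: "der w (mul v c) = mul v (der w c) + (if w = v then c else 0)"
  by (simp add: der_mul der_mul_same)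

lemma E_X: "E (X j c) = X j (E c)"
  by (simp add: E_def lin_sum[OF lin_mul] der_mul mul_mul)

lemma F_Y: "F (Y j c) = Y j (F c)"
  by (simp add: F_def lin_sum[OF lin_mul] der_mul mul_mul)

lemma E_Y:
  assumes "j \<in> I"
  shows "E (Y j c) = Y j (E c) + X j c"
proof -
  have "X i (DY i (Y j c)) = Y j (X i (DY i c)) + (if i = j then X j c else 0)" for i
    by (simp add: der_mul_Kronecker mul_lin mul_mul)
  then show ?thesis
    using assms finite_I by (simp add: E_def lin_sum[OF lin_mul] sum.distrib sum.delta)
qed

lemma F_X:
  assumes "j \<in> I"
  shows "F (X j c) = X j (F c) + Y j c"
proof -
  have "Y i (DX i (X j c)) = X j (Y i (DX i c)) + (if i = j then Y j c else 0)" for i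
    by (simp add: der_mul_Kronecker mul_lin mul_mul)
  then show ?thesis
    using assms finite_I by (simp add: F_def lin_sum[OF lin_mul] sum.distrib sum.delta)
qed

lemma E_DY: "E (DY j c) = DY j (E c)"
  by (simp add: E_def lin_sum[OF lin_der] der_mul der_der)

lemma E_DX:
  assumes "j \<in> I"
  shows "E (DX j c) = DX j (E c) - DY j c"
proof -
  have "DX j (X i (DY i c)) = X i (DY i (DX j c)) + (if i = j then DY j c else 0)" for i
    by (auto simp: der_mul_Kronecker der_der[of "Inl j"])
  then show ?thesis
    using assms finite_I by (simp add: E_def lin_sum[OF lin_der] sum.distrib sum.delta)
qed

lemma E_Del: "i \<in> I \<Longrightarrow> j \<in> I \<Longrightarrow> E (Del i j c) = Del i j (E c)"
  by (simp add: Del_def E_lin E_X E_Y mul_lin mul_mul)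

lemma F_Del: "i \<in> I \<Longrightarrow> j \<in> I \<Longrightarrow> F (Del i j c) = Del i j (F c)"
  by (simp add: Del_def F_lin F_X F_Y mul_lin mul_mul)

text \<open>Minors are invariant under sl2 and commute with \<open>E\<close> and \<open>F\<close>. A
  sum is instead the middle vector of a three-dimensional representation with top vector x_i x_j,
  hence the extra term.\<close>

lemma E_Sm: "i \<in> I \<Longrightarrow> j \<in> I \<Longrightarrow> E (Sm i j c) = Sm i j (E c) + fscale 2 (X i (X j c))"
  by (simp add: Sm_def E_lin E_X E_Y mul_lin mul_mul pointwise)

lemma E_Om: "i \<in> I \<Longrightarrow> j \<in> I \<Longrightarrow> E (Om i j c) = Om i j (E c)"
  by (simp add: Om_def E_lin E_DX E_DY der_lin der_der)

section \<open>Bihomogeneous pieces, Euler's identities and the kernel of \<open>E\<close>\<close>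

definition mon :: "nat \<Rightarrow> nat \<Rightarrow> ('i + 'i \<Rightarrow> nat) set" where
  "mon p q = {\<alpha>. (\<forall>i. i \<notin> I \<longrightarrow> \<alpha> (Inl i) = 0 \<and> \<alpha> (Inr i) = 0) \<and>
     (\<Sum>i\<in>I. \<alpha> (Inl i)) = p \<and> (\<Sum>i\<in>I. \<alpha> (Inr i)) = q}"

definition T :: "nat \<Rightarrow> nat \<Rightarrow> (('i + 'i \<Rightarrow> nat) \<Rightarrow> complex) set" where
  "T p q = {c. \<forall>\<alpha>. c \<alpha> \<noteq> 0 \<longrightarrow> \<alpha> \<in> mon p q}"

lemma subspace_T: "fs.subspace (T p q)"
  by (auto simp: fs.subspace_def T_def pointwise) (metis add_0)

lemma mon_X_upd: "i \<in> I \<Longrightarrow> \<alpha>(Inl i := \<alpha> (Inl i) + 1) \<in> mon p q \<longleftrightarrow> p > 0 \<and> \<alpha> \<in> mon (p - 1) q"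
proof -
  assume i: "i \<in> I"
  have "(\<Sum>k\<in>I. (\<alpha>(Inl i := \<alpha> (Inl i) + 1)) (Inl k)) = (\<Sum>k\<in>I. \<alpha> (Inl k)) + 1"
    using i finite_I by (simp add: sum.remove[of I i])
  then show ?thesis using i by (auto simp: mon_def)
qed

lemma mon_Y_upd: "i \<in> I \<Longrightarrow> \<alpha>(Inr i := \<alpha> (Inr i) + 1) \<in> mon p q \<longleftrightarrow> q > 0 \<and> \<alpha> \<in> mon p (q - 1)"
proof -
  assume i: "i \<in> I"
  have "(\<Sum>k\<in>I. (\<alpha>(Inr i := \<alpha> (Inr i) + 1)) (Inr k)) = (\<Sum>k\<in>I. \<alpha> (Inr k)) + 1"
    using i finite_I by (simp add: sum.remove[of I i])
  then show ?thesis using i by (auto simp: mon_def)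
qed

lemma DX_T: "i \<in> I \<Longrightarrow> c \<in> T (Suc p) q \<Longrightarrow> DX i c \<in> T p q"
  unfolding T_def der_def using mon_X_upd[of i _ "Suc p" q] by auto

lemma DY_T: "i \<in> I \<Longrightarrow> c \<in> T p (Suc q) \<Longrightarrow> DY i c \<in> T p q"
  unfolding T_def der_def using mon_Y_upd[of i _ p "Suc q"] by auto

lemma DX_T_0: "i \<in> I \<Longrightarrow> c \<in> T 0 q \<Longrightarrow> DX i c = 0"
  unfolding T_def der_def using mon_X_upd[of i _ 0 q] by (auto simp: pointwise)

lemma DY_T_0: "i \<in> I \<Longrightarrow> c \<in> T p 0 \<Longrightarrow> DY i c = 0"
  unfolding T_def der_def using mon_Y_upd[of i _ p 0] by (auto simp: pointwise)

lemma X_T: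
  assumes "i \<in> I" "c \<in> T p q"
  shows "X i c \<in> T (Suc p) q"
proof -
  have "\<alpha> \<in> mon (Suc p) q" if "\<alpha> (Inl i) \<noteq> 0" "\<alpha>(Inl i := \<alpha> (Inl i) - 1) \<in> mon p q" for \<alpha>
    using mon_X_upd[of i "\<alpha>(Inl i := \<alpha> (Inl i) - 1)" "Suc p" q] that assms(1) by simp
  then show ?thesis using assms(2) by (auto simp: T_def mul_def)
qed

lemma Y_T:
  assumes "i \<in> I" "c \<in> T p q"
  shows "Y i c \<in> T p (Suc q)"
proof -
  have "\<alpha> \<in> mon p (Suc q)" if "\<alpha> (Inr i) \<noteq> 0" "\<alpha>(Inr i := \<alpha> (Inr i) - 1) \<in> mon p q" for \<alpha>
    using mon_Y_upd[of i "\<alpha>(Inr i := \<alpha> (Inr i) - 1)" p "Suc q"] that assms(1) by simp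
  then show ?thesis using assms(2) by (auto simp: T_def mul_def)
qed

lemma E_T: "c \<in> T p (Suc q) \<Longrightarrow> E c \<in> T (Suc p) q"
  unfolding E_def by (intro fs.subspace_sum[OF subspace_T] X_T DY_T) auto

lemma F_T: "c \<in> T (Suc p) q \<Longrightarrow> F c \<in> T p (Suc q)"
  unfolding F_def by (intro fs.subspace_sum[OF subspace_T] Y_T DX_T) auto

lemma E_T_0: "c \<in> T p 0 \<Longrightarrow> E c = 0"
  unfolding E_def by (intro sum.neutral) (auto simp: DY_T_0 mul_lin)

lemma F_T_0: "c \<in> T 0 q \<Longrightarrow> F c = 0"
  unfolding F_def by (intro sum.neutral) (auto simp: DX_T_0 mul_lin)

lemma Del_T: "i \<in> I \<Longrightarrow> j \<in> I \<Longrightarrow> c \<in> T p q \<Longrightarrow> Del i j c \<in> T (Suc p) (Suc q)"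
  unfolding Del_def by (intro fs.subspace_diff[OF subspace_T] X_T Y_T)

lemma Sm_T: "i \<in> I \<Longrightarrow> j \<in> I \<Longrightarrow> c \<in> T p q \<Longrightarrow> Sm i j c \<in> T (Suc p) (Suc q)"
  unfolding Sm_def by (intro fs.subspace_add[OF subspace_T] X_T Y_T)

lemma Om_T: "i \<in> I \<Longrightarrow> j \<in> I \<Longrightarrow> c \<in> T (Suc p) (Suc q) \<Longrightarrow> Om i j c \<in> T p q"
  unfolding Om_def by (intro fs.subspace_diff[OF subspace_T] DX_T DY_T)

lemma swap_vars_T:
  assumes "c \<in> T p q"
  shows "swap_vars c \<in> T q p"
proof -
  have "\<alpha> \<in> mon q p" if "\<alpha> \<circ> case_sum Inr Inl \<in> mon p q" for \<alpha>
    using that by (auto simp: mon_def)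
  then show ?thesis using assms by (auto simp: T_def swap_vars_def)
qed

lemma Euler_X:
  assumes "c \<in> T p q"
  shows "(\<Sum>i\<in>I. X i (DX i c)) = fscale (of_nat p) c"
proof
  fix \<alpha>
  have "(\<Sum>i\<in>I. X i (DX i c)) \<alpha> = of_nat (\<Sum>i\<in>I. \<alpha> (Inl i)) * c \<alpha>"
    by (simp add: sum_fun_apply mul_der_apply sum_distrib_right)
  then show "(\<Sum>i\<in>I. X i (DX i c)) \<alpha> = fscale (of_nat p) c \<alpha>"
    using assms by (cases "c \<alpha> = 0") (auto simp: T_def mon_def pointwise)
qed

lemma Euler_Y:
  assumes "c \<in> T p q"
  shows "(\<Sum>i\<in>I. Y i (DY i c)) = fscale (of_nat q) c"
proof
  fix \<alpha>
  have "(\<Sum>i\<in>I. Y i (DY i c)) \<alpha> = of_nat (\<Sum>i\<in>I. \<alpha> (Inr i)) * c \<alpha>"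
    by (simp add: sum_fun_apply mul_der_apply sum_distrib_right)
  then show "(\<Sum>i\<in>I. Y i (DY i c)) \<alpha> = fscale (of_nat q) c \<alpha>"
    using assms by (cases "c \<alpha> = 0") (auto simp: T_def mon_def pointwise)
qed

text \<open>The relation [E, F] = H of sl2, where H is the difference of the Euler operators in x
  and in y.\<close>

lemma E_F:
  assumes "c \<in> T p q"
  shows "E (F c) = F (E c) + fscale (of_nat p - of_nat q) c"
proof -
  have "E (F c) = (\<Sum>j\<in>I. Y j (E (DX j c)) + X j (DX j c))"
    by (simp add: F_def lin_sum[OF lin_E] E_Y)
  also have "\<dots> = (\<Sum>j\<in>I. Y j (DX j (E c)) - Y j (DY j c) + X j (DX j c))"
    by (intro sum.cong) (auto simp: E_DX mul_lin)
  also have "\<dots> = F (E c) - fscale (of_nat q) c + fscale (of_nat p) c"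
    by (simp add: F_def sum.distrib sum_subtractf Euler_X[OF assms] Euler_Y[OF assms])
  finally show ?thesis by (simp add: fs.scale_left_diff_distrib)
qed

text \<open>The product splits into four terms. The two sums of \<open>A\<close> are products of
  Euler operators and give p q each. The crossed sums of \<open>B\<close> reorder into
  \<open>F (E c)\<close> minus the Euler operator in y, that is -q each because
  \<open>E c = 0\<close>. The total 2 p q + 2 q is the constant.\<close>

lemma Capelli_identity:
  assumes c: "c \<in> T p q" and E: "E c = 0"
  shows "(\<Sum>i\<in>I. \<Sum>j\<in>I. Del i j (Om i j c)) = fscale (of_nat (2 * Suc p * q)) c"
proof -
  define A where "A i j = X i (Y j (DX i (DY j c)))" for i j
  define B where "B i j = X i (Y j (DX j (DY i c)))" for i j
  have "(\<Sum>j\<in>I. A i j) = X i (DX i (fscale (of_nat q) c))" for i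
    unfolding Euler_Y[OF c, symmetric] A_def
    by (simp add: lin_sum[OF lin_mul] lin_sum[OF lin_der] der_mul)
  then have "(\<Sum>i\<in>I. \<Sum>j\<in>I. A i j) = fscale (of_nat q) (\<Sum>i\<in>I. X i (DX i c))"
    by (simp add: mul_lin der_lin fs.scale_sum_right)
  then have A: "(\<Sum>i\<in>I. \<Sum>j\<in>I. A i j) = fscale (of_nat (p * q)) c"
    by (simp add: Euler_X[OF c] mult.commute)
  have "B i j = Y j (DX j (X i (DY i c))) - (if i = j then Y i (DY i c) else 0)" for i j
    by (auto simp: B_def der_mul_Kronecker mul_lin mul_mul[of "Inr _"])
  then have "(\<Sum>i\<in>I. \<Sum>j\<in>I. B i j) =
      (\<Sum>i\<in>I. \<Sum>j\<in>I. Y j (DX j (X i (DY i c)))) - (\<Sum>i\<in>I. Y i (DY i c))"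
    using finite_I by (simp add: sum_subtractf)
  also have "(\<Sum>i\<in>I. \<Sum>j\<in>I. Y j (DX j (X i (DY i c)))) = F (E c)"
    by (subst sum.swap) (simp add: F_def E_def lin_sum[OF lin_mul] lin_sum[OF lin_der])
  finally have B: "(\<Sum>i\<in>I. \<Sum>j\<in>I. B i j) = - fscale (of_nat q) c"
    by (simp add: E F_lin Euler_Y[OF c])
  have "Del i j (Om i j c) = A i j - B i j - B j i + A j i" for i j
    by (simp add: Del_def Om_def A_def B_def mul_lin der_der)
  then have "(\<Sum>i\<in>I. \<Sum>j\<in>I. Del i j (Om i j c)) =
      (\<Sum>i\<in>I. \<Sum>j\<in>I. A i j) - (\<Sum>i\<in>I. \<Sum>j\<in>I. B i j) -
      (\<Sum>i\<in>I. \<Sum>j\<in>I. B j i) + (\<Sum>i\<in>I. \<Sum>j\<in>I. A j i)"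
    by (simp add: sum.distrib sum_subtractf)
  also have "(\<Sum>i\<in>I. \<Sum>j\<in>I. B j i) = (\<Sum>i\<in>I. \<Sum>j\<in>I. B i j)"
    by (rule sum.swap)
  also have "(\<Sum>i\<in>I. \<Sum>j\<in>I. A j i) = (\<Sum>i\<in>I. \<Sum>j\<in>I. A i j)"
    by (rule sum.swap)
  finally show ?thesis
    unfolding A B by (simp add: pointwise algebra_simps)
qed

text \<open>The span of the products of b minors with a polynomial of degree a - b in x alone. As an
  inductive predicate it turns statements about the kernel of \<open>E\<close> into inductions on
  the number of minors.\<close>

inductive P :: "nat \<Rightarrow> nat \<Rightarrow> (('i + 'i \<Rightarrow> nat) \<Rightarrow> complex) \<Rightarrow> bool" where
  base: "c \<in> T a 0 \<Longrightarrow> P a 0 c"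
| zero: "P a b 0"
| add: "P a b c \<Longrightarrow> P a b d \<Longrightarrow> P a b (c + d)"
| scale: "P a b c \<Longrightarrow> P a b (fscale k c)"
| del: "P a b c \<Longrightarrow> i \<in> I \<Longrightarrow> j \<in> I \<Longrightarrow> P (Suc a) (Suc b) (Del i j c)"

lemma P_sum: "(\<And>x. x \<in> A \<Longrightarrow> P a b (f x)) \<Longrightarrow> P a b (sum f A)"
  by (induction A rule: infinite_finite_induct) (auto intro: P.intros)

text \<open>Since \<open>Om\<close> commutes with \<open>E\<close>, Capelli's identity writes
  \<open>c\<close>, up to a scalar that is nonzero for b > 0, as a sum of minors times kernel
  elements of smaller bidegree.\<close>

lemma E_zero_imp_P: "c \<in> T a b \<Longrightarrow> E c = 0 \<Longrightarrow> P a b c"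
proof (induction b arbitrary: a c)
  case 0
  then show ?case by (simp add: P.base)
next
  case (Suc b)
  show ?case
  proof (cases a)
    \<comment> \<open>Without any x to differentiate, \<open>Om\<close> gives 0, and Capelli's
      identity forces \<open>c = 0\<close>.\<close>
    case a: 0
    have "DY j c \<in> T 0 b" if "j \<in> I" for j using DY_T that Suc.prems a by blast
    then have "Om i j c = 0" if "i \<in> I" "j \<in> I" for i j
      using that by (simp add: Om_def DX_T_0[of _ _ b])
    then have "(\<Sum>i\<in>I. \<Sum>j\<in>I. Del i j (Om i j c)) = 0"
      by (auto intro!: sum.neutral simp: lin_zero[OF lin_Del])
    then have "fscale (of_nat (2 * Suc a * Suc b)) c = 0" using Capelli_identity[OF Suc.prems] by simp
    then have "c = 0" by (simp only: fs.scale_eq_0_iff of_nat_eq_0_iff) simp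
    then show ?thesis by (simp add: P.zero)
  next
    case a: (Suc a')
    have "P a (Suc b) (\<Sum>i\<in>I. \<Sum>j\<in>I. Del i j (Om i j c))"
      unfolding a
    proof (intro P_sum P.del)
      fix i j assume ij: "i \<in> I" "j \<in> I"
      show "P a' b (Om i j c)"
      proof (rule Suc.IH)
        show "Om i j c \<in> T a' b" using ij Suc.prems a by (auto intro: Om_T)
        show "E (Om i j c) = 0" using ij Suc.prems(2) by (simp add: E_Om lin_zero[OF lin_Om])
      qed
    qed auto
    then have "P a (Suc b) (fscale (of_nat (2 * Suc a * Suc b)) c)"
      using Capelli_identity[OF Suc.prems] by simp
    then have "P a (Suc b) (fscale (inverse (of_nat (2 * Suc a * Suc b))) (fscale (of_nat (2 * Suc a * Suc b)) c))"
      by (rule P.scale)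
    then show ?thesis by (simp only: fs.scale_scale) (simp del: of_nat_mult of_nat_Suc)
  qed
qed

section \<open>Powers of the operators and highest weight vectors\<close>

lemma F_pow_Del: "i \<in> I \<Longrightarrow> j \<in> I \<Longrightarrow> (F ^^ k) (Del i j c) = Del i j ((F ^^ k) c)"
  by (induction k) (auto simp: F_Del)

lemma E_pow_Del: "i \<in> I \<Longrightarrow> j \<in> I \<Longrightarrow> (E ^^ k) (Del i j c) = Del i j ((E ^^ k) c)"
  by (induction k) (auto simp: E_Del)

text \<open>The Leibniz rule for a power of a derivation; it stops after the first order because
  \<open>F\<close> applied twice kills x_a. In \<open>E_pow_Sm\<close> it stops for the same
  reason.\<close>

lemma F_pow_X:
  assumes "a \<in> I"
  shows "(F ^^ Suc j) (X a c) = X a ((F ^^ Suc j) c) + fscale (of_nat (Suc j)) (Y a ((F ^^ j) c))"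
proof (induction j)
  case 0
  then show ?case using assms by (simp add: F_X)
next
  case (Suc j)
  have "(F ^^ Suc (Suc j)) (X a c) =
      F (X a ((F ^^ Suc j) c) + fscale (of_nat (Suc j)) (Y a ((F ^^ j) c)))"
    using Suc by simp
  then show ?case using assms by (simp add: F_X F_lin F_Y pointwise algebra_simps)
qed

lemma E_pow_Sm:
  assumes "a \<in> I" "b \<in> I"
  shows "(E ^^ Suc j) (Sm a b c) = Sm a b ((E ^^ Suc j) c) + fscale (of_nat (2 * Suc j)) (X a (X b ((E ^^ j) c)))"
proof (induction j)
  case 0
  then show ?case using assms by (simp add: E_Sm)
next
  case (Suc j)
  have "(E ^^ Suc (Suc j)) (Sm a b c) =
      E (Sm a b ((E ^^ Suc j) c) + fscale (of_nat (2 * Suc j)) (X a (X b ((E ^^ j) c))))"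
    using Suc by simp
  then show ?case using assms by (simp add: E_Sm E_lin E_X pointwise algebra_simps)
qed

lemma F_pow_T: "c \<in> T a b \<Longrightarrow> j \<le> a \<Longrightarrow> (F ^^ j) c \<in> T (a - j) (b + j)"
proof (induction j)
  case (Suc j)
  then have "(F ^^ j) c \<in> T (Suc (a - Suc j)) (b + j)" by (simp add: Suc_diff_Suc)
  then show ?case using F_T[of "(F ^^ j) c" "a - Suc j" "b + j"] by simp
qed simp

lemma E_pow_T: "c \<in> T a b \<Longrightarrow> j \<le> b \<Longrightarrow> (E ^^ j) c \<in> T (a + j) (b - j)"
proof (induction j)
  case (Suc j)
  then have "(E ^^ j) c \<in> T (a + j) (Suc (b - Suc j))" by (simp add: Suc_diff_Suc)
  then show ?case using E_T[of "(E ^^ j) c" "a + j" "b - Suc j"] by simp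
qed simp

lemma F_pow_T_0: "c \<in> T a b \<Longrightarrow> (F ^^ Suc a) c = 0"
  using F_pow_T[of c a b a] F_T_0 by simp

lemma E_pow_T_0: "c \<in> T a b \<Longrightarrow> (E ^^ Suc b) c = 0"
  using E_pow_T[of c a b b] E_T_0 by simp

text \<open>The standard sl2 formula for a highest weight vector of weight a - b; each further
  \<open>F\<close> adds the weight of the vector reached so far to the scalar.\<close>

lemma E_F_pow:
  assumes g: "g \<in> T a b" "E g = 0"
  shows "j < a \<Longrightarrow> E ((F ^^ Suc j) g) =
    fscale (of_nat (Suc j) * (of_nat a - of_nat b - of_nat j)) ((F ^^ j) g)"
proof (induction j)
  case 0
  then show ?case using E_F[OF g(1)] g(2) by (simp add: F_lin)
next
  case (Suc j)
  have T: "(F ^^ Suc j) g \<in> T (a - Suc j) (b + Suc j)"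
    using F_pow_T[OF g(1), of "Suc j"] Suc.prems by simp
  have "E ((F ^^ Suc (Suc j)) g) = F (E ((F ^^ Suc j) g)) +
      fscale (of_nat (a - Suc j) - of_nat (b + Suc j)) ((F ^^ Suc j) g)"
    using E_F[OF T] by simp
  also have "F (E ((F ^^ Suc j) g)) =
      fscale (of_nat (Suc j) * (of_nat a - of_nat b - of_nat j)) ((F ^^ Suc j) g)"
    using Suc by (simp add: F_lin)
  also have "\<dots> + fscale (of_nat (a - Suc j) - of_nat (b + Suc j)) ((F ^^ Suc j) g) =
      fscale (of_nat (Suc (Suc j)) * (of_nat a - of_nat b - of_nat (Suc j))) ((F ^^ Suc j) g)"
    using Suc.prems by (simp only: fs.scale_left_distrib[symmetric])
      (simp add: of_nat_diff algebra_simps)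
  finally show ?case .
qed

text \<open>The scalar is the product of the factors (j + 1) (a - b - j) for j < i, all nonzero
  since i is at most the weight. So \<open>F ^^ i\<close> provides explicit preimages under
  \<open>E ^^ i\<close>.\<close>

lemma E_pow_F_pow:
  assumes g: "g \<in> T a b" "E g = 0"
  shows "b + i \<le> a \<Longrightarrow> \<exists>k. k \<noteq> 0 \<and> (E ^^ i) ((F ^^ i) g) = fscale k g"
proof (induction i)
  case 0
  show ?case by (rule exI[of _ 1]) simp
next
  case (Suc i)
  then obtain k where k: "k \<noteq> 0" "(E ^^ i) ((F ^^ i) g) = fscale k g" by auto
  let ?k = "of_nat (Suc i) * (of_nat a - of_nat b - of_nat i) :: complex"
  have "(of_nat a - of_nat b - of_nat i :: complex) = of_nat (a - b - i)"
    using Suc.prems by (simp add: of_nat_diff)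
  then have "?k \<noteq> 0" using Suc.prems by (simp only: mult_eq_0_iff of_nat_eq_0_iff) simp
  moreover have "(E ^^ Suc i) ((F ^^ Suc i) g) = (E ^^ i) (E ((F ^^ Suc i) g))"
    by (simp only: funpow_Suc_right o_apply)
  then have "(E ^^ Suc i) ((F ^^ Suc i) g) = fscale (?k * k) g"
    using E_F_pow[OF g, of i] Suc.prems k
    by (simp add: lin_scale[OF lin_funpow[OF lin_E]] del: funpow.simps)
  ultimately show ?case using k(1) by (intro exI[of _ "?k * k"]) simp
qed

section \<open>Parity under the exchange of x and y\<close>

definition one :: "('i + 'i \<Rightarrow> nat) \<Rightarrow> complex" where
  "one = (\<lambda>\<alpha>. if \<alpha> = (\<lambda>_. 0) then 1 else 0)"

lemma one_T: "one \<in> T 0 0"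
  by (auto simp: one_def T_def mon_def)

lemma mon_0_0: "\<alpha> \<in> mon 0 0 \<Longrightarrow> \<alpha> = (\<lambda>_. 0)"
proof
  fix w assume "\<alpha> \<in> mon 0 0"
  then show "\<alpha> w = 0"
    using finite_I by (cases w; cases "projl w \<in> I"; cases "projr w \<in> I") (auto simp: mon_def)
qed

lemma T_0_0:
  assumes "g \<in> T 0 0"
  shows "g = fscale (g (\<lambda>_. 0)) one"
proof
  fix \<alpha>
  have "g \<alpha> = 0" if "\<alpha> \<noteq> (\<lambda>_. 0)" using assms mon_0_0 that unfolding T_def by blast
  then show "g \<alpha> = fscale (g (\<lambda>_. 0)) one \<alpha>"
    by (cases "\<alpha> = (\<lambda>_. 0)") (auto simp: one_def fscale_apply)
qed

lemma swap_vars_one: "swap_vars one = one"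
  using T_0_0[OF swap_vars_T[OF one_T]] by (simp add: swap_vars_def one_def comp_def)

text \<open>\<open>F ^^ u\<close> applied to g, divided by u!, is the coefficient of t^u in g(x + t
  y). Exchanging x and y gives g(y + t x) = t^d g(x + y / t), which reverses the order of the
  coefficients. The induction on the degree avoids this expansion by reducing to products x_a
  g'.\<close>

lemma F_pow_swap_vars:
  "g \<in> T d 0 \<Longrightarrow> u + v = d \<Longrightarrow>
    fscale (fact v) ((F ^^ u) g) = fscale (fact u) (swap_vars ((F ^^ v) g))"
proof (induction d arbitrary: g u v)
  case 0
  then have "g = fscale (g (\<lambda>_. 0)) one" by (intro T_0_0)
  then have "swap_vars g = g" by (metis lin_scale[OF lin_swap_vars] swap_vars_one)
  then show ?case using 0 by simp
next
  case (Suc d)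
  have main: "fscale (fact v) ((F ^^ u) (X a g')) = fscale (fact u) (swap_vars ((F ^^ v) (X a g')))"
    if a: "a \<in> I" and g': "g' \<in> T d 0" for a g'
  proof -
    have top: "(F ^^ Suc d) g' = 0" by (rule F_pow_T_0[OF g'])
    \<comment> \<open>The extreme cases u = 0 and v = 0 are treated apart, as the Leibniz rule has
      two terms only for positive powers. Here \<open>top\<close> removes one of them.\<close>
    have top': "fscale (fact (Suc d)) (X a g') = swap_vars ((F ^^ Suc d) (X a g'))"
    proof -
      have "fscale (fact d) g' = swap_vars ((F ^^ d) g')" using Suc.IH[OF g', of 0 d] by simp
      then have "X a (fscale (fact d) g') = X a (swap_vars ((F ^^ d) g'))" by (rule arg_cong)
      then show ?thesis
        unfolding F_pow_X[OF a] top
        by (simp add: mul_lin swap_lin swap_vars_mul del: fs.scale_scale add: fs.scale_scale[symmetric])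
    qed
    show ?thesis
    proof (cases u)
      case 0
      then show ?thesis using top' Suc.prems(2) by simp
    next
      case u: (Suc u')
      show ?thesis
      proof (cases v)
        case 0
        have "swap_vars (fscale (fact (Suc d)) (X a g')) = (F ^^ Suc d) (X a g')"
          unfolding top' by simp
        then show ?thesis using 0 Suc.prems(2) by (simp add: swap_lin)
      next
        case v: (Suc v')
        have 1: "fscale (fact v') ((F ^^ u) g') = fscale (fact u) (swap_vars ((F ^^ v') g'))"
          by (rule Suc.IH[OF g']) (use u v Suc.prems(2) in simp)
        have 2: "fscale (fact v) ((F ^^ u') g') = fscale (fact u') (swap_vars ((F ^^ v) g'))"
          by (rule Suc.IH[OF g']) (use u v Suc.prems(2) in simp)
        have "fscale (fact v) ((F ^^ u) (X a g')) =
            fscale (of_nat v) (X a (fscale (fact v') ((F ^^ u) g'))) +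
            fscale (of_nat u) (Y a (fscale (fact v) ((F ^^ u') g')))"
          unfolding u F_pow_X[OF a] unfolding v by (simp add: mul_lin pointwise algebra_simps)
        also have "\<dots> = fscale (of_nat v) (X a (fscale (fact u) (swap_vars ((F ^^ v') g')))) +
            fscale (of_nat u) (Y a (fscale (fact u') (swap_vars ((F ^^ v) g'))))"
          unfolding 1 2 ..
        also have "\<dots> = fscale (fact u) (swap_vars ((F ^^ v) (X a g')))"
          unfolding v F_pow_X[OF a] unfolding u
          by (simp add: mul_lin swap_lin swap_vars_mul pointwise algebra_simps)
        finally show ?thesis .
      qed
    qed
  qed
  \<comment> \<open>Euler's identity recovers g, up to the nonzero factor d + 1, from the products
    already treated.\<close>
  have "fscale (fact v) ((F ^^ u) (\<Sum>i\<in>I. X i (DX i g))) =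
      fscale (fact u) (swap_vars ((F ^^ v) (\<Sum>i\<in>I. X i (DX i g))))"
    unfolding lin_sum[OF lin_funpow[OF lin_F]] lin_sum[OF lin_swap_vars] fs.scale_sum_right
    by (intro sum.cong main DX_T Suc.prems(1) refl)
  then have "fscale (fact v) ((F ^^ u) (fscale (of_nat (Suc d)) g)) =
      fscale (fact u) (swap_vars ((F ^^ v) (fscale (of_nat (Suc d)) g)))"
    unfolding Euler_X[OF Suc.prems(1)] .
  then have "fscale (of_nat (Suc d)) (fscale (fact v) ((F ^^ u) g)) =
      fscale (of_nat (Suc d)) (fscale (fact u) (swap_vars ((F ^^ v) g)))"
    unfolding lin_scale[OF lin_funpow[OF lin_F]] swap_lin
    by (simp add: mult.commute del: of_nat_Suc)
  then show ?case by (simp only: fs.scale_cancel_left of_nat_eq_0_iff) simp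
qed

text \<open>\<open>F ^^ i\<close> moves the element to equal degrees in x and y. Each of the b
  minors changes sign under the exchange, while the factor in x alone becomes symmetric by
  \<open>F_pow_swap_vars\<close> with u = v = i.\<close>

lemma P_F_pow_parity:
  "P a b g \<Longrightarrow> a = b + 2 * i \<Longrightarrow> swap_vars ((F ^^ i) g) = fscale ((-1) ^ b) ((F ^^ i) g)"
proof (induction rule: P.induct)
  case (base c a)
  then have "fscale (fact i) ((F ^^ i) c) = fscale (fact i) (swap_vars ((F ^^ i) c))"
    by (intro F_pow_swap_vars[of c a]) auto
  then show ?case by simp
next
  case (zero a b)
  then show ?case by (simp add: lin_zero[OF lin_funpow[OF lin_F]] swap_lin)
next
  case (add a b c d)
  then show ?case by (simp add: lin_add[OF lin_funpow[OF lin_F]] swap_lin scale_simps)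
next
  case (scale a b c k)
  then show ?case by (simp add: lin_scale[OF lin_funpow[OF lin_F]] swap_lin mult.commute)
next
  case (del a b c i' j')
  then show ?case by (simp add: F_pow_Del swap_vars_Del lin_scale[OF lin_Del])
qed

text \<open>For a polynomial \<open>f\<close> the coefficient of \<open>t\<^sup>j\<close> in \<open>f(x, x + t z)\<close> is a multiple of
  \<open>E\<^sup>m\<^sup>-\<^sup>j f\<close>, so this says that the leading term of \<open>f\<close> along the diagonal, of order \<open>j\<close>, is
  multiplied by \<open>(-1)\<^sup>j\<close> when the two arguments of \<open>f\<close> are exchanged.\<close>

lemma E_pow_swap_vars:
  assumes stable: "\<And>f. f \<in> T m m \<Longrightarrow> (E ^^ i) f = 0 \<Longrightarrow> (E ^^ i) (swap_vars f) = 0"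
    and f: "f \<in> T m m" "(E ^^ Suc i) f = 0" and i: "i \<le> m"
  shows "(E ^^ i) (swap_vars f) = fscale ((-1) ^ (m - i)) ((E ^^ i) f)"
proof -
  define g where "g = (E ^^ i) f"
  have g: "g \<in> T (m + i) (m - i)" "E g = 0"
    using E_pow_T[OF f(1) i] f(2) by (simp_all add: g_def)
  obtain k where k: "k \<noteq> 0" "(E ^^ i) ((F ^^ i) g) = fscale k g"
    using E_pow_F_pow[OF g, of i] by auto
  have par: "swap_vars ((F ^^ i) g) = fscale ((-1) ^ (m - i)) ((F ^^ i) g)"
    by (rule P_F_pow_parity[OF E_zero_imp_P[OF g]]) (use i in simp)
  \<comment> \<open>Subtract from f an explicit preimage of its leading term. The preimage has known
    parity, and the rest lies in the kernel of \<open>E ^^ i\<close>, where \<open>stable\<close>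
    applies.\<close>
  define f' where "f' = f - fscale (1 / k) ((F ^^ i) g)"
  have "f' \<in> T m m"
    unfolding f'_def using F_pow_T[OF g(1), of i] i f(1)
    by (intro fs.subspace_diff[OF subspace_T] fs.subspace_scale[OF subspace_T]) auto
  moreover have "(E ^^ i) f' = 0"
    using k by (simp add: f'_def lin_diff[OF lin_funpow[OF lin_E]] lin_scale[OF lin_funpow[OF lin_E]] g_def)
  ultimately have "(E ^^ i) (swap_vars f') = 0" by (rule stable)
  moreover have "f = f' + fscale (1 / k) ((F ^^ i) g)" by (simp add: f'_def)
  then have "(E ^^ i) (swap_vars f) = (E ^^ i) (swap_vars f') + fscale (1 / k * (-1) ^ (m - i)) ((E ^^ i) ((F ^^ i) g))"
    by (simp add: swap_lin par lin_add[OF lin_funpow[OF lin_E]] lin_scale[OF lin_funpow[OF lin_E]])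
  ultimately show ?thesis using k by (simp add: g_def)
qed

text \<open>Stability of the kernel of \<open>E ^^ i\<close> and the sign rule of
  \<open>E_pow_swap_vars\<close> feed each other: stability at i gives the sign at i, and the sign
  gives stability at i + 1.\<close>

lemma E_pow_swap_vars_0:
  "i \<le> Suc m \<Longrightarrow> f \<in> T m m \<Longrightarrow> (E ^^ i) f = 0 \<Longrightarrow> (E ^^ i) (swap_vars f) = 0"
proof (induction i arbitrary: f)
  case 0
  then show ?case by (simp add: swap_lin)
next
  case (Suc i)
  have "(E ^^ i) (swap_vars f) = fscale ((-1) ^ (m - i)) ((E ^^ i) f)"
    by (rule E_pow_swap_vars) (use Suc in auto)
  then have "E ((E ^^ i) (swap_vars f)) = fscale ((-1) ^ (m - i)) (E ((E ^^ i) f))"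
    by (simp add: E_lin)
  then show ?case using Suc.prems(3) by simp
qed

text \<open>The symmetry of f and the order of its leading term prescribe opposite signs, so that
  term is its own negative. This is the origin of the congruence modulo 2.\<close>

lemma E_pow_parity:
  assumes f: "f \<in> T m m" "(E ^^ Suc i) f = 0" and i: "i \<le> m"
    and sg: "swap_vars f = fscale ((-1) ^ k) f" and odd: "odd (m - i + k)"
  shows "(E ^^ i) f = 0"
proof -
  have "(E ^^ i) (swap_vars f) = fscale ((-1) ^ (m - i)) ((E ^^ i) f)"
    by (rule E_pow_swap_vars) (use E_pow_swap_vars_0[of i m] assms in auto)
  then have "fscale ((-1) ^ k) ((E ^^ i) f) = fscale ((-1) ^ (m - i)) ((E ^^ i) f)"
    by (simp add: sg lin_scale[OF lin_funpow[OF lin_E]])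
  moreover have "(-1 :: complex) ^ k \<noteq> (-1) ^ (m - i)"
    using odd by (cases "even k") auto
  ultimately show ?thesis by (simp add: fs.scale_cancel_right)
qed

section \<open>The spans \<open>G k l\<close> of products of k minors and l sums\<close>

inductive G :: "nat \<Rightarrow> nat \<Rightarrow> (('i + 'i \<Rightarrow> nat) \<Rightarrow> complex) \<Rightarrow> bool" where
  one: "G 0 0 one"
| zero: "G k l 0"
| add: "G k l c \<Longrightarrow> G k l d \<Longrightarrow> G k l (c + d)"
| scale: "G k l c \<Longrightarrow> G k l (fscale z c)"
| del: "G k l c \<Longrightarrow> i \<in> I \<Longrightarrow> j \<in> I \<Longrightarrow> G (Suc k) l (Del i j c)"
| sm: "G k l c \<Longrightarrow> i \<in> I \<Longrightarrow> j \<in> I \<Longrightarrow> G k (Suc l) (Sm i j c)"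

lemma G_diff: "G k l c \<Longrightarrow> G k l d \<Longrightarrow> G k l (c - d)"
  using G.add[OF _ G.scale[of k l d "-1"], of c] by simp

lemma G_sum: "(\<And>x. x \<in> A \<Longrightarrow> G k l (f x)) \<Longrightarrow> G k l (sum f A)"
  by (induction A rule: infinite_finite_induct) (auto intro: G.intros)

lemma G_T: "G k l c \<Longrightarrow> c \<in> T (k + l) (k + l)"
  by (induction rule: G.induct)
    (auto intro: fs.subspace_0 fs.subspace_add fs.subspace_scale subspace_T Del_T Sm_T one_T)

lemma G_swap_vars: "G k l c \<Longrightarrow> swap_vars c = fscale ((-1) ^ k) c"
proof (induction rule: G.induct)
  case one
  then show ?case by (simp add: swap_vars_one)
next
  case (scale k l c z)
  then show ?case by (simp add: swap_lin mult.commute)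
next
  case (del k l c i j)
  then show ?case by (simp add: swap_vars_Del lin_scale[OF lin_Del])
qed (simp_all add: swap_lin scale_simps swap_vars_Sm lin_scale[OF lin_Sm])

text \<open>A minor commutes with \<open>E\<close>, and a sum raises the order of nilpotency by at
  most one, by \<open>E_pow_Sm\<close>. With total degree k + l this says that f vanishes to order
  at least k on the diagonal.\<close>

lemma G_E_pow: "G k l c \<Longrightarrow> (E ^^ Suc l) c = 0"
proof (induction rule: G.induct)
  case one
  then show ?case using E_T_0[OF one_T] by simp
next
  case (sm k l c i j)
  then show ?case
    by (simp add: E_pow_Sm E_lin lin_zero[OF lin_Sm] mul_lin del: funpow.simps)
      (simp add: E_lin lin_zero[OF lin_Sm])
qed (simp_all only: E_pow_Del lin_zero[OF lin_Del] lin_zero[OF lin_funpow[OF lin_E]]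
    lin_add[OF lin_funpow[OF lin_E]] lin_scale[OF lin_funpow[OF lin_E]] fs.scale_zero_right add_0)

lemma G_one_shift: "G k l c \<Longrightarrow> k = 1 \<Longrightarrow> a \<in> I \<Longrightarrow> b \<in> I \<Longrightarrow> G 0 (Suc (Suc l)) (Del a b c)"
proof (induction rule: G.induct)
  case (del k l c i j)
  then have "G 0 (Suc (Suc l)) (Sm a j (Sm i b c) - Sm a i (Sm j b c))"
    by (intro G_diff G.sm) auto
  then show ?case by (simp add: Del_Del)
next
  case (sm k l c i j)
  then show ?case by (simp add: Del_Sm G.sm)
qed (auto simp: lin_add[OF lin_Del] lin_scale[OF lin_Del] lin_zero[OF lin_Del] intro: G.intros)

text \<open>Two minors become two sums. Surplus minors are peeled off until a product of two
  remains, where \<open>G_one_shift\<close> applies \<open>Del_Del\<close>.\<close>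

lemma G_shift: "G k l c \<Longrightarrow> k = Suc (Suc k') \<Longrightarrow> G k' (Suc (Suc l)) c"
proof (induction arbitrary: k' rule: G.induct)
  case (del k l c i j)
  show ?case
  proof (cases k')
    case 0
    then show ?thesis using del G_one_shift by simp
  next
    case (Suc k'')
    then show ?thesis using del by (auto intro: G.del)
  qed
qed (auto intro: G.intros)

lemma G_shift_even: "G (k + 2 * t) l c \<Longrightarrow> G k (l + 2 * t) c"
proof (induction t arbitrary: l)
  case (Suc t)
  then show ?case using G_shift[of "k + 2 * Suc t" l c "k + 2 * t"] Suc.IH[of "Suc (Suc l)"] by simp
qed simp

text \<open>A second-order Euler identity writes g as a combination of x_a x_b times second
  derivatives of g, which lift by induction to some \<open>f a b\<close>. Multiplying
  \<open>f a b\<close> by the sum with indices a, b lifts the product: \<open>E ^^ Suc i\<close>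
  kills \<open>f a b\<close>, so only the term with x_a x_b survives.\<close>

lemma T_lift: "g \<in> T (2 * i) 0 \<Longrightarrow> \<exists>f. G 0 i f \<and> (E ^^ i) f = g"
proof (induction i arbitrary: g)
  case 0
  then have "g = fscale (g (\<lambda>_. 0)) one" by (intro T_0_0) simp
  then show ?case by (metis G.one G.scale funpow_0)
next
  case (Suc i)
  have "\<exists>f. G 0 i f \<and> (E ^^ i) f = DX b (DX a g)" if "a \<in> I" "b \<in> I" for a b
    by (rule Suc.IH) (use that Suc.prems in \<open>auto intro!: DX_T\<close>)
  then obtain f where f: "\<And>a b. a \<in> I \<Longrightarrow> b \<in> I \<Longrightarrow> G 0 i (f a b) \<and> (E ^^ i) (f a b) = DX b (DX a g)"
    by metis
  \<comment> \<open>Euler's identity is used twice, in degrees 2 i + 2 and 2 i + 1.\<close>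
  define k :: complex where "k = of_nat (Suc (2 * i)) * of_nat (2 * Suc i)"
  have k: "k \<noteq> 0" unfolding k_def by (simp only: mult_eq_0_iff of_nat_eq_0_iff) simp
  have g2: "(\<Sum>a\<in>I. \<Sum>b\<in>I. X a (X b (DX b (DX a g)))) = fscale k g"
  proof -
    have "(\<Sum>b\<in>I. X a (X b (DX b (DX a g)))) = fscale (of_nat (Suc (2 * i))) (X a (DX a g))" if "a \<in> I" for a
    proof -
      have "DX a g \<in> T (Suc (2 * i)) 0" using DX_T[OF that] Suc.prems by simp
      from Euler_X[OF this] show ?thesis
        by (simp only: lin_sum[OF lin_mul, symmetric] mul_lin)
    qed
    then have "(\<Sum>a\<in>I. \<Sum>b\<in>I. X a (X b (DX b (DX a g)))) = fscale (of_nat (Suc (2 * i))) (\<Sum>a\<in>I. X a (DX a g))"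
      by (simp only: fs.scale_sum_right cong: sum.cong)
    then show ?thesis using Euler_X[OF Suc.prems] by (simp add: k_def)
  qed
  define h where "h = (\<Sum>a\<in>I. \<Sum>b\<in>I. Sm a b (f a b))"
  have "G 0 (Suc i) h" unfolding h_def using f by (auto intro!: G_sum G.sm)
  moreover have "(E ^^ Suc i) (Sm a b (f a b)) = fscale (of_nat (2 * Suc i)) (X a (X b (DX b (DX a g))))"
    if "a \<in> I" "b \<in> I" for a b
  proof -
    have "(E ^^ Suc i) (f a b) = 0" using G_E_pow f that by blast
    then show ?thesis using f that by (simp only: E_pow_Sm lin_zero[OF lin_Sm]) simp
  qed
  then have "(E ^^ Suc i) h = fscale (of_nat (2 * Suc i)) (fscale k g)"
    unfolding h_def lin_sum[OF lin_funpow[OF lin_E]] g2[symmetric] fs.scale_sum_right by simp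
  ultimately have "G 0 (Suc i) (fscale (1 / (of_nat (2 * Suc i) * k)) h)"
    "(E ^^ Suc i) (fscale (1 / (of_nat (2 * Suc i) * k)) h) = g"
    using k by (simp_all add: G.scale lin_scale[OF lin_funpow[OF lin_E]] del: of_nat_Suc of_nat_mult funpow.simps)
  then show ?case by blast
qed

lemma P_lift: "P a b g \<Longrightarrow> a = b + 2 * i \<Longrightarrow> \<exists>f. G b i f \<and> (E ^^ i) f = g"
proof (induction rule: P.induct)
  case (base c a)
  then show ?case using T_lift by simp
next
  case (zero a b)
  then show ?case using G.zero lin_zero[OF lin_funpow[OF lin_E]] by blast
next
  case (add a b c d)
  then obtain f f' where "G b i f" "G b i f'" "(E ^^ i) f = c" "(E ^^ i) f' = d" by auto
  then show ?case by (intro exI[of _ "f + f'"]) (simp add: G.add lin_add[OF lin_funpow[OF lin_E]])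
next
  case (scale a b c k)
  then obtain f where "G b i f" "(E ^^ i) f = c" by auto
  then show ?case by (intro exI[of _ "fscale k f"]) (simp add: G.scale lin_scale[OF lin_funpow[OF lin_E]])
next
  case (del a b c i' j')
  then obtain f where "G b i f" "(E ^^ i) f = c" by auto
  then show ?case using del by (intro exI[of _ "Del i' j' f"]) (simp add: G.del E_pow_Del)
qed

text \<open>By \<open>P_lift\<close> there is a preimage made of k + l - i minors and i sums. As l -
  i is even, l - i of these minors can be traded for sums.\<close>

lemma E_zero_lift:
  assumes "g \<in> T (k + l + i) (k + l - i)" "E g = 0" "i \<le> l" "even (l - i)"
  shows "\<exists>f. G k l f \<and> (E ^^ i) f = g"
proof -
  obtain t where t: "l - i = 2 * t" using assms(4) by (elim evenE)
  have P: "P (k + l + i) (k + l - i) g" by (rule E_zero_imp_P[OF assms(1,2)])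
  obtain f where "G (k + l - i) i f" "(E ^^ i) f = g"
    using P_lift[OF P, of i] assms(3) by auto
  moreover have "k + l - i = k + 2 * t" "i + 2 * t = l" using t assms(3) by auto
  ultimately show ?thesis using G_shift_even[of k t i f] by auto
qed

text \<open>For sufficiency, the order of nilpotency is lowered step by step. A leading term of the
  wrong parity vanishes; one of the right parity is the leading term of an element of
  \<open>G k l\<close>, which is subtracted.\<close>

lemma G_iff:
  "G k l f \<longleftrightarrow> f \<in> T (k + l) (k + l) \<and> swap_vars f = fscale ((-1) ^ k) f \<and> (E ^^ Suc l) f = 0"
proof
  assume f: "f \<in> T (k + l) (k + l) \<and> swap_vars f = fscale ((-1) ^ k) f \<and> (E ^^ Suc l) f = 0"
  have "i \<le> Suc l \<Longrightarrow> f \<in> T (k + l) (k + l) \<Longrightarrow> swap_vars f = fscale ((-1) ^ k) f \<Longrightarrow>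
      (E ^^ i) f = 0 \<Longrightarrow> G k l f" for i
  proof (induction i arbitrary: f)
    case 0
    then show ?case by (simp add: G.zero)
  next
    case (Suc i)
    show ?case
    proof (cases "even (l - i)")
      case False
      have "(E ^^ i) f = 0"
        by (rule E_pow_parity[OF Suc.prems(2,4) _ Suc.prems(3)]) (use False Suc.prems(1) in auto)
      then show ?thesis using Suc by simp
    next
      case True
      have "(E ^^ i) f \<in> T (k + l + i) (k + l - i)" "E ((E ^^ i) f) = 0"
        using E_pow_T[OF Suc.prems(2), of i] Suc.prems by auto
      then obtain f0 where f0: "G k l f0" "(E ^^ i) f0 = (E ^^ i) f"
        using E_zero_lift True Suc.prems(1) by (metis Suc_le_mono)
      have "G k l (f - f0)"
        using Suc.prems f0 G_T[OF f0(1)] G_swap_vars[OF f0(1)]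
        by (intro Suc.IH)
          (auto simp: swap_lin scale_simps lin_diff[OF lin_funpow[OF lin_E]] intro: fs.subspace_diff[OF subspace_T])
      then show ?thesis using G.add[OF _ f0(1), of "f - f0"] by simp
    qed
  qed
  then show "G k l f" using f by blast
qed (auto simp: G_T G_swap_vars G_E_pow simp del: funpow.simps)

section \<open>Counting monomials and the dimensions of the layers\<close>

lemma card_compositions:
  "card {a :: 'i \<Rightarrow> nat. (\<forall>i. i \<notin> I \<longrightarrow> a i = 0) \<and> sum a I = p} = (card I + p - 1) choose p"
proof -
  let ?S = "{a :: 'i \<Rightarrow> nat. (\<forall>i. i \<notin> I \<longrightarrow> a i = 0) \<and> sum a I = p}"
  have size: "size M = sum (count M) I" if "set_mset M \<subseteq> I" for M :: "'i multiset"
    unfolding size_multiset_overloaded_eq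
    by (rule sum.mono_neutral_left) (use that finite_I in \<open>auto simp: count_eq_zero_iff\<close>)
  have "bij_betw count (multisets_of_size I p) ?S"
  proof (rule bij_betwI[of _ _ _ "\<lambda>a. \<Sum>i\<in>I. replicate_mset (a i) i"])
    show "count \<in> multisets_of_size I p \<rightarrow> ?S"
      using size by (auto simp: multisets_of_size_def count_eq_zero_iff)
    have count: "count (\<Sum>i\<in>I. replicate_mset (a i) i) x = (if x \<in> I then a x else 0)" for a x
      using finite_I by (simp add: count_sum)
    have set: "set_mset (\<Sum>i\<in>I. replicate_mset (a i) i) \<subseteq> I" for a
      by (auto simp: count count_greater_zero_iff[symmetric] simp del: count_greater_zero_iff split: if_splits)
    show "(\<lambda>a. \<Sum>i\<in>I. replicate_mset (a i) i) \<in> ?S \<rightarrow> multisets_of_size I p"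
      using set by (auto simp: multisets_of_size_def size_multiset_sum)
    show "(\<Sum>i\<in>I. replicate_mset (count x i) i) = x" if "x \<in> multisets_of_size I p" for x
      using that by (auto simp: multiset_eq_iff count multisets_of_size_def count_eq_zero_iff)
    show "count (\<Sum>i\<in>I. replicate_mset (a i) i) = a" if "a \<in> ?S" for a
      using that by (auto simp: count)
  qed
  then have "card ?S = card (multisets_of_size I p)" by (rule bij_betw_same_card[symmetric])
  then show ?thesis using card_multisets_of_size[OF finite_I] by simp
qed

definition hc :: "nat \<Rightarrow> nat" where "hc p = (card I + p - 1) choose p"

lemma finite_compositions:
  "finite {a :: 'i \<Rightarrow> nat. (\<forall>i. i \<notin> I \<longrightarrow> a i = 0) \<and> sum a I = p}" (is "finite ?S")
proof -
  have "?S \<subseteq> {a. \<forall>i. (i \<in> I \<longrightarrow> a i \<in> {..p}) \<and> (i \<notin> I \<longrightarrow> a i = 0)}"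
    using finite_I member_le_sum[of _ I] by fastforce
  moreover have "finite \<dots>" by (rule finite_set_of_finite_funs[OF finite_I]) simp
  ultimately show ?thesis by (rule finite_subset)
qed

lemma mon_bij:
  "bij_betw (\<lambda>\<alpha>. (\<alpha> \<circ> Inl, \<alpha> \<circ> Inr)) (mon p q)
    ({a. (\<forall>i. i \<notin> I \<longrightarrow> a i = 0) \<and> sum a I = p} \<times> {a. (\<forall>i. i \<notin> I \<longrightarrow> a i = 0) \<and> sum a I = q})"
  by (rule bij_betwI[of _ _ _ "\<lambda>(a, b). case_sum a b"])
    (auto simp: mon_def fun_eq_iff split: sum.split)

lemma finite_mon: "finite (mon p q)"
  using bij_betw_finite[OF mon_bij[of p q]] finite_compositions by simp

lemma card_mon: "card (mon p q) = hc p * hc q"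
  using bij_betw_same_card[OF mon_bij[of p q]] card_compositions by (simp add: hc_def card_cartesian_product)

definition monomial :: "('i + 'i \<Rightarrow> nat) \<Rightarrow> ('i + 'i \<Rightarrow> nat) \<Rightarrow> complex" where
  "monomial \<alpha> = (\<lambda>\<beta>. if \<beta> = \<alpha> then 1 else 0)"

lemma T_eq_span: "T p q = fs.span (monomial ` mon p q)"
proof
  show "T p q \<subseteq> fs.span (monomial ` mon p q)"
  proof
    fix c assume c: "c \<in> T p q"
    have "c = (\<Sum>\<alpha>\<in>mon p q. fscale (c \<alpha>) (monomial \<alpha>))"
    proof
      fix \<beta>
      have "(\<Sum>\<alpha>\<in>mon p q. fscale (c \<alpha>) (monomial \<alpha>)) \<beta> = (\<Sum>\<alpha>\<in>mon p q. if \<beta> = \<alpha> then c \<beta> else 0)"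
        unfolding sum_fun_apply by (intro sum.cong) (auto simp: monomial_def fscale_apply)
      then show "c \<beta> = (\<Sum>\<alpha>\<in>mon p q. fscale (c \<alpha>) (monomial \<alpha>)) \<beta>"
        using c finite_mon by (auto simp: T_def)
    qed
    also have "\<dots> \<in> fs.span (monomial ` mon p q)"
      by (intro fs.span_sum fs.span_scale fs.span_base) auto
    finally show "c \<in> fs.span (monomial ` mon p q)" .
  qed
  show "fs.span (monomial ` mon p q) \<subseteq> T p q"
    by (rule fs.span_minimal[OF _ subspace_T]) (auto simp: T_def monomial_def split: if_splits)
qed

lemma inj_monomial: "inj monomial"
  by (auto simp: inj_def monomial_def fun_eq_iff)

lemma independent_monomials: "fs.independent (monomial ` A)" if "finite A"
proof (rule fs.independent_if_scalars_zero)
  fix f x assume f: "(\<Sum>x\<in>monomial ` A. fscale (f x) x) = 0" and "x \<in> monomial ` A"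
  then obtain \<alpha> where \<alpha>: "x = monomial \<alpha>" "\<alpha> \<in> A" by auto
  have "(\<Sum>x\<in>monomial ` A. fscale (f x) x) \<alpha> = (\<Sum>\<beta>\<in>A. f (monomial \<beta>) * monomial \<beta> \<alpha>)"
    by (simp add: sum.reindex[OF inj_on_subset[OF inj_monomial]] sum_fun_apply fscale_apply)
  also have "\<dots> = (\<Sum>\<beta>\<in>A. if \<alpha> = \<beta> then f x else 0)"
    by (intro sum.cong) (auto simp: monomial_def \<alpha>(1))
  finally show "f x = 0" using f \<alpha> that by (simp add: zero_fun_apply)
qed (use that in simp)

lemma dim_T: "fs.dim (T p q) = hc p * hc q"
proof -
  have "fs.dim (T p q) = card (monomial ` mon p q)"
    unfolding T_eq_span by (rule fs.dim_span_eq_card_independent[OF independent_monomials[OF finite_mon]])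
  then show ?thesis
    by (simp add: card_image[OF inj_on_subset[OF inj_monomial]] card_mon)
qed

definition K :: "nat \<Rightarrow> nat \<Rightarrow> (('i + 'i \<Rightarrow> nat) \<Rightarrow> complex) set" where
  "K p q = {c \<in> T p q. E c = 0}"

text \<open>Filter by the kernels of the powers of \<open>E\<close>. Every layer is a full kernel of
  \<open>E\<close>, since \<open>q \<le> p\<close> makes the weights large enough for the preimages
  of \<open>E_pow_F_pow\<close>.\<close>

lemma dim_T_eq_sum:
  assumes "q \<le> p"
  shows "fs.dim (T p q) = (\<Sum>i<Suc q. fs.dim (K (p + i) (q - i)))"
proof -
  have "{c \<in> T p q. (E ^^ Suc q) c = 0} = T p q" using E_pow_T_0 by auto
  then have "fs.dim (T p q) = fs.dim {c \<in> T p q. (E ^^ Suc q) c = 0}" by simp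
  also have "\<dots> = (\<Sum>i<Suc q. fs.dim ((E ^^ i) ` {c \<in> T p q. (E ^^ Suc i) c = 0}))"
    by (rule dim_funpow_filtration[OF lin_E subspace_T, of "monomial ` mon p q"])
      (simp_all add: finite_mon T_eq_span)
  also have "\<dots> = (\<Sum>i<Suc q. fs.dim (K (p + i) (q - i)))"
  proof (rule sum.cong[OF refl])
    fix i assume "i \<in> {..<Suc q}"
    then have i: "i \<le> q" by simp
    have "(E ^^ i) ` {c \<in> T p q. (E ^^ Suc i) c = 0} = K (p + i) (q - i)"
    proof
      show "(E ^^ i) ` {c \<in> T p q. (E ^^ Suc i) c = 0} \<subseteq> K (p + i) (q - i)"
        using E_pow_T[OF _ i] by (auto simp: K_def)
      show "K (p + i) (q - i) \<subseteq> (E ^^ i) ` {c \<in> T p q. (E ^^ Suc i) c = 0}"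
      proof
        fix g assume "g \<in> K (p + i) (q - i)"
        then have g: "g \<in> T (p + i) (q - i)" "E g = 0" by (auto simp: K_def)
        obtain k where k: "k \<noteq> 0" "(E ^^ i) ((F ^^ i) g) = fscale k g"
          using E_pow_F_pow[OF g, of i] i assms by auto
        let ?f = "fscale (1 / k) ((F ^^ i) g)"
        have f: "(E ^^ i) ?f = g"
          using k by (simp add: lin_scale[OF lin_funpow[OF lin_E]])
        moreover have "?f \<in> T p q"
          using F_pow_T[OF g(1), of i] i by (auto intro: fs.subspace_scale[OF subspace_T])
        ultimately show "g \<in> (E ^^ i) ` {c \<in> T p q. (E ^^ Suc i) c = 0}"
          using g(2) by (intro image_eqI[of _ _ ?f]) auto
      qed
    qed
    then show "fs.dim ((E ^^ i) ` {c \<in> T p q. (E ^^ Suc i) c = 0}) = fs.dim (K (p + i) (q - i))"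
      by simp
  qed
  finally show ?thesis .
qed

text \<open>The layers in bidegree (p, q + 1), apart from the first, are exactly those in bidegree
  (p + 1, q). The additive form avoids subtraction of natural numbers.\<close>

lemma dim_K:
  assumes "Suc q \<le> p"
  shows "fs.dim (K p (Suc q)) + hc (Suc p) * hc q = hc p * hc (Suc q)"
proof -
  have "hc p * hc (Suc q) = (\<Sum>i<Suc (Suc q). fs.dim (K (p + i) (Suc q - i)))"
    using dim_T_eq_sum[OF assms] by (simp add: dim_T)
  also have "\<dots> = fs.dim (K p (Suc q)) + (\<Sum>i<Suc q. fs.dim (K (Suc p + i) (q - i)))"
    by (subst sum.lessThan_Suc_shift) simp
  also have "(\<Sum>i<Suc q. fs.dim (K (Suc p + i) (q - i))) = hc (Suc p) * hc q"
    using dim_T_eq_sum[of q "Suc p"] assms by (simp add: dim_T)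
  finally show ?thesis by simp
qed

lemma subspace_G: "fs.subspace (Collect (G k l))"
  by (auto simp: fs.subspace_def intro: G.intros)

text \<open>Layer i is the full kernel by \<open>E_zero_lift\<close> when l - i is even, and zero by
  \<open>E_pow_parity\<close> otherwise.\<close>

lemma dim_G:
  "fs.dim (Collect (G k l)) = (\<Sum>i<Suc l. if even (l - i) then fs.dim (K (k + l + i) (k + l - i)) else 0)"
proof -
  have "{c \<in> Collect (G k l). (E ^^ Suc l) c = 0} = Collect (G k l)" using G_E_pow by auto
  then have "fs.dim (Collect (G k l)) = fs.dim {c \<in> Collect (G k l). (E ^^ Suc l) c = 0}" by simp
  also have "\<dots> = (\<Sum>i<Suc l. fs.dim ((E ^^ i) ` {c \<in> Collect (G k l). (E ^^ Suc i) c = 0}))"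
    by (rule dim_funpow_filtration[OF lin_E subspace_G, of "monomial ` mon (k + l) (k + l)"])
      (use G_T in \<open>auto simp: finite_mon T_eq_span\<close>)
  also have "\<dots> = (\<Sum>i<Suc l. if even (l - i) then fs.dim (K (k + l + i) (k + l - i)) else 0)"
  proof (rule sum.cong[OF refl])
    fix i assume "i \<in> {..<Suc l}"
    then have i: "i \<le> l" by simp
    show "fs.dim ((E ^^ i) ` {c \<in> Collect (G k l). (E ^^ Suc i) c = 0}) =
      (if even (l - i) then fs.dim (K (k + l + i) (k + l - i)) else 0)"
    proof (cases "even (l - i)")
      case True
      have "(E ^^ i) ` {c \<in> Collect (G k l). (E ^^ Suc i) c = 0} = K (k + l + i) (k + l - i)"
      proof
        show "(E ^^ i) ` {c \<in> Collect (G k l). (E ^^ Suc i) c = 0} \<subseteq> K (k + l + i) (k + l - i)"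
          using E_pow_T[OF G_T, of k l _ i] i by (auto simp: K_def)
        show "K (k + l + i) (k + l - i) \<subseteq> (E ^^ i) ` {c \<in> Collect (G k l). (E ^^ Suc i) c = 0}"
        proof
          fix g assume "g \<in> K (k + l + i) (k + l - i)"
          then have g: "g \<in> T (k + l + i) (k + l - i)" "E g = 0" by (auto simp: K_def)
          obtain f where "G k l f" "(E ^^ i) f = g" using E_zero_lift[OF g i True] by blast
          then show "g \<in> (E ^^ i) ` {c \<in> Collect (G k l). (E ^^ Suc i) c = 0}"
            using g(2) by (intro image_eqI[of _ _ f]) auto
        qed
      qed
      then show ?thesis using True by simp
    next
      case False
      have "(E ^^ i) c = 0" if "G k l c" "(E ^^ Suc i) c = 0" for c
        by (rule E_pow_parity[OF G_T[OF that(1)] that(2) _ G_swap_vars[OF that(1)]])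
          (use i False in auto)
      then have "(E ^^ i) ` {c \<in> Collect (G k l). (E ^^ Suc i) c = 0} \<subseteq> fs.span {}" by auto
      from fs.dim_le_card[OF this finite.emptyI] show ?thesis using False by simp
    qed
  qed
  finally show ?thesis .
qed

text \<open>Antisymmetric polynomials vanish on the diagonal, which removes the last condition in
  \<open>G_iff\<close>.\<close>

lemma G_1_iff: "G 1 l f \<longleftrightarrow> f \<in> T (Suc l) (Suc l) \<and> swap_vars f = - f"
proof
  assume f: "f \<in> T (Suc l) (Suc l) \<and> swap_vars f = - f"
  have "(E ^^ Suc l) f = 0"
    by (rule E_pow_parity[of f "Suc l" "Suc l" 1])
      (use f E_pow_T_0 in \<open>auto simp: pointwise simp del: funpow.simps\<close>)
  then show "G 1 l f" using f G_iff[of 1 l f] by (simp add: pointwise)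
next
  assume "G 1 l f"
  then show "f \<in> T (Suc l) (Suc l) \<and> swap_vars f = - f"
    using G_iff[of 1 l f] by (simp add: pointwise)
qed

end

section \<open>Polynomial functions\<close>

text \<open>Exponents are functions on the whole type while only the variables in \<open>J\<close>
  are evaluated, so distinct exponents have to differ already on \<open>J\<close>.\<close>

lemma sum_monomials_eq_zero_imp:
  fixes c :: "('w \<Rightarrow> nat) \<Rightarrow> complex"
  assumes "finite J" "finite A"
    and "\<And>\<alpha> \<beta>. \<alpha> \<in> A \<Longrightarrow> \<beta> \<in> A \<Longrightarrow> (\<And>w. w \<in> J \<Longrightarrow> \<alpha> w = \<beta> w) \<Longrightarrow> \<alpha> = \<beta>"
    and "\<And>z. (\<Sum>\<alpha>\<in>A. c \<alpha> * (\<Prod>w\<in>J. z w ^ \<alpha> w)) = 0"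
    and "\<alpha> \<in> A"
  shows "c \<alpha> = 0"
  using assms
proof (induction J arbitrary: A \<alpha> rule: finite_induct)
  case empty
  then have "A = {\<alpha>}" by auto
  then show ?case using empty.prems(3)[of undefined] by simp
next
  case (insert v J)
  \<comment> \<open>With the other variables fixed, the sum is a polynomial in the value t of the
    variable v that vanishes for every t, so each of its coefficients is zero.\<close>
  have *: "(\<Sum>\<beta>\<in>{\<beta> \<in> A. \<beta> v = k}. c \<beta> * (\<Prod>w\<in>J. z w ^ \<beta> w)) = 0" if "k \<in> (\<lambda>\<beta>. \<beta> v) ` A" for k z
  proof -
    define M where "M = Max ((\<lambda>\<beta>. \<beta> v) ` A)"
    have M: "(\<lambda>\<beta>. \<beta> v) ` A \<subseteq> {..M}" using insert.prems(1) by (auto simp: M_def)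
    have "(\<Sum>k\<le>M. (\<Sum>\<beta>\<in>{\<beta> \<in> A. \<beta> v = k}. c \<beta> * (\<Prod>w\<in>J. z w ^ \<beta> w)) * t ^ k) = 0" for t
    proof -
      have "(\<Sum>k\<le>M. (\<Sum>\<beta>\<in>{\<beta> \<in> A. \<beta> v = k}. c \<beta> * (\<Prod>w\<in>J. z w ^ \<beta> w)) * t ^ k) =
          (\<Sum>k\<le>M. \<Sum>\<beta>\<in>{\<beta> \<in> A. \<beta> v = k}. c \<beta> * (\<Prod>w\<in>J. z w ^ \<beta> w) * t ^ \<beta> v)"
        by (intro sum.cong refl) (auto simp: sum_distrib_right)
      also have "\<dots> = (\<Sum>\<beta>\<in>A. c \<beta> * (\<Prod>w\<in>J. z w ^ \<beta> w) * t ^ \<beta> v)"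
        by (rule sum.group[OF insert.prems(1) _ M]) simp
      also have "\<dots> = (\<Sum>\<beta>\<in>A. c \<beta> * (\<Prod>w\<in>insert v J. (z(v := t)) w ^ \<beta> w))"
      proof (intro sum.cong refl)
        fix \<beta>
        have "(\<Prod>w\<in>J. (z(v := t)) w ^ \<beta> w) = (\<Prod>w\<in>J. z w ^ \<beta> w)"
          using insert.hyps(2) by (intro prod.cong) auto
        then have "(\<Prod>w\<in>insert v J. (z(v := t)) w ^ \<beta> w) = t ^ \<beta> v * (\<Prod>w\<in>J. z w ^ \<beta> w)"
          by (simp only: prod.insert[OF insert.hyps] fun_upd_same)
        then show "c \<beta> * (\<Prod>w\<in>J. z w ^ \<beta> w) * t ^ \<beta> v = c \<beta> * (\<Prod>w\<in>insert v J. (z(v := t)) w ^ \<beta> w)"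
          by (simp only: mult.assoc mult.commute[of "t ^ \<beta> v"])
      qed
      finally show ?thesis by (simp only: insert.prems(3))
    qed
    then have "\<forall>k\<le>M. (\<Sum>\<beta>\<in>{\<beta> \<in> A. \<beta> v = k}. c \<beta> * (\<Prod>w\<in>J. z w ^ \<beta> w)) = 0"
      by (intro polyfun_eq_0[where c = "\<lambda>k. \<Sum>\<beta>\<in>{\<beta> \<in> A. \<beta> v = k}. c \<beta> * (\<Prod>w\<in>J. z w ^ \<beta> w)", THEN iffD1] allI)
    then show ?thesis using that M by auto
  qed
  show ?case
  proof (rule insert.IH[of "{\<beta> \<in> A. \<beta> v = \<alpha> v}"])
    show "(\<Sum>\<beta>\<in>{\<beta> \<in> A. \<beta> v = \<alpha> v}. c \<beta> * (\<Prod>w\<in>J. z w ^ \<beta> w)) = 0" for z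
      by (rule *) (use insert.prems(4) in auto)
    show "\<beta> = \<gamma>" if "\<beta> \<in> {\<beta> \<in> A. \<beta> v = \<alpha> v}" "\<gamma> \<in> {\<beta> \<in> A. \<beta> v = \<alpha> v}"
      "\<And>w. w \<in> J \<Longrightarrow> \<beta> w = \<gamma> w" for \<beta> \<gamma>
      using that by (intro insert.prems(2)) auto
  qed (use insert.prems in auto)
qed

context coords
begin

definition mon_fun :: "('i + 'i \<Rightarrow> nat) \<Rightarrow> ('i + 'i \<Rightarrow> complex) \<Rightarrow> complex" where
  "mon_fun \<alpha> z = (\<Prod>w\<in>I <+> I. z w ^ \<alpha> w)"

text \<open>The bidegree is a parameter because a coefficient function need not have finite support;
  it keeps the sum finite.\<close>

definition ev :: "nat \<Rightarrow> nat \<Rightarrow> (('i + 'i \<Rightarrow> nat) \<Rightarrow> complex) \<Rightarrow> ('i + 'i \<Rightarrow> complex) \<Rightarrow> complex" where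
  "ev p q c = (\<lambda>z. \<Sum>\<alpha>\<in>mon p q. c \<alpha> * mon_fun \<alpha> z)"

lemma lin_ev: "lin (ev p q)"
  by (rule linI) (simp_all add: ev_def pointwise sum.distrib sum_distrib_left algebra_simps)

lemma ev_inj:
  assumes "c \<in> T p q" "ev p q c = 0"
  shows "c = 0"
proof
  fix \<alpha>
  show "c \<alpha> = 0 \<alpha>"
  proof (cases "\<alpha> \<in> mon p q")
    case True
    have "c \<alpha> = 0"
    proof (rule sum_monomials_eq_zero_imp[OF _ finite_mon _ _ True])
      show "finite (I <+> I)" using finite_I by simp
      show "(\<Sum>\<alpha>\<in>mon p q. c \<alpha> * (\<Prod>w\<in>I <+> I. z w ^ \<alpha> w)) = 0" for z
        using fun_cong[OF assms(2), of z] by (simp add: ev_def mon_fun_def zero_fun_apply)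
      show "\<alpha> = \<beta>" if "\<alpha> \<in> mon p q" "\<beta> \<in> mon p q" "\<And>w. w \<in> I <+> I \<Longrightarrow> \<alpha> w = \<beta> w" for \<alpha> \<beta>
      proof
        fix w show "\<alpha> w = \<beta> w"
        proof (cases "w \<in> I <+> I")
          case False
          then have "\<alpha> w = 0 \<and> \<beta> w = 0"
            using that(1,2) by (cases w) (auto simp: mon_def)
          then show ?thesis by simp
        qed (rule that(3))
      qed
    qed
    then show ?thesis by (simp add: zero_fun_apply)
  next
    case False
    then show ?thesis using assms(1) by (auto simp: T_def zero_fun_apply)
  qed
qed

lemma mon_fun_upd:
  assumes "w \<in> I <+> I"
  shows "mon_fun (\<alpha>(w := \<alpha> w + 1)) z = z w * mon_fun \<alpha> z"
proof -
  have fin: "finite (I <+> I)" using finite_I by simp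
  have "(\<Prod>v\<in>I <+> I - {w}. z v ^ (\<alpha>(w := \<alpha> w + 1)) v) = (\<Prod>v\<in>I <+> I - {w}. z v ^ \<alpha> v)"
    by (intro prod.cong) auto
  then show ?thesis
    unfolding mon_fun_def prod.remove[OF fin assms] by simp
qed

lemma ev_mul:
  assumes w: "w \<in> I <+> I" and mon: "\<And>\<alpha>. \<alpha>(w := \<alpha> w + 1) \<in> mon p' q' \<longleftrightarrow> \<alpha> \<in> mon p q"
  shows "ev p' q' (mul w c) = (\<lambda>z. z w) * ev p q c"
proof
  fix z
  have "(\<Sum>\<alpha>\<in>mon p' q'. mul w c \<alpha> * mon_fun \<alpha> z) =
      (\<Sum>\<alpha>\<in>{\<alpha> \<in> mon p' q'. \<alpha> w \<noteq> 0}. c (\<alpha>(w := \<alpha> w - 1)) * mon_fun \<alpha> z)"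
    by (rule sum.mono_neutral_cong_right) (auto simp: finite_mon mul_def)
  also have "\<dots> = (\<Sum>\<alpha>\<in>mon p q. c \<alpha> * mon_fun (\<alpha>(w := \<alpha> w + 1)) z)"
  proof (rule sum.reindex_bij_witness[of _ "\<lambda>\<alpha>. \<alpha>(w := \<alpha> w + 1)" "\<lambda>\<alpha>. \<alpha>(w := \<alpha> w - 1)"])
    fix \<alpha> assume "\<alpha> \<in> {\<alpha> \<in> mon p' q'. \<alpha> w \<noteq> 0}"
    then show "\<alpha>(w := \<alpha> w - 1) \<in> mon p q"
      using mon[of "\<alpha>(w := \<alpha> w - 1)"] by simp
  qed (use mon in auto)
  also have "\<dots> = z w * (\<Sum>\<alpha>\<in>mon p q. c \<alpha> * mon_fun \<alpha> z)"
    unfolding mon_fun_upd[OF w] by (simp add: sum_distrib_left algebra_simps)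
  finally show "ev p' q' (mul w c) z = ((\<lambda>z. z w) * ev p q c) z"
    by (simp add: ev_def times_fun_apply)
qed

lemma ev_X: "i \<in> I \<Longrightarrow> ev (Suc p) q (X i c) = (\<lambda>z. z (Inl i)) * ev p q c"
  by (rule ev_mul) (use mon_X_upd[of i _ "Suc p" q] in auto)

lemma ev_Y: "i \<in> I \<Longrightarrow> ev p (Suc q) (Y i c) = (\<lambda>z. z (Inr i)) * ev p q c"
  by (rule ev_mul) (use mon_Y_upd[of i _ p "Suc q"] in auto)

lemma ev_Del:
  assumes "i \<in> I" "j \<in> I"
  shows "ev (Suc p) (Suc q) (Del i j c) =
    (\<lambda>z. z (Inl i) * z (Inr j) - z (Inl j) * z (Inr i)) * ev p q c"
  using assms by (simp add: Del_def lin_diff[OF lin_ev] ev_X ev_Y pointwise algebra_simps)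

lemma ev_Sm:
  assumes "i \<in> I" "j \<in> I"
  shows "ev (Suc p) (Suc q) (Sm i j c) =
    (\<lambda>z. z (Inl i) * z (Inr j) + z (Inl j) * z (Inr i)) * ev p q c"
  using assms by (simp add: Sm_def lin_add[OF lin_ev] ev_X ev_Y pointwise algebra_simps)

lemma ev_one: "ev 0 0 one = 1"
proof
  fix z
  have "mon 0 0 = {\<lambda>_. 0}" using mon_0_0 by (auto simp: mon_def)
  then show "ev 0 0 one z = 1 z" by (simp add: ev_def one_def mon_fun_def one_fun_apply)
qed

lemma ev_swap_vars: "ev q p (swap_vars c) z = ev p q c (z \<circ> case_sum Inr Inl)"
proof -
  have swap_swap: "\<alpha> \<circ> case_sum Inr Inl \<circ> case_sum Inr Inl = \<alpha>" for \<alpha> :: "'i + 'i \<Rightarrow> 'b"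
    by (auto simp: fun_eq_iff split: sum.split)
  have mon_swap: "\<alpha> \<circ> case_sum Inr Inl \<in> mon p q \<longleftrightarrow> \<alpha> \<in> mon q p" for \<alpha> p q
    by (auto simp: mon_def)
  have fin: "finite (I <+> I)" using finite_I by simp
  have mf: "mon_fun \<alpha> (z \<circ> case_sum Inr Inl) = mon_fun (\<alpha> \<circ> case_sum Inr Inl) z" for \<alpha>
    unfolding mon_fun_def
    by (rule prod.reindex_bij_witness[of _ "case_sum Inr Inl" "case_sum Inr Inl"])
      (auto split: sum.split)
  have "(\<Sum>\<alpha>\<in>mon q p. c (\<alpha> \<circ> case_sum Inr Inl) * mon_fun \<alpha> z) =
      (\<Sum>\<alpha>\<in>mon p q. c \<alpha> * mon_fun (\<alpha> \<circ> case_sum Inr Inl) z)"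
    by (rule sum.reindex_bij_witness[of _ "\<lambda>\<alpha>. \<alpha> \<circ> case_sum Inr Inl" "\<lambda>\<alpha>. \<alpha> \<circ> case_sum Inr Inl"])
      (auto simp: swap_swap mon_swap)
  then show ?thesis by (simp add: ev_def swap_vars_def mf)
qed

lemma subspace_ev_T: "fs.subspace (ev p q ` T p q)"
  by (rule fs_pair.linear_subspace_image[OF lin_ev subspace_T])

lemma subspace_ev_G: "fs.subspace (ev p q ` Collect (G k l))"
  by (rule fs_pair.linear_subspace_image[OF lin_ev subspace_G])

lemma prod_vars_in_ev_T:
  assumes "\<And>i. i < p \<Longrightarrow> g i \<in> I" "\<And>i. i < q \<Longrightarrow> h i \<in> I"
  shows "(\<lambda>z. (\<Prod>i<p. z (Inl (g i))) * (\<Prod>i<q. z (Inr (h i)))) \<in> ev p q ` T p q"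
  using assms
proof (induction p)
  case 0
  then show ?case
  proof (induction q)
    case 0
    have "ev 0 0 one = (\<lambda>z. (\<Prod>i<0. z (Inl (g i))) * (\<Prod>i<0. z (Inr (h i))))"
      by (simp add: ev_one pointwise)
    then show ?case using one_T by (metis image_eqI)
  next
    case (Suc q)
    then obtain c where c: "c \<in> T 0 q" "(\<lambda>z. (\<Prod>i<0. z (Inl (g i))) * (\<Prod>i<q. z (Inr (h i)))) = ev 0 q c"
      by auto
    have "ev 0 (Suc q) (Y (h q) c) = (\<lambda>z. (\<Prod>i<0. z (Inl (g i))) * (\<Prod>i<Suc q. z (Inr (h i))))"
      using Suc.prems by (simp add: ev_Y c(2)[symmetric] pointwise algebra_simps)
    moreover have "Y (h q) c \<in> T 0 (Suc q)" using c(1) Suc.prems by (intro Y_T) auto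
    ultimately show ?case by (metis image_eqI)
  qed
next
  case (Suc p)
  then obtain c where c: "c \<in> T p q" "(\<lambda>z. (\<Prod>i<p. z (Inl (g i))) * (\<Prod>i<q. z (Inr (h i)))) = ev p q c"
    by auto
  have "ev (Suc p) q (X (g p) c) = (\<lambda>z. (\<Prod>i<Suc p. z (Inl (g i))) * (\<Prod>i<q. z (Inr (h i))))"
    using Suc.prems by (simp add: ev_X c(2)[symmetric] pointwise algebra_simps)
  moreover have "X (g p) c \<in> T (Suc p) q" using c(1) Suc.prems by (intro X_T) auto
  ultimately show ?case by (metis image_eqI)
qed

section \<open>Multiplication of the evaluated spans\<close>

abbreviation evG :: "nat \<Rightarrow> nat \<Rightarrow> (('i + 'i \<Rightarrow> complex) \<Rightarrow> complex) set" where
  "evG k l \<equiv> ev (k + l) (k + l) ` Collect (G k l)"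

lemma evG_mult_evG:
  assumes d: "g \<in> evG k' l'"
  shows "G k l c \<Longrightarrow> ev (k + l) (k + l) c * g \<in> evG (k + k') (l + l')"
proof (induction rule: G.induct)
  case one
  then show ?case using d by (simp add: ev_one)
next
  case (zero k l)
  then show ?case using fs.subspace_0[OF subspace_ev_G] by (simp add: lin_zero[OF lin_ev])
next
  case (add k l c d)
  then show ?case using fs.subspace_add[OF subspace_ev_G] by (simp add: lin_add[OF lin_ev] distrib_right)
next
  case (scale k l c z)
  have "ev (k + l) (k + l) (fscale z c) * g = fscale z (ev (k + l) (k + l) c * g)"
    by (simp add: lin_scale[OF lin_ev] pointwise)
  then show ?case using fs.subspace_scale[OF subspace_ev_G scale.IH] by simp
next
  case (del k l c i j)
  then obtain e where e: "G (k + k') (l + l') e" "ev (k + l) (k + l) c * g = ev (k + k' + (l + l')) (k + k' + (l + l')) e"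
    by auto
  have "ev (Suc k + l) (Suc k + l) (Del i j c) * g = ev (Suc k + k' + (l + l')) (Suc k + k' + (l + l')) (Del i j e)"
    using del.hyps e(2) by (simp add: ev_Del mult.assoc)
  then show ?case using G.del[OF e(1) del.hyps(2,3)] by auto
next
  case (sm k l c i j)
  then obtain e where e: "G (k + k') (l + l') e" "ev (k + l) (k + l) c * g = ev (k + k' + (l + l')) (k + k' + (l + l')) e"
    by auto
  have "ev (k + Suc l) (k + Suc l) (Sm i j c) * g = ev (k + k' + (Suc l + l')) (k + k' + (Suc l + l')) (Sm i j e)"
    using sm.hyps e(2) by (simp add: ev_Sm mult.assoc)
  then show ?case using G.sm[OF e(1) sm.hyps(2,3)] by auto
qed

lemma mult_span_subset:
  assumes "f \<in> fs.span S" "\<And>s. s \<in> S \<Longrightarrow> h * s \<in> fs.span S'"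
  shows "h * f \<in> fs.span S'"
proof -
  have "h * f \<in> fs.span ((*) h ` S)"
    using assms(1) fs_pair.linear_span_image[OF lin_times(1)[of h], of S] by auto
  also have "\<dots> \<subseteq> fs.span S'" by (rule fs.span_minimal) (use assms(2) in auto)
  finally show ?thesis .
qed

text \<open>The minors and sums of a product can be dealt out to two factors in any prescribed
  numbers. Each new one goes to the first factor unless that has no place left for its kind.\<close>

lemma evG_split:
  "G k l c \<Longrightarrow> k = k1 + k2 \<Longrightarrow> l = l1 + l2 \<Longrightarrow>
    ev (k + l) (k + l) c \<in> fs.span {f * g | f g. f \<in> evG k1 l1 \<and> g \<in> evG k2 l2}"
proof (induction arbitrary: k1 k2 l1 l2 rule: G.induct)
  case one
  have "ev 0 0 one \<in> {f * g | f g. f \<in> evG 0 0 \<and> g \<in> evG 0 0}"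
    using G.one by (auto simp: ev_one intro!: exI[of _ 1] image_eqI[of _ _ one])
  then show ?case using one by (auto intro: fs.span_base)
next
  case (zero k l)
  then show ?case by (simp add: lin_zero[OF lin_ev] fs.span_zero)
next
  case (add k l c d)
  then show ?case by (simp add: lin_add[OF lin_ev] fs.span_add)
next
  case (scale k l c z)
  then show ?case by (simp add: lin_scale[OF lin_ev] fs.span_scale)
next
  case (del k l c i j)
  let ?h = "\<lambda>z. z (Inl i) * z (Inr j) - z (Inl j) * z (Inr i)"
  have ev: "ev (Suc k + l) (Suc k + l) (Del i j c) = ?h * ev (k + l) (k + l) c"
    using del.hyps by (simp add: ev_Del)
  have step: "?h * f \<in> evG (Suc k') l'" if f: "f \<in> evG k' l'" for f k' l'
  proof -
    obtain e where e: "G k' l' e" "f = ev (k' + l') (k' + l') e" using f by auto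
    have "?h * f = ev (Suc k' + l') (Suc k' + l') (Del i j e)"
      using del.hyps e(2) by (simp add: ev_Del)
    then show ?thesis using G.del[OF e(1) del.hyps(2,3)] by auto
  qed
  show ?case
  proof (cases k1)
    case 0
    then obtain k2' where k2: "k2 = Suc k2'" "k = k1 + k2'" using del.prems by (cases k2) auto
    show ?thesis
      unfolding ev
    proof (rule mult_span_subset[OF del.IH[OF k2(2) del.prems(2)]])
      fix s assume "s \<in> {f * g | f g. f \<in> evG k1 l1 \<and> g \<in> evG k2' l2}"
      then obtain f g where "s = f * g" "f \<in> evG k1 l1" "g \<in> evG k2' l2" by auto
      then have "?h * s = f * (?h * g)" "f \<in> evG k1 l1" "?h * g \<in> evG k2 l2"
        using step k2(1) by (auto simp only: mult.left_commute)
      then show "?h * s \<in> fs.span {f * g | f g. f \<in> evG k1 l1 \<and> g \<in> evG k2 l2}"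
        by (auto intro!: fs.span_base simp only: mem_Collect_eq)
    qed
  next
    case (Suc k1')
    then have k: "k = k1' + k2" using del.prems by simp
    show ?thesis
      unfolding ev
    proof (rule mult_span_subset[OF del.IH[OF k del.prems(2)]])
      fix s assume "s \<in> {f * g | f g. f \<in> evG k1' l1 \<and> g \<in> evG k2 l2}"
      then obtain f g where "s = f * g" "f \<in> evG k1' l1" "g \<in> evG k2 l2" by auto
      then have "?h * s = (?h * f) * g" "?h * f \<in> evG k1 l1" "g \<in> evG k2 l2"
        using step Suc by (auto simp only: mult.assoc)
      then show "?h * s \<in> fs.span {f * g | f g. f \<in> evG k1 l1 \<and> g \<in> evG k2 l2}"
        by (auto intro!: fs.span_base simp only: mem_Collect_eq)
    qed
  qed
next
  case (sm k l c i j)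
  let ?h = "\<lambda>z. z (Inl i) * z (Inr j) + z (Inl j) * z (Inr i)"
  have ev: "ev (k + Suc l) (k + Suc l) (Sm i j c) = ?h * ev (k + l) (k + l) c"
    using sm.hyps by (simp add: ev_Sm)
  have step: "?h * f \<in> evG k' (Suc l')" if f: "f \<in> evG k' l'" for f k' l'
  proof -
    obtain e where e: "G k' l' e" "f = ev (k' + l') (k' + l') e" using f by auto
    have "?h * f = ev (k' + Suc l') (k' + Suc l') (Sm i j e)"
      using sm.hyps e(2) by (simp add: ev_Sm)
    then show ?thesis using G.sm[OF e(1) sm.hyps(2,3)] by auto
  qed
  show ?case
  proof (cases l1)
    case 0
    then obtain l2' where l2: "l2 = Suc l2'" "l = l1 + l2'" using sm.prems by (cases l2) auto
    show ?thesis
      unfolding ev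
    proof (rule mult_span_subset[OF sm.IH[OF sm.prems(1) l2(2)]])
      fix s assume "s \<in> {f * g | f g. f \<in> evG k1 l1 \<and> g \<in> evG k2 l2'}"
      then obtain f g where "s = f * g" "f \<in> evG k1 l1" "g \<in> evG k2 l2'" by auto
      then have "?h * s = f * (?h * g)" "f \<in> evG k1 l1" "?h * g \<in> evG k2 l2"
        using step l2(1) by (auto simp only: mult.left_commute)
      then show "?h * s \<in> fs.span {f * g | f g. f \<in> evG k1 l1 \<and> g \<in> evG k2 l2}"
        by (auto intro!: fs.span_base simp only: mem_Collect_eq)
    qed
  next
    case (Suc l1')
    then have l: "l = l1' + l2" using sm.prems by simp
    show ?thesis
      unfolding ev
    proof (rule mult_span_subset[OF sm.IH[OF sm.prems(1) l]])
      fix s assume "s \<in> {f * g | f g. f \<in> evG k1 l1' \<and> g \<in> evG k2 l2}"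
      then obtain f g where "s = f * g" "f \<in> evG k1 l1'" "g \<in> evG k2 l2" by auto
      then have "?h * s = (?h * f) * g" "?h * f \<in> evG k1 l1" "g \<in> evG k2 l2"
        using step Suc by (auto simp only: mult.assoc)
      then show "?h * s \<in> fs.span {f * g | f g. f \<in> evG k1 l1 \<and> g \<in> evG k2 l2}"
        by (auto intro!: fs.span_base simp only: mem_Collect_eq)
    qed
  qed
qed

text \<open>Generation in degree one: k minors and k s sums can be arranged in k groups of one minor
  and s sums.\<close>

lemma span_products_evG:
  "fs.span {\<Prod>i<k. a i | a. \<forall>i<k. a i \<in> evG 1 s} = evG k (k * s)"
proof
  have "(\<Prod>i<k. a i) \<in> evG k (k * s)" if "\<forall>i<k. a i \<in> evG 1 s" for a k
    using that
  proof (induction k)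
    case 0
    show ?case using G.one by (auto simp: ev_one intro!: image_eqI[of _ _ one])
  next
    case (Suc k)
    then obtain c where c: "G k (k * s) c" "(\<Prod>i<k. a i) = ev (k + k * s) (k + k * s) c" by auto
    have "ev (k + k * s) (k + k * s) c * a k \<in> evG (k + 1) (k * s + s)"
      by (rule evG_mult_evG[OF _ c(1)]) (use Suc.prems in auto)
    then show ?case unfolding prod.lessThan_Suc c(2) by (simp add: add.commute)
  qed
  then show "fs.span {\<Prod>i<k. a i | a. \<forall>i<k. a i \<in> evG 1 s} \<subseteq> evG k (k * s)"
    by (intro fs.span_minimal subspace_ev_G) auto
  have "G k (k * s) c \<Longrightarrow> ev (k + k * s) (k + k * s) c \<in> fs.span {\<Prod>i<k. a i | a. \<forall>i<k. a i \<in> evG 1 s}" for c k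
  proof (induction k arbitrary: c)
    case 0
    then have "c \<in> T 0 0" using G_T[of 0 0 c] by simp
    then have "ev 0 0 c = fscale (c (\<lambda>_. 0)) 1"
      using T_0_0 ev_one by (metis lin_scale[OF lin_ev])
    then show ?case by (simp add: fs.span_scale fs.span_base)
  next
    case (Suc k)
    have "ev (Suc k + Suc k * s) (Suc k + Suc k * s) c \<in>
        fs.span {f * g | f g. f \<in> evG k (k * s) \<and> g \<in> evG 1 s}"
      by (rule evG_split[OF Suc.prems]) auto
    also have "\<dots> \<subseteq> fs.span {\<Prod>i<Suc k. a i | a. \<forall>i<Suc k. a i \<in> evG 1 s}"
    proof (rule fs.span_minimal, rule subsetI)
      fix h assume "h \<in> {f * g | f g. f \<in> evG k (k * s) \<and> g \<in> evG 1 s}"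
      then obtain f g where fg: "h = f * g" "f \<in> evG k (k * s)" "g \<in> evG 1 s" by auto
      have f: "f \<in> fs.span {\<Prod>i<k. a i | a. \<forall>i<k. a i \<in> evG 1 s}" using Suc.IH fg(2) by auto
      have "g * f \<in> fs.span {\<Prod>i<Suc k. a i | a. \<forall>i<Suc k. a i \<in> evG 1 s}"
      proof (rule mult_span_subset[OF f])
        fix s' assume "s' \<in> {\<Prod>i<k. a i | a. \<forall>i<k. a i \<in> evG 1 s}"
        then obtain a where a: "s' = (\<Prod>i<k. a i)" "\<forall>i<k. a i \<in> evG 1 s" by auto
        have "g * s' = (\<Prod>i<Suc k. (a(k := g)) i)"
          unfolding a(1) prod.lessThan_Suc by (simp add: mult.commute)
        moreover have "\<forall>i<Suc k. (a(k := g)) i \<in> evG 1 s" using a(2) fg(3) by (auto simp: less_Suc_eq)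
        ultimately show "g * s' \<in> fs.span {\<Prod>i<Suc k. a i | a. \<forall>i<Suc k. a i \<in> evG 1 s}"
          by (intro fs.span_base) blast
      qed
      then show "h \<in> fs.span {\<Prod>i<Suc k. a i | a. \<forall>i<Suc k. a i \<in> evG 1 s}"
        by (simp only: fg(1) mult.commute)
    qed simp
    finally show ?case .
  qed
  then show "evG k (k * s) \<subseteq> fs.span {\<Prod>i<k. a i | a. \<forall>i<k. a i \<in> evG 1 s}" by auto
qed

lemma dim_evG: "fs.dim (evG k l) = fs.dim (Collect (G k l))"
proof -
  have sub: "Collect (G k l) \<subseteq> fs.span (monomial ` mon (k + l) (k + l))"
    using G_T T_eq_span by auto
  have "{c \<in> Collect (G k l). ev (k + l) (k + l) c = 0} \<subseteq> fs.span {}"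
    using ev_inj[OF G_T] by auto
  from fs.dim_le_card[OF this finite.emptyI]
  have "fs.dim {c \<in> Collect (G k l). ev (k + l) (k + l) c = 0} = 0" by simp
  moreover have "finite (monomial ` mon (k + l) (k + l))" using finite_mon by simp
  ultimately show ?thesis
    using fs_pair.dim_eq_dim_kernel_plus_dim_image[OF lin_ev[of "k + l" "k + l"] subspace_G _ sub] by simp
qed

end

section \<open>Asymptotics\<close>

lemma tendsto_inverse_power_at_infinity:
  fixes m :: nat
  assumes "m > 0"
  shows "((\<lambda>x::real. inverse (x ^ m)) \<longlongrightarrow> 0) at_infinity"
proof -
  have "((\<lambda>x::real. inverse x ^ m) \<longlongrightarrow> 0 ^ m) at_infinity"
    by (intro tendsto_power tendsto_inverse_0)
  then show ?thesis unfolding zero_power[OF assms] power_inverse .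
qed

lemma poly_divide_power_tendsto_lead_coeff:
  "((\<lambda>x::real. poly p x / x ^ degree p) \<longlongrightarrow> lead_coeff p) at_infinity"
proof -
  have ev: "eventually (\<lambda>x::real. x \<noteq> 0) at_infinity"
    by (auto simp: eventually_at_infinity intro!: exI[of _ 1])
  have "((\<lambda>x::real. \<Sum>i\<le>degree p. coeff p i * (x ^ i / x ^ degree p)) \<longlongrightarrow>
      (\<Sum>i\<le>degree p. coeff p i * (if i = degree p then 1 else 0))) at_infinity"
  proof (intro tendsto_sum tendsto_mult tendsto_const)
    fix i assume "i \<in> {..degree p}"
    then have i: "i \<le> degree p" by simp
    show "((\<lambda>x::real. x ^ i / x ^ degree p) \<longlongrightarrow> (if i = degree p then 1 else 0)) at_infinity"
    proof (cases "i = degree p")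
      case True
      then show ?thesis
        by (auto intro!: tendsto_eventually eventually_mono[OF ev])
    next
      case False
      then have "((\<lambda>x::real. inverse (x ^ (degree p - i))) \<longlongrightarrow> 0) at_infinity"
        using i by (intro tendsto_inverse_power_at_infinity) auto
      moreover have "eventually (\<lambda>x::real. inverse (x ^ (degree p - i)) = x ^ i / x ^ degree p) at_infinity"
        using i by (auto intro!: eventually_mono[OF ev] simp: power_diff field_simps)
      ultimately show ?thesis using False by (auto intro: Lim_transform_eventually)
    qed
  qed
  then show ?thesis
    by (simp add: poly_altdef sum_divide_distrib if_distrib[of "(*) _"] sum.delta cong: if_cong)
qed

text \<open>Growth along the natural numbers determines degree and leading coefficient, so the
  Hilbert polynomial need not be expanded.\<close>

lemma degree_lead_coeff_eqI:
  assumes lim: "(\<lambda>k. poly p (real k) / real k ^ d) \<longlonglongrightarrow> L" and "L \<noteq> 0"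
  shows "degree p = d" "lead_coeff p = L"
proof -
  have inf: "filterlim real at_infinity sequentially"
    by (rule filterlim_at_top_imp_at_infinity[OF filterlim_real_sequentially])
  have lc: "(\<lambda>k. poly p (real k) / real k ^ degree p) \<longlonglongrightarrow> lead_coeff p"
    by (rule filterlim_compose[OF poly_divide_power_tendsto_lead_coeff inf])
  have z: "(\<lambda>k. inverse (real k ^ m)) \<longlonglongrightarrow> 0" if "m > 0" for m
    by (rule filterlim_compose[OF tendsto_inverse_power_at_infinity[OF that] inf])
  have p0: "p \<noteq> 0"
  proof
    assume "p = 0"
    then have "(\<lambda>k::nat. 0::real) \<longlonglongrightarrow> L" using lim by simp
    then show False using \<open>L \<noteq> 0\<close> LIMSEQ_unique tendsto_const by metis
  qed
  have ev: "eventually (\<lambda>k::nat. k > 0) sequentially" by (rule eventually_gt_at_top)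
  show deg: "degree p = d"
  proof (rule ccontr)
    assume "degree p \<noteq> d"
    then consider "degree p < d" | "d < degree p" by linarith
    then show False
    proof cases
      case 1
      have "(\<lambda>k. poly p (real k) / real k ^ degree p * inverse (real k ^ (d - degree p))) \<longlonglongrightarrow> lead_coeff p * 0"
        using 1 by (intro tendsto_mult lc z) auto
      moreover have "eventually (\<lambda>k. poly p (real k) / real k ^ degree p * inverse (real k ^ (d - degree p)) =
          poly p (real k) / real k ^ d) sequentially"
        using 1 by (auto intro!: eventually_mono[OF ev] simp: power_diff field_simps)
      ultimately have "(\<lambda>k. poly p (real k) / real k ^ d) \<longlonglongrightarrow> lead_coeff p * 0"
        by (rule Lim_transform_eventually)
      then show False using lim \<open>L \<noteq> 0\<close> LIMSEQ_unique by fastforce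
    next
      case 2
      have "(\<lambda>k. poly p (real k) / real k ^ d * inverse (real k ^ (degree p - d))) \<longlonglongrightarrow> L * 0"
        using 2 by (intro tendsto_mult lim z) auto
      moreover have "eventually (\<lambda>k. poly p (real k) / real k ^ d * inverse (real k ^ (degree p - d)) =
          poly p (real k) / real k ^ degree p) sequentially"
        using 2 by (auto intro!: eventually_mono[OF ev] simp: power_diff field_simps)
      ultimately have "(\<lambda>k. poly p (real k) / real k ^ degree p) \<longlonglongrightarrow> L * 0"
        by (rule Lim_transform_eventually)
      then have "lead_coeff p = 0" using lc LIMSEQ_unique by fastforce
      then show False using p0 by simp
    qed
  qed
  show "lead_coeff p = L" using lc lim unfolding deg by (rule LIMSEQ_unique)
qed

text \<open>These are the Euler polynomials divided by 2. Expanding (t + 1)^d gives the recursion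
  that defines \<open>q\<close>.\<close>

lemma alternating_poly_ex:
  "\<exists>p :: real poly. (\<forall>t. poly p t + poly p (t + 1) = t ^ d) \<and>
     ((\<lambda>x. poly p x / x ^ d) \<longlongrightarrow> 1 / 2) at_infinity"
proof (induction d rule: less_induct)
  case (less d)
  then obtain p :: "nat \<Rightarrow> real poly" where
    p: "\<And>j t. j < d \<Longrightarrow> poly (p j) t + poly (p j) (t + 1) = t ^ j"
      "\<And>j. j < d \<Longrightarrow> ((\<lambda>x. poly (p j) x / x ^ j) \<longlongrightarrow> 1 / 2) at_infinity"
    by metis
  define q where "q = smult (1 / 2) (monom 1 d - (\<Sum>j<d. smult (of_nat (d choose j)) (p j)))"
  have q: "poly q x = (x ^ d - (\<Sum>j<d. of_nat (d choose j) * poly (p j) x)) / 2" for x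
    by (simp add: q_def poly_monom poly_sum)
  have "poly q t + poly q (t + 1) = t ^ d" for t
  proof -
    have "poly q t + poly q (t + 1) = (t ^ d + (t + 1) ^ d -
        (\<Sum>j<d. of_nat (d choose j) * (poly (p j) t + poly (p j) (t + 1)))) / 2"
      by (simp add: q sum.distrib algebra_simps add_divide_distrib diff_divide_distrib)
    also have "(\<Sum>j<d. of_nat (d choose j) * (poly (p j) t + poly (p j) (t + 1))) =
        (\<Sum>j<d. of_nat (d choose j) * t ^ j)"
      using p(1) by (intro sum.cong) auto
    also have "(t + 1) ^ d = (\<Sum>j<d. of_nat (d choose j) * t ^ j) + t ^ d"
      using binomial_ring[of t 1 d] by (simp add: lessThan_Suc_atMost[symmetric])
    finally show ?thesis by simp
  qed
  moreover have "((\<lambda>x. poly q x / x ^ d) \<longlongrightarrow> 1 / 2) at_infinity"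
  proof -
    have ev: "eventually (\<lambda>x::real. x \<noteq> 0) at_infinity"
      by (auto simp: eventually_at_infinity intro!: exI[of _ 1])
    have "((\<lambda>x. (1 - (\<Sum>j<d. of_nat (d choose j) * (poly (p j) x / x ^ j * inverse (x ^ (d - j))))) / 2)
        \<longlongrightarrow> (1 - (\<Sum>j<d. of_nat (d choose j) * (1 / 2 * 0))) / 2) at_infinity"
      by (intro tendsto_intros p(2) tendsto_inverse_power_at_infinity) auto
    moreover have "(1 - (\<Sum>j<d. of_nat (d choose j) * (poly (p j) x / x ^ j * inverse (x ^ (d - j))))) / 2 =
        poly q x / x ^ d" if "x \<noteq> 0" for x
    proof -
      have "(\<Sum>j<d. of_nat (d choose j) * (poly (p j) x / x ^ j * inverse (x ^ (d - j)))) =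
          (\<Sum>j<d. of_nat (d choose j) * poly (p j) x) / x ^ d"
        unfolding sum_divide_distrib
        using that by (intro sum.cong refl) (simp add: power_diff field_simps)
      then show ?thesis using that by (simp add: q diff_divide_distrib)
    qed
    then have "eventually (\<lambda>x. (1 - (\<Sum>j<d. of_nat (d choose j) * (poly (p j) x / x ^ j * inverse (x ^ (d - j))))) / 2 =
        poly q x / x ^ d) at_infinity"
      by (auto intro!: eventually_mono[OF ev])
    ultimately have "((\<lambda>x. poly q x / x ^ d) \<longlongrightarrow> (1 - (\<Sum>j<d. of_nat (d choose j) * (1 / 2 * 0))) / 2) at_infinity"
      by (rule Lim_transform_eventually)
    then show ?thesis by simp
  qed
  ultimately show ?case by blast
qed

text \<open>Averaging with the reflection t to 1 - t enforces equal values at 0 and 1. The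
  functional equation survives because the exponent is even.\<close>

lemma alternating_poly_even_ex:
  "\<exists>p :: real poly. (\<forall>t. poly p t + poly p (t + 1) = t ^ (2 * a)) \<and> poly p 0 = poly p 1 \<and>
     ((\<lambda>x. poly p x / x ^ (2 * a)) \<longlongrightarrow> 1 / 2) at_infinity"
proof -
  obtain p :: "real poly" where p: "\<And>t. poly p t + poly p (t + 1) = t ^ (2 * a)"
      "((\<lambda>x. poly p x / x ^ (2 * a)) \<longlongrightarrow> 1 / 2) at_infinity"
    using alternating_poly_ex[of "2 * a"] by blast
  define q where "q = smult (1 / 2) (p + pcompose p [:1, -1:])"
  have q: "poly q x = (poly p x + poly p (1 - x)) / 2" for x
    by (simp add: q_def poly_pcompose)
  have "poly q t + poly q (t + 1) = t ^ (2 * a)" for t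
  proof -
    have "poly q t + poly q (t + 1) = (poly p t + poly p (t + 1) + (poly p (- t) + poly p (- t + 1))) / 2"
      by (simp add: q add_divide_distrib)
    then show ?thesis unfolding p(1) by simp
  qed
  moreover have "poly q 0 = poly q 1" by (simp add: q)
  moreover have "((\<lambda>x. poly q x / x ^ (2 * a)) \<longlongrightarrow> 1 / 2) at_infinity"
  proof -
    have ev: "eventually (\<lambda>x::real. x \<noteq> 0 \<and> x \<noteq> 1) at_infinity"
      by (auto simp: eventually_at_infinity intro!: exI[of _ 2])
    have inf: "filterlim (\<lambda>x::real. 1 - x) at_infinity at_infinity"
      unfolding filterlim_at_infinity[OF order_refl] eventually_at_infinity
    proof (intro allI impI)
      fix R :: real
      show "\<exists>b. \<forall>x::real. b \<le> norm x \<longrightarrow> R \<le> norm (1 - x)"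
        by (intro exI[of _ "R + 1"]) auto
    qed
    have l1: "((\<lambda>x. poly p (1 - x) / (1 - x) ^ (2 * a)) \<longlongrightarrow> 1 / 2) at_infinity"
      by (rule filterlim_compose[OF p(2) inf])
    have l2: "((\<lambda>x::real. (inverse x - 1) ^ (2 * a)) \<longlongrightarrow> (0 - 1) ^ (2 * a)) at_infinity"
      by (intro tendsto_intros tendsto_inverse_0)
    have "((\<lambda>x. (poly p x / x ^ (2 * a) + poly p (1 - x) / (1 - x) ^ (2 * a) * (inverse x - 1) ^ (2 * a)) / 2)
        \<longlongrightarrow> (1 / 2 + 1 / 2 * (0 - 1) ^ (2 * a)) / 2) at_infinity"
      by (intro tendsto_intros p(2) l1 l2) auto
    moreover have "(poly p x / x ^ (2 * a) + poly p (1 - x) / (1 - x) ^ (2 * a) * (inverse x - 1) ^ (2 * a)) / 2 =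
        poly q x / x ^ (2 * a)" if "x \<noteq> 0 \<and> x \<noteq> 1" for x
    proof -
      have "(inverse x - 1) ^ (2 * a) = (1 - x) ^ (2 * a) / x ^ (2 * a)"
      proof -
        have "inverse x - 1 = (1 - x) / x" using that by (simp add: field_simps)
        then show ?thesis by (simp only: power_divide)
      qed
      moreover have "(1 - x) ^ (2 * a) \<noteq> 0" using that by simp
      ultimately show ?thesis by (simp add: q add_divide_distrib)
    qed
    then have "eventually (\<lambda>x. (poly p x / x ^ (2 * a) + poly p (1 - x) / (1 - x) ^ (2 * a) * (inverse x - 1) ^ (2 * a)) / 2 =
        poly q x / x ^ (2 * a)) at_infinity"
      by (auto intro!: eventually_mono[OF ev])
    ultimately have "((\<lambda>x. poly q x / x ^ (2 * a)) \<longlongrightarrow> (1 / 2 + 1 / 2 * (0 - 1) ^ (2 * a)) / 2) at_infinity"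
      by (rule Lim_transform_eventually)
    then show ?thesis by simp
  qed
  ultimately show ?thesis by blast
qed

text \<open>Divided by N!^2, for integers t between 0 and k r, this product counts pairs of
  monomials of degrees k r + t and k r - t in N + 1 variables each. When t grows like k, only the
  homogeneous top part (r^2 - t^2)^N with coefficients \<open>C\<close> matters.\<close>

lemma prod_diff_squares_expansion:
  fixes r :: real
  shows "\<exists>(c :: nat \<Rightarrow> real poly) C. (\<forall>a > N. c a = 0 \<and> C a = 0) \<and>
    (\<forall>k t. (\<Prod>s<N. (r * k + 1 + real s)\<^sup>2 - t\<^sup>2) = (\<Sum>a\<le>N. poly (c a) k * t ^ (2 * a))) \<and>
    (\<forall>a\<le>N. (\<lambda>k. poly (c a) (real k) / real k ^ (2 * (N - a))) \<longlonglongrightarrow> C a) \<and>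
    (\<forall>t. (r\<^sup>2 - t\<^sup>2) ^ N = (\<Sum>a\<le>N. C a * t ^ (2 * a)))"
proof (induction N)
  case 0
  show ?case
    by (intro exI[of _ "\<lambda>a. if a = 0 then 1 else 0"] exI[of _ "\<lambda>a. if a = 0 then 1 else (0::real)"]) simp
next
  case (Suc N)
  then obtain c :: "nat \<Rightarrow> real poly" and C where
    0: "\<And>a. a > N \<Longrightarrow> c a = 0" "\<And>a. a > N \<Longrightarrow> C a = 0" and
    1: "\<And>k t. (\<Prod>s<N. (r * k + 1 + real s)\<^sup>2 - t\<^sup>2) = (\<Sum>a\<le>N. poly (c a) k * t ^ (2 * a))" and
    2: "\<And>a. a \<le> N \<Longrightarrow> (\<lambda>k. poly (c a) (real k) / real k ^ (2 * (N - a))) \<longlonglongrightarrow> C a" and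
    3: "\<And>t. (r\<^sup>2 - t\<^sup>2) ^ N = (\<Sum>a\<le>N. C a * t ^ (2 * a))"
    by blast
  \<comment> \<open>Multiplication by the new factor (r k + 1 + N)^2 - t^2; its second term shifts
    the index by one.\<close>
  define c' where "c' a = [:1 + real N, r:]\<^sup>2 * c a - (case a of 0 \<Rightarrow> 0 | Suc b \<Rightarrow> c b)" for a
  define C' where "C' a = r\<^sup>2 * C a - (case a of 0 \<Rightarrow> 0 | Suc b \<Rightarrow> C b)" for a
  have rec: "(\<Sum>a\<le>Suc N. (u * e a - (case a of 0 \<Rightarrow> 0 | Suc b \<Rightarrow> e b)) * t ^ (2 * a)) =
      (\<Sum>a\<le>N. e a * t ^ (2 * a)) * (u - t\<^sup>2)" if "e (Suc N) = 0" for u t and e :: "nat \<Rightarrow> real"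
  proof -
    have "(\<Sum>a\<le>Suc N. (u * e a - (case a of 0 \<Rightarrow> 0 | Suc b \<Rightarrow> e b)) * t ^ (2 * a)) =
        (\<Sum>a\<le>Suc N. u * e a * t ^ (2 * a)) - (\<Sum>a\<le>Suc N. (case a of 0 \<Rightarrow> 0 | Suc b \<Rightarrow> e b) * t ^ (2 * a))"
      by (simp add: sum_subtractf left_diff_distrib)
    also have "(\<Sum>a\<le>Suc N. (case a of 0 \<Rightarrow> 0 | Suc b \<Rightarrow> e b) * t ^ (2 * a)) = (\<Sum>a\<le>N. e a * t ^ (2 * a)) * t\<^sup>2"
      by (subst sum.atMost_Suc_shift) (simp add: sum_distrib_left power_add power2_eq_square algebra_simps)
    also have "(\<Sum>a\<le>Suc N. u * e a * t ^ (2 * a)) = (\<Sum>a\<le>N. e a * t ^ (2 * a)) * u"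
      using that by (simp add: sum_distrib_left algebra_simps)
    finally show ?thesis by (simp add: algebra_simps)
  qed
  have "\<forall>a > Suc N. c' a = 0 \<and> C' a = 0"
    using 0 by (auto simp: c'_def C'_def split: nat.split)
  moreover have "(\<Prod>s<Suc N. (r * k + 1 + real s)\<^sup>2 - t\<^sup>2) = (\<Sum>a\<le>Suc N. poly (c' a) k * t ^ (2 * a))" for k t
  proof -
    have "poly (c' a) k = (r * k + 1 + real N)\<^sup>2 * poly (c a) k - (case a of 0 \<Rightarrow> 0 | Suc b \<Rightarrow> poly (c b) k)" for a
      by (simp add: c'_def algebra_simps split: nat.split)
    then show ?thesis using rec[of "\<lambda>a. poly (c a) k" "(r * k + 1 + real N)\<^sup>2" t] 0 1[of k t] by simp
  qed
  moreover have "(\<lambda>k. poly (c' a) (real k) / real k ^ (2 * (Suc N - a))) \<longlonglongrightarrow> C' a" if a: "a \<le> Suc N" for a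
  proof -
    have ev: "eventually (\<lambda>k::nat. k > 0) sequentially" by (rule eventually_gt_at_top)
    have l1: "(\<lambda>k. poly ([:1 + real N, r:]\<^sup>2 * c a) (real k) / real k ^ (2 * (Suc N - a))) \<longlonglongrightarrow> r\<^sup>2 * C a"
    proof (cases "a \<le> N")
      case True
      have "(\<lambda>k. (r + (1 + real N) * inverse (real k))\<^sup>2 * (poly (c a) (real k) / real k ^ (2 * (N - a))))
          \<longlonglongrightarrow> (r + (1 + real N) * 0)\<^sup>2 * C a"
        by (intro tendsto_intros lim_inverse_n 2 True)
      moreover have "eventually (\<lambda>k. (r + (1 + real N) * inverse (real k))\<^sup>2 * (poly (c a) (real k) / real k ^ (2 * (N - a))) =
          poly ([:1 + real N, r:]\<^sup>2 * c a) (real k) / real k ^ (2 * (Suc N - a))) sequentially"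
      proof (rule eventually_mono[OF ev])
        fix k :: nat assume k: "k > 0"
        have "r + (1 + real N) * inverse (real k) = (1 + real N + r * real k) / real k"
          using k by (simp add: field_simps)
        moreover have "real k ^ (2 * (Suc N - a)) = (real k)\<^sup>2 * real k ^ (2 * (N - a))"
          using True by (simp add: Suc_diff_le power_add[symmetric])
        ultimately show "(r + (1 + real N) * inverse (real k))\<^sup>2 * (poly (c a) (real k) / real k ^ (2 * (N - a))) =
          poly ([:1 + real N, r:]\<^sup>2 * c a) (real k) / real k ^ (2 * (Suc N - a))"
          by (simp add: power_divide mult.commute)
      qed
      ultimately show ?thesis by (auto intro: Lim_transform_eventually)
    next
      case False
      then show ?thesis using 0 by simp
    qed
    have l2: "(\<lambda>k. poly (case a of 0 \<Rightarrow> 0 | Suc b \<Rightarrow> c b) (real k) / real k ^ (2 * (Suc N - a)))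
        \<longlonglongrightarrow> (case a of 0 \<Rightarrow> 0 | Suc b \<Rightarrow> C b)"
      using 2 a by (cases a) auto
    show ?thesis
      using tendsto_diff[OF l1 l2] by (simp add: c'_def C'_def diff_divide_distrib)
  qed
  moreover have "(r\<^sup>2 - t\<^sup>2) ^ Suc N = (\<Sum>a\<le>Suc N. C' a * t ^ (2 * a))" for t
    using rec[of C "r\<^sup>2" t] 0 3[of t] by (simp add: C'_def mult.commute)
  ultimately show ?case by blast
qed

text \<open>Each term equals \<open>\<phi> i - \<phi> (i + 2)\<close>, so the sum telescopes down to
  \<open>\<phi> 0\<close> or \<open>\<phi> 1\<close> according to the parity of l. Their equality
  gives one formula for both parities.\<close>

lemma sum_even_telescope:
  fixes f :: "nat \<Rightarrow> real"
  assumes "\<And>i. \<phi> i + \<phi> (Suc i) = f i" "\<phi> 0 = \<phi> 1"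
  shows "(\<Sum>i<Suc l. if even (l - i) then f i - f (Suc i) else 0) = f 0 / 2 - \<phi> (l + 2)"
proof -
  have step: "f i - f (Suc i) = \<phi> i - \<phi> (i + 2)" for i
    using assms(1)[of i] assms(1)[of "Suc i"] by simp
  have "(\<Sum>i<Suc l. if even (l - i) then f i - f (Suc i) else 0) = \<phi> 0 - \<phi> (l + 2)"
  proof (induction l rule: induct_nat_012)
    case 0
    then show ?case by (simp add: step)
  next
    case 1
    then show ?case by (simp add: step assms(2))
  next
    case (ge2 l)
    have "(\<Sum>i<Suc (Suc (Suc l)). if even (Suc (Suc l) - i) then f i - f (Suc i) else 0) =
        (\<Sum>i<Suc l. if even (Suc (Suc l) - i) then f i - f (Suc i) else 0) + (f (l + 2) - f (Suc (l + 2)))"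
      by simp
    also have "(\<Sum>i<Suc l. if even (Suc (Suc l) - i) then f i - f (Suc i) else 0) =
        (\<Sum>i<Suc l. if even (l - i) then f i - f (Suc i) else 0)"
      by (intro sum.cong refl) (simp add: Suc_diff_le)
    also have "\<dots> = \<phi> 0 - \<phi> (l + 2)" by (rule ge2(1))
    finally show ?case using step[of "l + 2"] by simp
  qed
  then show ?thesis using assms(1)[of 0] assms(2) by simp
qed

lemma binomial_eq_prod: "real ((N + p) choose p) = (\<Prod>s<N. real p + 1 + real s) / fact N"
proof -
  have "real ((N + p) choose p) = real ((N + p) choose N)"
    using binomial_symmetric[of p "N + p"] by simp
  also have "\<dots> = pochhammer (real p + 1) N / fact N"
    by (simp add: binomial_gbinomial gbinomial_pochhammer')
  also have "pochhammer (real p + 1) N = (\<Prod>s<N. real p + 1 + real s)"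
    by (simp add: pochhammer_prod lessThan_atLeast0)
  finally show ?thesis .
qed

theorem alternating_dimension_poly:
  fixes d :: "nat \<Rightarrow> nat \<Rightarrow> nat"
  assumes d: "\<And>p q. Suc q \<le> p \<Longrightarrow> d p (Suc q) + ((N + Suc p) choose Suc p) * ((N + q) choose q) =
      ((N + p) choose p) * ((N + Suc q) choose Suc q)"
    and r: "r \<ge> 2" and N: "N \<ge> 1"
  shows "\<exists>p :: real poly. (\<forall>k\<ge>1. poly p (real k) =
      real (\<Sum>i<Suc (k * (r - 1)). if even (k * (r - 1) - i) then d (k * r + i) (k * r - i) else 0)) \<and>
    degree p = 2 * N \<and> lead_coeff p = (real r ^ (2 * N) - (2 * real r - 1) ^ N) / (2 * (fact N)\<^sup>2)"
proof -
  obtain c :: "nat \<Rightarrow> real poly" and C where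
    c1: "\<And>k t. (\<Prod>s<N. (real r * k + 1 + real s)\<^sup>2 - t\<^sup>2) = (\<Sum>a\<le>N. poly (c a) k * t ^ (2 * a))" and
    c2: "\<And>a. a \<le> N \<Longrightarrow> (\<lambda>k. poly (c a) (real k) / real k ^ (2 * (N - a))) \<longlonglongrightarrow> C a" and
    c3: "\<And>t. ((real r)\<^sup>2 - t\<^sup>2) ^ N = (\<Sum>a\<le>N. C a * t ^ (2 * a))"
    using prod_diff_squares_expansion[of N "real r"] by blast
  define Q where "Q a p \<longleftrightarrow> (\<forall>t. poly p t + poly p (t + 1) = t ^ (2 * a)) \<and> poly p 0 = poly p 1 \<and>
     ((\<lambda>x. poly p x / x ^ (2 * a)) \<longlongrightarrow> 1 / 2) at_infinity" for a and p :: "real poly"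
  have "\<exists>p. Q a p" for a
    unfolding Q_def by (rule alternating_poly_even_ex)
  then obtain e where "\<And>a. Q a (e a)" by metis
  then have e: "\<And>a t. poly (e a) t + poly (e a) (t + 1) = t ^ (2 * a)" "\<And>a. poly (e a) 0 = poly (e a) 1"
      "\<And>a. ((\<lambda>x. poly (e a) x / x ^ (2 * a)) \<longlongrightarrow> 1 / 2) at_infinity"
    unfolding Q_def by blast+
  let ?\<rho> = "real r - 1"
  \<comment> \<open>The telescoped sum as a polynomial in k: half the value at 0 minus the value at
    the upper end k (r - 1) + 2, whence the inner polynomial with coefficients 2 and r - 1.\<close>
  define p where "p = smult (1 / (fact N)\<^sup>2)
    (smult (1 / 2) (c 0) - (\<Sum>a\<le>N. c a * pcompose (e a) [:2, ?\<rho>:]))"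
  have p: "poly p k = (poly (c 0) k / 2 - (\<Sum>a\<le>N. poly (c a) k * poly (e a) (?\<rho> * k + 2))) / (fact N)\<^sup>2" for k
    by (simp add: p_def poly_sum poly_pcompose algebra_simps diff_divide_distrib)
  have "poly p (real k) =
      real (\<Sum>i<Suc (k * (r - 1)). if even (k * (r - 1) - i) then d (k * r + i) (k * r - i) else 0)"
    if k: "k \<ge> 1" for k
  proof -
    let ?l = "k * (r - 1)"
    define f where "f i = (\<Sum>a\<le>N. poly (c a) (real k) * real i ^ (2 * a)) / (fact N)\<^sup>2" for i :: nat
    define \<phi> where "\<phi> i = (\<Sum>a\<le>N. poly (c a) (real k) * poly (e a) (real i)) / (fact N)\<^sup>2" for i :: nat
    have l: "k * r = k + ?l" using r by (cases r) (auto simp: algebra_simps)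
    have f: "f i = real (((N + (k * r + i)) choose (k * r + i)) * ((N + (k * r - i)) choose (k * r - i)))"
      if "i \<le> k * r" for i
    proof -
      have "(real r * real k + 1 + real s)\<^sup>2 - (real i)\<^sup>2 =
          (real (k * r + i) + 1 + real s) * (real (k * r - i) + 1 + real s)" for s
        using that by (simp add: of_nat_diff power2_eq_square algebra_simps)
      then have "(\<Prod>s<N. (real r * real k + 1 + real s)\<^sup>2 - (real i)\<^sup>2) =
          (\<Prod>s<N. real (k * r + i) + 1 + real s) * (\<Prod>s<N. real (k * r - i) + 1 + real s)"
        by (simp add: prod.distrib)
      then show ?thesis
        unfolding f_def c1[symmetric] of_nat_mult binomial_eq_prod by (simp add: power2_eq_square)
    qed
    have "real (d (k * r + i) (k * r - i)) = f i - f (Suc i)" if "i < Suc ?l" for i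
    proof -
      \<comment> \<open>Here \<open>k \<ge> 1\<close> is needed: i is at most k (r - 1), which is
        less than k r.\<close>
      have "0 < k * r - i" using that k l by linarith
      then obtain q where q: "k * r - i = Suc q" using gr0_conv_Suc by blast
      have q': "k * r - Suc i = q" using q by simp
      have "d (k * r + i) (Suc q) + ((N + Suc (k * r + i)) choose Suc (k * r + i)) * ((N + q) choose q) =
          ((N + (k * r + i)) choose (k * r + i)) * ((N + Suc q) choose Suc q)"
        by (rule d) (use q in simp)
      then have "real (d (k * r + i) (Suc q)) =
          real (((N + (k * r + i)) choose (k * r + i)) * ((N + Suc q) choose Suc q)) -
          real (((N + Suc (k * r + i)) choose Suc (k * r + i)) * ((N + q) choose q))"
        by (metis add_diff_cancel_right' of_nat_add)
      then show ?thesis using f[of i] f[of "Suc i"] q q' by simp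
    qed
    then have "real (\<Sum>i<Suc ?l. if even (?l - i) then d (k * r + i) (k * r - i) else 0) =
        (\<Sum>i<Suc ?l. if even (?l - i) then f i - f (Suc i) else 0)"
      unfolding of_nat_sum by (intro sum.cong) auto
    also have "\<dots> = f 0 / 2 - \<phi> (?l + 2)"
    proof (rule sum_even_telescope)
      show "\<phi> i + \<phi> (Suc i) = f i" for i
        unfolding \<phi>_def f_def
        by (simp add: add_divide_distrib[symmetric] sum.distrib[symmetric] distrib_left[symmetric]
            e(1)[symmetric] add.commute)
      show "\<phi> 0 = \<phi> 1" using e(2) by (simp add: \<phi>_def)
    qed
    also have "f 0 = poly (c 0) (real k) / (fact N)\<^sup>2"
    proof -
      have "(\<Sum>a\<le>N. poly (c a) (real k) * real 0 ^ (2 * a)) = (\<Sum>a\<le>N. if a = 0 then poly (c a) (real k) else 0)"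
        by (intro sum.cong) auto
      then show ?thesis by (simp add: f_def)
    qed
    also have "\<phi> (?l + 2) = (\<Sum>a\<le>N. poly (c a) (real k) * poly (e a) (?\<rho> * real k + 2)) / (fact N)\<^sup>2"
    proof -
      have "real (?l + 2) = ?\<rho> * real k + 2" using r by (simp add: of_nat_diff)
      then show ?thesis by (simp only: \<phi>_def)
    qed
    finally show ?thesis by (simp add: p diff_divide_distrib)
  qed
  moreover have lim: "(\<lambda>k. poly p (real k) / real k ^ (2 * N)) \<longlonglongrightarrow>
      (real r ^ (2 * N) - (2 * real r - 1) ^ N) / (2 * (fact N)\<^sup>2)"
  proof -
    have ev: "eventually (\<lambda>k::nat. k > 0) sequentially" by (rule eventually_gt_at_top)
    have \<rho>: "?\<rho> > 0" using r by simp
    have "filterlim (\<lambda>k. 2 + ?\<rho> * real k) at_top sequentially"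
      by (rule filterlim_tendsto_add_at_top[OF tendsto_const
            filterlim_tendsto_pos_mult_at_top[OF tendsto_const \<rho> filterlim_real_sequentially]])
    then have inf: "filterlim (\<lambda>k. ?\<rho> * real k + 2) at_infinity sequentially"
      by (intro filterlim_at_top_imp_at_infinity) (simp add: add.commute)
    have le: "(\<lambda>k. poly (e a) (?\<rho> * real k + 2) / real k ^ (2 * a)) \<longlonglongrightarrow> ?\<rho> ^ (2 * a) / 2" for a
    proof -
      have l: "(\<lambda>k. poly (e a) (?\<rho> * real k + 2) / (?\<rho> * real k + 2) ^ (2 * a)) \<longlonglongrightarrow> 1 / 2"
        by (rule filterlim_compose[OF e(3) inf])
      have "(\<lambda>k. poly (e a) (?\<rho> * real k + 2) / (?\<rho> * real k + 2) ^ (2 * a)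
          * (?\<rho> + 2 * inverse (real k)) ^ (2 * a)) \<longlonglongrightarrow> 1 / 2 * (?\<rho> + 2 * 0) ^ (2 * a)"
        by (intro tendsto_intros lim_inverse_n l)
      moreover have "eventually (\<lambda>k. poly (e a) (?\<rho> * real k + 2) / (?\<rho> * real k + 2) ^ (2 * a)
          * (?\<rho> + 2 * inverse (real k)) ^ (2 * a) = poly (e a) (?\<rho> * real k + 2) / real k ^ (2 * a)) sequentially"
      proof (rule eventually_mono[OF ev])
        fix k :: nat assume k: "k > 0"
        have "?\<rho> + 2 * inverse (real k) = (?\<rho> * real k + 2) / real k" using k by (simp add: field_simps)
        moreover have "?\<rho> * real k + 2 \<noteq> 0"
          using \<rho> k by (smt (verit) mult_pos_pos of_nat_0_less_iff)
        ultimately show "poly (e a) (?\<rho> * real k + 2) / (?\<rho> * real k + 2) ^ (2 * a)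
          * (?\<rho> + 2 * inverse (real k)) ^ (2 * a) = poly (e a) (?\<rho> * real k + 2) / real k ^ (2 * a)"
          by (simp add: power_divide)
      qed
      ultimately show ?thesis by (auto intro: Lim_transform_eventually)
    qed
    have "(\<lambda>k. (poly (c 0) (real k) / real k ^ (2 * (N - 0)) / 2 - (\<Sum>a\<le>N. poly (c a) (real k) / real k ^ (2 * (N - a)) *
        (poly (e a) (?\<rho> * real k + 2) / real k ^ (2 * a)))) / (fact N)\<^sup>2) \<longlonglongrightarrow>
        (C 0 / 2 - (\<Sum>a\<le>N. C a * (?\<rho> ^ (2 * a) / 2))) / (fact N)\<^sup>2"
      by (intro tendsto_intros c2 le) auto
    moreover have "(poly (c 0) (real k) / real k ^ (2 * (N - 0)) / 2 - (\<Sum>a\<le>N. poly (c a) (real k) / real k ^ (2 * (N - a)) *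
        (poly (e a) (?\<rho> * real k + 2) / real k ^ (2 * a)))) / (fact N)\<^sup>2 = poly p (real k) / real k ^ (2 * N)" for k
    proof -
      have "(\<Sum>a\<le>N. poly (c a) (real k) / real k ^ (2 * (N - a)) * (poly (e a) (?\<rho> * real k + 2) / real k ^ (2 * a))) =
        (\<Sum>a\<le>N. poly (c a) (real k) * poly (e a) (?\<rho> * real k + 2)) / real k ^ (2 * N)"
        unfolding sum_divide_distrib
        by (intro sum.cong refl) (simp add: power_add[symmetric] distrib_left[symmetric])
      then show ?thesis by (simp add: p diff_divide_distrib mult.commute)
    qed
    ultimately have "(\<lambda>k. poly p (real k) / real k ^ (2 * N)) \<longlonglongrightarrow>
        (C 0 / 2 - (\<Sum>a\<le>N. C a * (?\<rho> ^ (2 * a) / 2))) / (fact N)\<^sup>2"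
      by simp
    moreover have C0: "C 0 = real r ^ (2 * N)"
    proof -
      have "(\<Sum>a\<le>N. C a * 0 ^ (2 * a)) = (\<Sum>a\<le>N. if a = 0 then C a else 0)"
        by (intro sum.cong) auto
      then show ?thesis using c3[of 0] by (simp add: power_mult)
    qed
    \<comment> \<open>At t = r - 1 the top part is (r^2 - (r - 1)^2)^N, which is the source of the
      second power in the degree formula.\<close>
    moreover have S: "(\<Sum>a\<le>N. C a * (?\<rho> ^ (2 * a) / 2)) = (2 * real r - 1) ^ N / 2"
      using c3[of ?\<rho>] by (simp add: sum_divide_distrib[symmetric] power2_eq_square algebra_simps)
    moreover have "(real r ^ (2 * N) / 2 - (2 * real r - 1) ^ N / 2) / (fact N)\<^sup>2 =
        (real r ^ (2 * N) - (2 * real r - 1) ^ N) / (2 * (fact N)\<^sup>2)"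
      by (simp add: diff_divide_distrib)
    ultimately show ?thesis by (simp only:)
  qed
  moreover have ne: "(real r ^ (2 * N) - (2 * real r - 1) ^ N) / (2 * (fact N)\<^sup>2) \<noteq> 0"
  proof -
    have "0 < (real r - 1)\<^sup>2" using r by simp
    then have "2 * real r - 1 < (real r)\<^sup>2" by (simp add: power2_eq_square algebra_simps)
    then have "(2 * real r - 1) ^ N < ((real r)\<^sup>2) ^ N"
      using r N by (intro power_strict_mono) auto
    then show ?thesis by (simp add: power_mult)
  qed
  ultimately show ?thesis
    by (intro exI[of _ p] conjI degree_lead_coeff_eqI[OF lim ne]) auto
qed

section \<open>Functionals and forms\<close>

lemma power_fun_apply: "(f ^ n) x = (f x :: 'b :: monoid_mult) ^ n"
  by (induction n) (simp_all add: one_fun_apply times_fun_apply)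

lemma dual_space_sum:
  assumes "vector_space scale" "l \<in> dual_space scale U" "module.subspace scale U" "\<And>b. b \<in> A \<Longrightarrow> f b \<in> U"
  shows "l (\<Sum>b\<in>A. scale (c b) (f b)) = (\<Sum>b\<in>A. c b * l (f b))"
proof -
  interpret vector_space scale by fact
  have "0 \<in> U" using assms(3) by (rule subspace_0)
  then have "l (scale 0 0) = 0 * l 0" using assms(2) unfolding dual_space_def by blast
  then have l0: "l 0 = 0" by simp
  show ?thesis
    using assms(4)
  proof (induction A rule: infinite_finite_induct)
  case (insert b A)
  have "(\<Sum>b\<in>A. scale (c b) (f b)) \<in> U" "scale (c b) (f b) \<in> U"
    using insert.prems by (auto intro!: subspace_sum[OF assms(3)] subspace_scale[OF assms(3)])
  then have "l (scale (c b) (f b) + (\<Sum>b\<in>A. scale (c b) (f b))) = l (scale (c b) (f b)) + l (\<Sum>b\<in>A. scale (c b) (f b))"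
    using assms(2) by (auto simp: dual_space_def)
  moreover have "l (scale (c b) (f b)) = c b * l (f b)"
    using assms(2) insert.prems by (auto simp: dual_space_def)
  ultimately show ?case using insert by simp
qed (use l0 in auto)
qed

lemma subspace_dual_space: "fs.subspace (dual_space scale V)"
  by (auto simp: fs.subspace_def dual_space_def pointwise algebra_simps)

locale fin_space = vector_space scale
  for scale :: "complex \<Rightarrow> 'v::ab_group_add \<Rightarrow> 'v" +
  fixes V :: "'v set" and B :: "'v set"
  assumes finite_B: "finite B" and independent_B: "independent B" and span_B: "span B = V"
begin

lemma subspace_V: "subspace V"
  using span_B subspace_span by blast

lemma B_subset: "B \<subseteq> V"
  using span_B span_superset by blast

definition crd :: "'v \<Rightarrow> 'v \<Rightarrow> complex" where
  "crd b = (\<lambda>v. if v \<in> V then representation B v b else 0)"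

lemma crd_dual: "crd b \<in> dual_space scale V"
  using subspace_V by (auto simp: dual_space_def crd_def span_B subspace_add subspace_scale
      representation_add[OF independent_B] representation_scale[OF independent_B])

lemma sum_crd: "v \<in> V \<Longrightarrow> (\<Sum>b\<in>B. scale (crd b v) b) = v"
  using sum_representation_eq[OF independent_B _ finite_B order_refl] by (simp add: crd_def span_B)

lemma crd_basis: "b \<in> B \<Longrightarrow> c \<in> B \<Longrightarrow> crd b c = (if b = c then 1 else 0)"
  using B_subset representation_basis[OF independent_B] by (auto simp: crd_def)

definition lx :: "('v \<Rightarrow> complex) \<Rightarrow> 'v \<Rightarrow> complex" where
  "lx x = (\<Sum>b\<in>B. fscale (x b) (crd b))"

lemma lx_apply: "lx x v = (\<Sum>b\<in>B. x b * crd b v)"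
  by (simp add: lx_def sum_fun_apply fscale_apply)

lemma lx_dual: "lx x \<in> dual_space scale V"
  unfolding lx_def
  by (intro fs.subspace_sum fs.subspace_scale subspace_dual_space crd_dual)

text \<open>The coordinates of a functional in the dual basis are its values on \<open>B\<close>, so
  it can serve as its own coordinate vector.\<close>

lemma dual_eq_lx:
  assumes l: "l \<in> dual_space scale V"
  shows "l = lx l"
proof
  fix v
  show "l v = lx l v"
  proof (cases "v \<in> V")
    case True
    have "l v = l (\<Sum>b\<in>B. scale (crd b v) b)" using sum_crd[OF True] by simp
    also have "\<dots> = (\<Sum>b\<in>B. crd b v * l b)"
      by (rule dual_space_sum[OF vector_space_axioms l subspace_V]) (use B_subset in auto)
    finally show ?thesis by (simp add: lx_apply mult.commute)
  next
    case False
    then show ?thesis using l by (simp add: lx_apply crd_def dual_space_def)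
  qed
qed

lemma lx_add: "u \<in> V \<Longrightarrow> v \<in> V \<Longrightarrow> lx x (u + v) = lx x u + lx x v"
  using lx_dual[of x] by (simp add: dual_space_def)

lemma lx_scale: "u \<in> V \<Longrightarrow> lx x (scale c u) = c * lx x u"
  using lx_dual[of x] by (simp add: dual_space_def)

lemma lx_basis: "b \<in> B \<Longrightarrow> lx x b = x b"
  using finite_B by (simp add: lx_apply crd_basis if_distrib[of "(*) _"] sum.delta cong: if_cong sum.cong)

lemma dual_space_finite_span: "\<exists>A. finite A \<and> dual_space scale V \<subseteq> fs.span A"
proof (intro exI[of _ "crd ` B"] conjI subsetI)
  fix l assume "l \<in> dual_space scale V"
  then have "l = (\<Sum>b\<in>B. fscale (l b) (crd b))" using dual_eq_lx lx_def by metis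
  also have "\<dots> \<in> fs.span (crd ` B)" by (intro fs.span_sum fs.span_scale fs.span_base) auto
  finally show "l \<in> fs.span (crd ` B)" .
qed (use finite_B in auto)

end

lemma products_finite_span:
  assumes "finite A"
  shows "\<exists>P. finite P \<and> (\<forall>l. (\<forall>i<(k::nat). l i \<in> fs.span A) \<longrightarrow> (\<Prod>i<k. l i) \<in> fs.span P)"
proof (induction k)
  case 0
  show ?case by (intro exI[of _ "{1}"]) (simp add: fs.span_base)
next
  case (Suc k)
  then obtain P where P: "finite P" "\<And>l. (\<forall>i<k. l i \<in> fs.span A) \<Longrightarrow> (\<Prod>i<k. l i) \<in> fs.span P"
    by blast
  let ?Q = "{s * t | s t. s \<in> P \<and> t \<in> A}"
  have "(\<Prod>i<Suc k. l i) \<in> fs.span ?Q" if "\<forall>i<Suc k. l i \<in> fs.span A" for l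
    unfolding prod.lessThan_Suc
    by (rule span_bilinear) (use that P lin_times in auto)
  moreover have "?Q = (\<lambda>(s, t). s * t) ` (P \<times> A)" by auto
  then have "finite ?Q" using P assms by simp
  ultimately show ?case by blast
qed

lemma sym_dual_eq: "sym_dual scale V k = fs.span {\<Prod>i<k. l i | l. \<forall>i<k. l i \<in> dual_space scale V}"
proof -
  have "(\<lambda>v. \<Prod>i<k. l i v) = (\<Prod>i<k. l i)" for l :: "nat \<Rightarrow> 'a \<Rightarrow> complex"
    by (simp add: fun_eq_iff prod_fun_apply)
  then show ?thesis by (simp add: sym_dual_def)
qed

lemma (in fin_space) sym_dual_finite_span: "\<exists>A. finite A \<and> sym_dual scale V k \<subseteq> fs.span A"
proof -
  obtain A where A: "finite A" "dual_space scale V \<subseteq> fs.span A"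
    using dual_space_finite_span by blast
  obtain P where P: "finite P" "\<And>l. (\<forall>i<k. l i \<in> fs.span A) \<Longrightarrow> (\<Prod>i<k. l i) \<in> fs.span P"
    using products_finite_span[OF A(1)] by blast
  have "sym_dual scale V k \<subseteq> fs.span P"
    unfolding sym_dual_eq by (rule fs.span_minimal) (use P(2) A(2) in auto)
  then show ?thesis using P(1) by blast
qed

lemma lin_wedge: "lin (wedge f)" "lin (\<lambda>g. wedge g f)"
  by (auto intro!: linI simp: wedge_def pointwise algebra_simps)

lemma wedge_self: "wedge f f = 0"
  by (auto simp: wedge_def pointwise mult.commute)

lemma wedge_swap: "wedge g f = - wedge f g"
  by (auto simp: wedge_def pointwise algebra_simps)

lemma ext_square_finite_span:
  assumes "finite A" "W \<subseteq> fs.span A"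
  shows "\<exists>A'. finite A' \<and> ext_square W \<subseteq> fs.span A'"
proof (intro exI[of _ "{wedge s t | s t. s \<in> A \<and> t \<in> A}"] conjI)
  have "{wedge s t | s t. s \<in> A \<and> t \<in> A} = (\<lambda>(s, t). wedge s t) ` (A \<times> A)" by auto
  then show "finite {wedge s t | s t. s \<in> A \<and> t \<in> A}" using assms(1) by simp
  show "ext_square W \<subseteq> fs.span {wedge s t | s t. s \<in> A \<and> t \<in> A}"
    unfolding ext_square_def
    by (rule fs.span_minimal) (use assms(2) lin_wedge in \<open>auto intro!: span_bilinear\<close>)
qed

lemma subspace_ext_square: "fs.subspace (ext_square W)"
  by (simp add: ext_square_def)

lemma wedge_in_ext_square: "f \<in> W \<Longrightarrow> g \<in> W \<Longrightarrow> wedge f g \<in> ext_square W"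
  unfolding ext_square_def by (intro fs.span_base) auto

lemma plucker_span_pair: "plucker (fs.span {f, g}) \<subseteq> range (\<lambda>c. fscale c (wedge f g))"
proof -
  have "wedge a b \<in> fs.span {wedge f g}" if "a \<in> fs.span {f, g}" "b \<in> fs.span {f, g}" for a b
  proof -
    have "wedge a b \<in> fs.span {wedge s t | s t. s \<in> {f, g} \<and> t \<in> {f, g}}"
      by (rule span_bilinear) (use that lin_wedge in auto)
    also have "\<dots> \<subseteq> fs.span {wedge f g}"
    proof (rule fs.span_minimal, rule subsetI)
      fix h assume "h \<in> {wedge s t | s t. s \<in> {f, g} \<and> t \<in> {f, g}}"
      then consider "h = 0" | "h = wedge f g" | "h = - wedge f g"
        using wedge_self wedge_swap[of g f] by auto
      then show "h \<in> fs.span {wedge f g}"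
        by cases (auto intro: fs.span_zero fs.span_base fs.span_neg)
    qed simp
    finally show ?thesis .
  qed
  then show ?thesis
    unfolding plucker_def ext_square_def fs.span_singleton[symmetric]
    by (intro fs.span_minimal) auto
qed

lemma dim_span_pair:
  assumes "wedge f g \<noteq> 0"
  shows "fs.dim (fs.span {f, g}) = 2"
proof -
  have "f \<noteq> g" using assms wedge_self by metis
  moreover have "g \<noteq> 0" using assms lin_zero[OF lin_wedge(1)] by metis
  moreover have "f \<notin> fs.span {g}"
  proof
    assume "f \<in> fs.span {g}"
    then obtain c where "f = fscale c g" by (auto simp: fs.span_singleton)
    then have "wedge f g = fscale c (wedge g g)" using lin_scale[OF lin_wedge(2)] by metis
    then show False using assms by (simp add: wedge_self)
  qed
  ultimately have "fs.independent {f, g}" by (simp add: fs.independent_insert)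
  then show ?thesis using \<open>f \<noteq> g\<close> by (simp add: fs.dim_span_eq_card_independent del: fs.dim_span)
qed

lemma sym_dual_homogeneous:
  assumes "F \<in> sym_dual fscale U k" "u \<in> U"
  shows "F (fscale c u) = c ^ k * F u"
proof -
  have "F \<in> fs.span {\<Prod>i<k. l i | l. \<forall>i<k. l i \<in> dual_space fscale U}"
    using assms(1) by (simp add: sym_dual_eq)
  then show ?thesis
  proof (induction rule: fs.span_induct_alt)
    case base
    show ?case by (simp add: pointwise)
  next
    case (step a x y)
    then obtain l where l: "x = (\<Prod>i<k. l i)" "\<forall>i<k. l i \<in> dual_space fscale U" by auto
    have "x (fscale c u) = (\<Prod>i<k. c * l i u)"
      unfolding l(1) prod_fun_apply
      by (intro prod.cong refl) (use l(2) assms(2) in \<open>auto simp: dual_space_def\<close>)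
    also have "\<dots> = c ^ k * x u" by (simp add: l(1) prod_fun_apply prod.distrib)
    finally have x: "x (fscale c u) = c ^ k * x u" .
    have "(fscale a x + y) v = a * x v + y v" for v
      by (simp only: plus_fun_apply fscale_apply[of a x])
    then show "(fscale a x + y) (fscale c u) = c ^ k * (fscale a x + y) u"
      using x step.IH by (simp only: distrib_left mult.left_commute)
  qed
qed

text \<open>A single form already cuts out a closed set, and this contains the closure as soon as it
  contains the set itself.\<close>

lemma vanishing_forms_hull:
  assumes "\<Z> \<subseteq> Gr 2 W"
  shows "vanishing_forms (ext_square W) (plucker ` (gr2_closed W hull \<Z>)) k =
    vanishing_forms (ext_square W) (plucker ` \<Z>) k"
proof
  show "vanishing_forms (ext_square W) (plucker ` (gr2_closed W hull \<Z>)) k \<subseteq>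
    vanishing_forms (ext_square W) (plucker ` \<Z>) k"
    using hull_subset[of \<Z> "gr2_closed W"] by (auto simp: vanishing_forms_def)
  show "vanishing_forms (ext_square W) (plucker ` \<Z>) k \<subseteq>
    vanishing_forms (ext_square W) (plucker ` (gr2_closed W hull \<Z>)) k"
  proof
    fix F assume F: "F \<in> vanishing_forms (ext_square W) (plucker ` \<Z>) k"
    let ?Z = "{L \<in> Gr 2 W. \<forall>G\<in>{F}. \<forall>w\<in>plucker L. G w = 0}"
    have "gr2_closed W ?Z"
      unfolding gr2_closed_def
      by (rule exI[of _ "{F}"]) (use F in \<open>auto simp: vanishing_forms_def\<close>)
    then have "gr2_closed W hull \<Z> \<subseteq> ?Z"
      by (intro hull_minimal) (use F assms in \<open>auto simp: vanishing_forms_def\<close>)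
    then show "F \<in> vanishing_forms (ext_square W) (plucker ` (gr2_closed W hull \<Z>)) k"
      using F by (auto simp: vanishing_forms_def)
  qed
qed

section \<open>Polarization\<close>

context fin_space
begin

text \<open>The pairing of a linear form with a vector, read as a linear function of the coordinates
  x for a fixed vector u.\<close>

definition Lf :: "'v \<Rightarrow> ('v \<Rightarrow> complex) \<Rightarrow> complex" where "Lf u = (\<lambda>x. lx x u)"

text \<open>Substitute w + t u for w. The coefficient of t is (m + 1) times the wanted product and
  stays in \<open>S\<close> by \<open>coeff_in_subspace\<close>.\<close>

lemma polarization_step:
  assumes S: "fs.subspace S" and q: "\<And>w. w \<in> V \<Longrightarrow> Lf w ^ Suc m * q \<in> S"
    and w: "w \<in> V" and u: "u \<in> V"
  shows "Lf w ^ m * (Lf u * q) \<in> S"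
proof -
  define c where "c j = fscale (of_nat (Suc m choose j)) (Lf u ^ j * Lf w ^ (Suc m - j) * q)" for j
  have "(\<Sum>j\<le>Suc m. fscale (t ^ j) (c j)) \<in> S" for t
  proof -
    have L: "Lf (w + scale t u) = fscale t (Lf u) + Lf w"
      using w u subspace_scale[OF subspace_V] by (auto simp: Lf_def pointwise lx_add lx_scale)
    have "Lf (w + scale t u) ^ Suc m * q = (\<Sum>j\<le>Suc m. fscale (t ^ j) (c j))"
      unfolding L c_def fun_eq_iff times_fun_apply power_fun_apply sum_fun_apply plus_fun_apply fscale_apply binomial_ring
        sum_distrib_right
      by (intro allI sum.cong refl) (simp add: power_mult_distrib)
    moreover have "Lf (w + scale t u) ^ Suc m * q \<in> S"
      by (intro q subspace_add[OF subspace_V] subspace_scale[OF subspace_V] w u)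
    ultimately show ?thesis by simp
  qed
  then have "c 1 \<in> S" by (rule coeff_in_subspace[OF S]) simp
  then have "fscale (inverse (of_nat (Suc m))) (c 1) \<in> S" by (rule fs.subspace_scale[OF S])
  moreover have "fscale (inverse (of_nat (Suc m))) (c 1) = Lf w ^ m * (Lf u * q)"
    by (simp add: c_def mult.commute mult.left_commute del: of_nat_Suc)
  ultimately show ?thesis by simp
qed

lemma polarization_power:
  assumes S: "fs.subspace S" and "\<And>w. w \<in> V \<Longrightarrow> Lf w ^ (r - s) * q \<in> S" and u: "u \<in> V"
  shows "s + m \<le> r \<Longrightarrow> w \<in> V \<Longrightarrow> Lf w ^ (r - (s + m)) * (Lf u ^ m * q) \<in> S"
proof (induction m arbitrary: w)
  case 0
  then show ?case using assms(2) by simp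
next
  case (Suc m)
  have "Lf w ^ (r - (s + Suc m)) * (Lf u * (Lf u ^ m * q)) \<in> S"
  proof (rule polarization_step[OF S _ Suc.prems(2) u])
    fix w assume "w \<in> V"
    then have "Lf w ^ (r - (s + m)) * (Lf u ^ m * q) \<in> S" using Suc by simp
    then show "Lf w ^ Suc (r - (s + Suc m)) * (Lf u ^ m * q) \<in> S"
      using Suc.prems(1) by (simp add: Suc_diff_Suc)
  qed
  then show ?case by (simp add: mult.assoc)
qed

lemma polarization_prod:
  assumes S: "fs.subspace S" and "\<And>w. w \<in> V \<Longrightarrow> Lf w ^ r \<in> S"
  shows "A \<subseteq> V \<Longrightarrow> finite A \<Longrightarrow> sum a A \<le> r \<Longrightarrow> w \<in> V \<Longrightarrow> Lf w ^ (r - sum a A) * (\<Prod>b\<in>A. Lf b ^ a b) \<in> S"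
proof (induction A arbitrary: w rule: infinite_finite_induct)
  case empty
  then show ?case using assms(2) by simp
next
  case (insert b A)
  have "Lf w ^ (r - (sum a A + a b)) * (Lf b ^ a b * (\<Prod>b\<in>A. Lf b ^ a b)) \<in> S"
    by (rule polarization_power[OF S]) (use insert in auto)
  then show ?case using insert.hyps by (simp add: add.commute)
qed simp

lemma monomial_in_span_powers:
  assumes "sum a B = r"
  shows "(\<lambda>x. \<Prod>b\<in>B. x b ^ a b) \<in> fs.span {Lf u ^ r | u. u \<in> V}"
proof -
  \<comment> \<open>All r factors have been converted, so the remaining power has exponent 0 and its
    base is arbitrary.\<close>
  have "Lf 0 ^ (r - sum a B) * (\<Prod>b\<in>B. Lf b ^ a b) \<in> fs.span {Lf u ^ r | u. u \<in> V}"
    by (rule polarization_prod[OF fs.subspace_span _ B_subset finite_B])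
      (use assms subspace_0[OF subspace_V] in \<open>auto intro: fs.span_base\<close>)
  moreover have "(\<Prod>b\<in>B. Lf b ^ a b) = (\<lambda>x. \<Prod>b\<in>B. x b ^ a b)"
    by (auto simp: fun_eq_iff prod_fun_apply power_fun_apply Lf_def lx_basis intro!: prod.cong)
  ultimately show ?thesis using assms by simp
qed

end

section \<open>The Hilbert function\<close>

context fin_space
begin

sublocale coords B
  by unfold_locales (rule finite_B)

abbreviation Sym :: "nat \<Rightarrow> ('v \<Rightarrow> complex) set" where
  "Sym r \<equiv> sym_dual scale V r"

definition pw :: "nat \<Rightarrow> ('v \<Rightarrow> complex) \<Rightarrow> 'v \<Rightarrow> complex" where
  "pw r x = (\<lambda>v. lx x v ^ r)"

text \<open>The pullback of a form along the pairs of r-th powers. In each positive degree its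
  kernel consists of the forms vanishing on the variety, and its image is the corresponding piece of
  the coordinate ring.\<close>

definition restr :: "nat \<Rightarrow> (('v \<times> 'v \<Rightarrow> complex) \<Rightarrow> complex) \<Rightarrow> ('v + 'v \<Rightarrow> complex) \<Rightarrow> complex" where
  "restr r \<Phi> = (\<lambda>z. \<Phi> (wedge (pw r (z \<circ> Inl)) (pw r (z \<circ> Inr))))"

lemma lin_restr: "lin (restr r)"
  by (rule linI) (simp_all add: restr_def plus_fun_def fscale_def)

lemma pw_eq_prod: "pw r x = (\<Prod>i<r. lx x)"
  by (simp add: pw_def fun_eq_iff power_fun_apply)

lemma pw_dual: "l \<in> dual_space scale V \<Longrightarrow> pw r l = (\<lambda>v. l v ^ r)"
  using dual_eq_lx[of l] by (simp add: pw_def)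

lemma pw_in_Sym: "pw r x \<in> Sym r"
  unfolding pw_eq_prod sym_dual_eq
  by (intro fs.span_base CollectI exI[of _ "\<lambda>_. lx x"] conjI refl) (simp add: lx_dual)

lemma wedge_pw_in: "wedge (pw r x) (pw r y) \<in> ext_square (Sym r)"
  by (intro wedge_in_ext_square pw_in_Sym)

definition secants :: "nat \<Rightarrow> ('v \<Rightarrow> complex) set set" where
  "secants r = {L \<in> Gr 2 (Sym r). \<exists>l1\<in>dual_space scale V. \<exists>l2\<in>dual_space scale V.
        L = fs.span {\<lambda>v. l1 v ^ r, \<lambda>v. l2 v ^ r}}"

lemma secants_iff: "L \<in> secants r \<longleftrightarrow> L \<in> Gr 2 (Sym r) \<and> (\<exists>x y. L = fs.span {pw r x, pw r y})"
proof
  assume "L \<in> secants r"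
  then obtain l1 l2 where "L \<in> Gr 2 (Sym r)" "l1 \<in> dual_space scale V" "l2 \<in> dual_space scale V"
    "L = fs.span {\<lambda>v. l1 v ^ r, \<lambda>v. l2 v ^ r}" by (auto simp: secants_def)
  then show "L \<in> Gr 2 (Sym r) \<and> (\<exists>x y. L = fs.span {pw r x, pw r y})"
    using pw_dual[of l1 r] pw_dual[of l2 r] by metis
next
  assume "L \<in> Gr 2 (Sym r) \<and> (\<exists>x y. L = fs.span {pw r x, pw r y})"
  then show "L \<in> secants r" using lx_dual by (auto simp: secants_def pw_def)
qed

text \<open>Pairs with linearly dependent powers span no plane, so the variety imposes nothing
  there; but their wedge is 0, where a form of positive degree vanishes anyway.\<close>

lemma vanishing_forms_secants:
  assumes "k \<ge> 1"
  shows "vanishing_forms (ext_square (Sym r)) (plucker ` secants r) k =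
    {\<Phi> \<in> sym_dual fscale (ext_square (Sym r)) k. restr r \<Phi> = 0}"
proof (intro equalityI subsetI CollectI conjI)
  let ?U = "ext_square (Sym r)"
  fix \<Phi> assume \<Phi>: "\<Phi> \<in> vanishing_forms ?U (plucker ` secants r) k"
  then show form: "\<Phi> \<in> sym_dual fscale ?U k" by (simp add: vanishing_forms_def)
  have "\<Phi> (wedge (pw r x) (pw r y)) = 0" for x y
  proof (cases "wedge (pw r x) (pw r y) = 0")
    case True
    have "\<Phi> (fscale 0 (wedge (pw r x) (pw r y))) = 0 ^ k * \<Phi> (wedge (pw r x) (pw r y))"
      by (rule sym_dual_homogeneous[OF form wedge_pw_in])
    then show ?thesis using True assms by (simp add: power_0_left)
  next
    case False
    let ?L = "fs.span {pw r x, pw r y}"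
    have "?L \<subseteq> Sym r"
      unfolding sym_dual_eq using pw_in_Sym[of r] unfolding sym_dual_eq
      by (intro fs.span_minimal) auto
    then have "?L \<in> secants r"
      unfolding secants_iff Gr_def using dim_span_pair[OF False] by auto
    moreover have "wedge (pw r x) (pw r y) \<in> plucker ?L"
      unfolding plucker_def by (intro wedge_in_ext_square fs.span_base) auto
    ultimately show ?thesis using \<Phi> by (auto simp: vanishing_forms_def)
  qed
  then show "restr r \<Phi> = 0" by (simp add: restr_def pointwise)
next
  let ?U = "ext_square (Sym r)"
  fix \<Phi> assume \<Phi>: "\<Phi> \<in> {\<Phi> \<in> sym_dual fscale ?U k. restr r \<Phi> = 0}"
  have 0: "\<Phi> (wedge (pw r x) (pw r y)) = 0" for x y
  proof -
    have "restr r \<Phi> (case_sum x y) = 0" using \<Phi> by (simp add: zero_fun_apply)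
    moreover have "case_sum x y \<circ> Inl = x" "case_sum x y \<circ> Inr = y" by auto
    ultimately show ?thesis by (simp add: restr_def)
  qed
  have "\<Phi> u = 0" if L: "L \<in> secants r" and u: "u \<in> plucker L" for L u
  proof -
    obtain x y where "L = fs.span {pw r x, pw r y}" using L unfolding secants_iff by blast
    then have "u \<in> range (\<lambda>c. fscale c (wedge (pw r x) (pw r y)))"
      using subsetD[OF plucker_span_pair] u by simp
    then obtain c where "u = fscale c (wedge (pw r x) (pw r y))" by blast
    moreover have "\<Phi> (fscale c (wedge (pw r x) (pw r y))) = c ^ k * \<Phi> (wedge (pw r x) (pw r y))"
      by (rule sym_dual_homogeneous[OF _ wedge_pw_in]) (use \<Phi> in blast)
    ultimately show ?thesis by (simp only: 0 mult_zero_right)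
  qed
  then show "\<Phi> \<in> vanishing_forms ?U (plucker ` secants r) k"
    using \<Phi> by (auto simp: vanishing_forms_def)
qed

lemma restr_dual_subset:
  assumes \<phi>: "\<phi> \<in> dual_space fscale (ext_square (Sym r))"
  shows "restr r \<phi> \<in> ev r r ` T r r"
proof -
  \<comment> \<open>Indexing by maps from \<open>{..<r}\<close> to the basis, not by multisets,
    avoids multinomial coefficients.\<close>
  define m where "m g = (\<Prod>i<r. crd (g i))" for g
  have m: "m g \<in> Sym r" for g
    unfolding m_def sym_dual_eq
    by (intro fs.span_base CollectI exI[of _ "\<lambda>i. crd (g i)"] conjI refl) (simp add: crd_dual)
  let ?P = "PiE {..<r} (\<lambda>_. B)"
  have pw: "pw r x = (\<Sum>g\<in>?P. fscale (\<Prod>i<r. x (g i)) (m g))" for x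
  proof
    fix v
    have "pw r x v = (\<Prod>i<r. \<Sum>b\<in>B. x b * crd b v)"
      by (simp add: pw_def lx_apply)
    also have "\<dots> = (\<Sum>g\<in>?P. \<Prod>i<r. x (g i) * crd (g i) v)"
      by (rule prod_sum_PiE) (use finite_B in auto)
    finally show "pw r x v = (\<Sum>g\<in>?P. fscale (\<Prod>i<r. x (g i)) (m g)) v"
      by (simp add: sum_fun_apply fscale_apply m_def prod_fun_apply prod.distrib)
  qed
  have sub: "fs.subspace (ext_square (Sym r))" by (rule subspace_ext_square)
  have "\<phi> (wedge (pw r x) (pw r y)) =
      (\<Sum>g\<in>?P. \<Sum>h\<in>?P. (\<Prod>i<r. x (g i)) * (\<Prod>i<r. y (h i)) * \<phi> (wedge (m g) (m h)))" for x y
  proof -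
    have "wedge (pw r x) (pw r y) = (\<Sum>g\<in>?P. fscale (\<Prod>i<r. x (g i)) (wedge (m g) (pw r y)))"
      unfolding pw[of x] lin_sum[OF lin_wedge(2)] lin_scale[OF lin_wedge(2)] ..
    then have "\<phi> (wedge (pw r x) (pw r y)) = (\<Sum>g\<in>?P. (\<Prod>i<r. x (g i)) * \<phi> (wedge (m g) (pw r y)))"
      by (simp add: dual_space_sum[OF fs.vector_space_axioms \<phi> sub] wedge_in_ext_square m pw_in_Sym)
    moreover have "\<phi> (wedge (m g) (pw r y)) = (\<Sum>h\<in>?P. (\<Prod>i<r. y (h i)) * \<phi> (wedge (m g) (m h)))" for g
    proof -
      have "wedge (m g) (pw r y) = (\<Sum>h\<in>?P. fscale (\<Prod>i<r. y (h i)) (wedge (m g) (m h)))"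
        unfolding pw[of y] lin_sum[OF lin_wedge(1)] lin_scale[OF lin_wedge(1)] ..
      then show ?thesis by (simp add: dual_space_sum[OF fs.vector_space_axioms \<phi> sub] wedge_in_ext_square m)
    qed
    ultimately show ?thesis by (simp add: sum_distrib_left mult.assoc)
  qed
  then have "restr r \<phi> = (\<Sum>g\<in>?P. \<Sum>h\<in>?P. fscale (\<phi> (wedge (m g) (m h)))
      (\<lambda>z. (\<Prod>i<r. z (Inl (g i))) * (\<Prod>i<r. z (Inr (h i)))))"
    by (auto simp: fun_eq_iff restr_def sum_fun_apply fscale_apply mult.commute intro!: sum.cong)
  also have "\<dots> \<in> ev r r ` T r r"
    by (intro fs.subspace_sum[OF subspace_ev_T] fs.subspace_scale[OF subspace_ev_T] prod_vars_in_ev_T) auto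
  finally show ?thesis .
qed

lemma restr_dual_swap:
  assumes \<phi>: "\<phi> \<in> dual_space fscale (ext_square (Sym r))"
  shows "restr r \<phi> (z \<circ> case_sum Inr Inl) = - restr r \<phi> z"
proof -
  let ?w = "wedge (pw r (z \<circ> Inl)) (pw r (z \<circ> Inr))"
  have "z \<circ> case_sum Inr Inl \<circ> Inl = z \<circ> Inr" "z \<circ> case_sum Inr Inl \<circ> Inr = z \<circ> Inl" by auto
  then have "restr r \<phi> (z \<circ> case_sum Inr Inl) = \<phi> (fscale (- 1) ?w)"
    by (simp add: restr_def wedge_swap[of "pw r (z \<circ> Inr)"])
  also have "\<dots> = (- 1) * \<phi> ?w"
    using \<phi> wedge_pw_in[of r "z \<circ> Inl" "z \<circ> Inr"] unfolding dual_space_def by blast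
  finally show ?thesis by (simp add: restr_def)
qed

text \<open>The exterior square consists of functions on pairs, so evaluation at a pair is a
  functional. These functionals are enough to reach all antisymmetric polynomials.\<close>

lemma eval_wedge_in_dual: "(\<lambda>w. if w \<in> ext_square (Sym r) then w p else 0) \<in> dual_space fscale (ext_square (Sym r))"
  using fs.subspace_add[OF subspace_ext_square, of _ "Sym r"] fs.subspace_scale[OF subspace_ext_square, of _ "Sym r"]
  by (auto simp: dual_space_def plus_fun_apply fscale_apply[of _ _ p])

text \<open>Pullbacks of functionals are antisymmetric, hence covered by \<open>G_1_iff\<close>.
  Conversely, evaluation at (u, v) pulls back to the wedge of the r-th powers of \<open>Lf u\<close>
  and \<open>Lf v\<close>, and by polarization such wedges span every antisymmetrized
  monomial.\<close>

lemma restr_dual: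
  assumes "r \<ge> 1"
  shows "restr r ` dual_space fscale (ext_square (Sym r)) = evG 1 (r - 1)"
proof
  show "restr r ` dual_space fscale (ext_square (Sym r)) \<subseteq> evG 1 (r - 1)"
  proof
    fix f assume "f \<in> restr r ` dual_space fscale (ext_square (Sym r))"
    then obtain \<phi> where \<phi>: "f = restr r \<phi>" "\<phi> \<in> dual_space fscale (ext_square (Sym r))" by auto
    obtain c where c: "c \<in> T r r" "f = ev r r c" using restr_dual_subset[OF \<phi>(2)] \<phi>(1) by auto
    have "ev r r (swap_vars c + c) = 0"
      using restr_dual_swap[OF \<phi>(2)] c(2) \<phi>(1)
      by (simp add: fun_eq_iff lin_add[OF lin_ev] plus_fun_apply ev_swap_vars zero_fun_apply)
    then have "swap_vars c + c = 0"
      by (rule ev_inj[rotated]) (intro fs.subspace_add[OF subspace_T] swap_vars_T c(1))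
    then have "G 1 (r - 1) c"
      using c(1) assms unfolding G_1_iff by (simp add: eq_neg_iff_add_eq_0)
    then show "f \<in> evG 1 (r - 1)" using c(2) assms by auto
  qed
  let ?A = "restr r ` dual_space fscale (ext_square (Sym r))"
  have subA: "fs.subspace ?A"
    by (rule fs_pair.linear_subspace_image[OF lin_restr subspace_dual_space])
  define tr :: "(('v \<Rightarrow> complex) \<times> ('v \<Rightarrow> complex) \<Rightarrow> complex) \<Rightarrow> ('v + 'v \<Rightarrow> complex) \<Rightarrow> complex"
    where "tr h = (\<lambda>z. h (z \<circ> Inl, z \<circ> Inr))" for h
  have lin_tr: "lin tr" by (rule linI) (simp_all add: tr_def pointwise)
  have gen: "tr (wedge s t) \<in> ?A" if "s \<in> {Lf u ^ r | u. u \<in> V}" "t \<in> {Lf u ^ r | u. u \<in> V}" for s t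
  proof -
    from that obtain u v where uv: "s = Lf u ^ r" "t = Lf v ^ r" by blast
    let ?\<phi> = "\<lambda>w. if w \<in> ext_square (Sym r) then w (u, v) else 0"
    have "restr r ?\<phi> = tr (wedge s t)"
      using wedge_pw_in[of r]
      by (simp add: restr_def tr_def uv wedge_def power_fun_apply Lf_def pw_def mult.commute)
    moreover have "restr r ?\<phi> \<in> ?A" by (rule imageI[OF eval_wedge_in_dual])
    ultimately show ?thesis by (simp only:)
  qed
  have monomial_diff: "ev r r (monomial \<alpha> - swap_vars (monomial \<alpha>)) \<in> ?A" if \<alpha>: "\<alpha> \<in> mon r r" for \<alpha>
  proof -
    \<comment> \<open>The monomial factors into its x-part \<open>f\<close> and its y-part
      \<open>g\<close>, so its antisymmetrization is their wedge.\<close>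
    define f where "f x = (\<Prod>b\<in>B. x b ^ \<alpha> (Inl b))" for x :: "'v \<Rightarrow> complex"
    define g where "g x = (\<Prod>b\<in>B. x b ^ \<alpha> (Inr b))" for x :: "'v \<Rightarrow> complex"
    have \<alpha>': "(\<Sum>b\<in>B. \<alpha> (Inl b)) = r" "(\<Sum>b\<in>B. \<alpha> (Inr b)) = r"
      using \<alpha> unfolding mon_def by blast+
    have "f \<in> fs.span {Lf u ^ r | u. u \<in> V}" "g \<in> fs.span {Lf u ^ r | u. u \<in> V}"
      using monomial_in_span_powers[OF \<alpha>'(1)] monomial_in_span_powers[OF \<alpha>'(2)]
      unfolding f_def[abs_def] g_def[abs_def] .
    then have "wedge f g \<in> fs.span {wedge s t | s t. s \<in> {Lf u ^ r | u. u \<in> V} \<and> t \<in> {Lf u ^ r | u. u \<in> V}}"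
      (is "_ \<in> fs.span ?S") by (intro span_bilinear lin_wedge)
    then have "tr (wedge f g) \<in> fs.span (tr ` ?S)"
      using fs_pair.linear_span_image[OF lin_tr, of ?S] by auto
    also have "fs.span (tr ` ?S) \<subseteq> ?A"
      by (rule fs.span_minimal[OF _ subA]) (use gen in blast)
    finally have "tr (wedge f g) \<in> ?A" .
    moreover have "ev r r (monomial \<alpha> - swap_vars (monomial \<alpha>)) = tr (wedge f g)"
    proof
      fix z :: "'v + 'v \<Rightarrow> complex"
      have ev: "ev r r (monomial \<alpha>) z = f (z \<circ> Inl) * g (z \<circ> Inr)" for z
      proof -
        have "ev r r (monomial \<alpha>) z = (\<Sum>\<beta>\<in>mon r r. if \<beta> = \<alpha> then mon_fun \<alpha> z else 0)"
          unfolding ev_def by (intro sum.cong) (auto simp: monomial_def)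
        also have "\<dots> = mon_fun \<alpha> z" using \<alpha> finite_mon by simp
        also have "\<dots> = f (z \<circ> Inl) * g (z \<circ> Inr)"
          unfolding mon_fun_def f_def g_def using finite_B by (subst prod.Plus) auto
        finally show ?thesis .
      qed
      have "z \<circ> case_sum Inr Inl \<circ> Inl = z \<circ> Inr" "z \<circ> case_sum Inr Inl \<circ> Inr = z \<circ> Inl" by auto
      then show "ev r r (monomial \<alpha> - swap_vars (monomial \<alpha>)) z = tr (wedge f g) z"
        by (simp add: lin_diff[OF lin_ev] minus_apply ev_swap_vars ev tr_def wedge_def mult.commute)
    qed
    ultimately show ?thesis by simp
  qed
  show "evG 1 (r - 1) \<subseteq> ?A"
  proof
    fix h assume "h \<in> evG 1 (r - 1)"
    then obtain c where c: "h = ev r r c" "G 1 (r - 1) c" using assms by auto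
    then have cT: "c \<in> T r r" "swap_vars c = - c" using assms unfolding G_1_iff by auto
    have sub: "fs.subspace {c. ev r r (c - swap_vars c) \<in> ?A}"
    proof (rule fs.subspaceI)
      show "0 \<in> {c. ev r r (c - swap_vars c) \<in> ?A}"
        using fs.subspace_0[OF subA] by (simp add: swap_lin lin_zero[OF lin_ev])
      fix x y assume "x \<in> {c. ev r r (c - swap_vars c) \<in> ?A}" "y \<in> {c. ev r r (c - swap_vars c) \<in> ?A}"
      then have "ev r r (x - swap_vars x) + ev r r (y - swap_vars y) \<in> ?A"
        using fs.subspace_add[OF subA] by blast
      moreover have "x + y - swap_vars (x + y) = (x - swap_vars x) + (y - swap_vars y)"
        by (simp add: swap_lin)
      ultimately show "x + y \<in> {c. ev r r (c - swap_vars c) \<in> ?A}"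
        by (simp only: mem_Collect_eq lin_add[OF lin_ev])
    next
      fix a x assume "x \<in> {c. ev r r (c - swap_vars c) \<in> ?A}"
      then have "fscale a (ev r r (x - swap_vars x)) \<in> ?A"
        using fs.subspace_scale[OF subA] by blast
      moreover have "fscale a x - swap_vars (fscale a x) = fscale a (x - swap_vars x)"
        by (simp add: swap_lin scale_simps)
      ultimately show "fscale a x \<in> {c. ev r r (c - swap_vars c) \<in> ?A}"
        by (simp only: mem_Collect_eq lin_scale[OF lin_ev])
    qed
    have "T r r \<subseteq> {c. ev r r (c - swap_vars c) \<in> ?A}"
      unfolding T_eq_span by (rule fs.span_minimal[OF _ sub]) (use monomial_diff in auto)
    then have "ev r r (c - swap_vars c) \<in> ?A" using cT(1) by blast
    then have "fscale (1 / 2) (ev r r (c - swap_vars c)) \<in> ?A" by (rule fs.subspace_scale[OF subA])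
    moreover have half: "fscale (1 / 2) (c - swap_vars c) = c" by (simp add: cT(2) pointwise)
    have "fscale (1 / 2) (ev r r (c - swap_vars c)) = ev r r c"
      by (simp only: lin_scale[OF lin_ev, symmetric] half)
    ultimately show "h \<in> ?A" by (simp only: c(1))
  qed
qed

text \<open>Pullback is multiplicative, and forms of degree k are spanned by products of k
  functionals, so degree one determines everything.\<close>

lemma restr_sym_dual:
  assumes "r \<ge> 1"
  shows "restr r ` sym_dual fscale (ext_square (Sym r)) k = evG k (k * (r - 1))"
proof -
  let ?D = "dual_space fscale (ext_square (Sym r))"
  have restr_prod: "restr r (\<Prod>i<k. l i) = (\<Prod>i<k. restr r (l i))" for l k
    by (simp add: restr_def fun_eq_iff prod_fun_apply)
  have "restr r ` sym_dual fscale (ext_square (Sym r)) k =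
      fs.span (restr r ` {\<Prod>i<k. l i | l. \<forall>i<k. l i \<in> ?D})"
    unfolding sym_dual_eq by (rule fs_pair.linear_span_image[OF lin_restr, symmetric])
  also have "restr r ` {\<Prod>i<k. l i | l. \<forall>i<k. l i \<in> ?D} = {\<Prod>i<k. a i | a. \<forall>i<k. a i \<in> evG 1 (r - 1)}"
  proof (intro equalityI subsetI)
    fix f assume "f \<in> restr r ` {\<Prod>i<k. l i | l. \<forall>i<k. l i \<in> ?D}"
    then obtain l where l: "\<forall>i<k. l i \<in> ?D" "f = restr r (\<Prod>i<k. l i)" by auto
    have "\<forall>i<k. restr r (l i) \<in> evG 1 (r - 1)"
      using l(1) unfolding restr_dual[OF assms, symmetric] by blast
    then show "f \<in> {\<Prod>i<k. a i | a. \<forall>i<k. a i \<in> evG 1 (r - 1)}"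
      unfolding l(2) restr_prod by blast
  next
    fix f assume "f \<in> {\<Prod>i<k. a i | a. \<forall>i<k. a i \<in> evG 1 (r - 1)}"
    then obtain a where a: "\<forall>i<k. a i \<in> restr r ` ?D" "f = (\<Prod>i<k. a i)"
      unfolding restr_dual[OF assms] by auto
    from a(1) have "\<forall>i. \<exists>l. i < k \<longrightarrow> l \<in> ?D \<and> a i = restr r l" by blast
    then obtain l where l: "\<And>i. i < k \<Longrightarrow> l i \<in> ?D \<and> a i = restr r (l i)" by metis
    have "f = restr r (\<Prod>i<k. l i)" unfolding a(2) restr_prod using l by (intro prod.cong) auto
    then show "f \<in> restr r ` {\<Prod>i<k. l i | l. \<forall>i<k. l i \<in> ?D}" using l by blast
  qed
  also have "fs.span \<dots> = evG k (k * (r - 1))" by (rule span_products_evG)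
  finally show ?thesis .
qed

lemma sym_dual_ext_square_finite_span:
  "\<exists>A. finite A \<and> sym_dual fscale (ext_square (Sym r)) k \<subseteq> fs.span A"
proof -
  obtain A0 where "finite A0" "Sym r \<subseteq> fs.span A0" using sym_dual_finite_span by blast
  then obtain A where A: "finite A" "ext_square (Sym r) \<subseteq> fs.span A"
    using ext_square_finite_span by blast
  \<comment> \<open>A basis of the exterior square lets the finite-dimensional theory be applied to
    it in place of \<open>V\<close>.\<close>
  obtain C where C: "C \<subseteq> ext_square (Sym r)" "fs.independent C" "ext_square (Sym r) \<subseteq> fs.span C"
    using fs.maximal_independent_subset by blast
  have "finite C" using fs.independent_span_bound[OF A(1) C(2)] C(1) A(2) by blast
  moreover have "fs.span C = ext_square (Sym r)"
    using C subspace_ext_square by (meson fs.span_minimal subset_antisym)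
  ultimately interpret U: fin_space fscale "ext_square (Sym r)" C
    by unfold_locales (use C in auto)
  show ?thesis by (rule U.sym_dual_finite_span)
qed

text \<open>Rank-nullity for \<open>restr r\<close>: the vanishing forms are its kernel, so the
  difference of dimensions is the dimension of the image.\<close>

lemma hilbert_function_Sigma2:
  assumes "r \<ge> 1" "k \<ge> 1"
  shows "hilbert_function (ext_square (Sym r)) (plucker ` Sigma2 scale V r) k =
    fs.dim (Collect (G k (k * (r - 1))))"
proof -
  let ?U = "ext_square (Sym r)"
  have "Sigma2 scale V r = gr2_closed (Sym r) hull secants r"
    by (simp add: Sigma2_def secants_def)
  moreover have "secants r \<subseteq> Gr 2 (Sym r)" by (auto simp: secants_def)
  ultimately have van: "vanishing_forms ?U (plucker ` Sigma2 scale V r) k =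
      {\<Phi> \<in> sym_dual fscale ?U k. restr r \<Phi> = 0}"
    using vanishing_forms_hull vanishing_forms_secants[OF assms(2)] by metis
  obtain A where A: "finite A" "sym_dual fscale ?U k \<subseteq> fs.span A"
    using sym_dual_ext_square_finite_span by blast
  have sub: "fs.subspace (sym_dual fscale ?U k)" by (simp add: sym_dual_eq)
  have "fs.dim (sym_dual fscale ?U k) =
      fs.dim {\<Phi> \<in> sym_dual fscale ?U k. restr r \<Phi> = 0} + fs.dim (restr r ` sym_dual fscale ?U k)"
    by (rule fs_pair.dim_eq_dim_kernel_plus_dim_image[OF lin_restr sub A])
  then show ?thesis
    by (simp add: hilbert_function_def van restr_sym_dual[OF assms(1)] dim_evG)
qed

lemma hilbert_poly_Sigma2:
  assumes "card B = Suc N" "N \<ge> 1" "r \<ge> 2"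
  shows "degree (hilbert_poly (ext_square (Sym r)) (plucker ` Sigma2 scale V r)) = 2 * N"
    and "lead_coeff (hilbert_poly (ext_square (Sym r)) (plucker ` Sigma2 scale V r)) =
      (real r ^ (2 * N) - (2 * real r - 1) ^ N) / (2 * (fact N)\<^sup>2)"
proof -
  let ?h = "hilbert_function (ext_square (Sym r)) (plucker ` Sigma2 scale V r)"
  have hc: "hc p = (N + p) choose p" for p by (simp add: hc_def assms(1))
  obtain p :: "real poly" where
    p: "\<And>k. k \<ge> 1 \<Longrightarrow> poly p (real k) = real (\<Sum>i<Suc (k * (r - 1)).
        if even (k * (r - 1) - i) then fs.dim (K (k * r + i) (k * r - i)) else 0)" and
    deg: "degree p = 2 * N"
      "lead_coeff p = (real r ^ (2 * N) - (2 * real r - 1) ^ N) / (2 * (fact N)\<^sup>2)"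
    using alternating_dimension_poly[of "\<lambda>p q. fs.dim (K p q)" N r] dim_K[unfolded hc] assms(2,3) by blast
  have p_eq: "poly p (real k) = real (?h k)" if "k \<ge> 1" for k
  proof -
    have kr: "k + k * (r - 1) = k * r" using assms(3) by (cases r) auto
    have "r \<ge> 1" using assms(3) by simp
    then show ?thesis
      by (simp only: p[OF that] hilbert_function_Sigma2[OF _ that] dim_G kr)
  qed
  \<comment> \<open>The definite description is unique because polynomials that agree at all large
    integers coincide.\<close>
  have "hilbert_poly (ext_square (Sym r)) (plucker ` Sigma2 scale V r) = p"
    unfolding hilbert_poly_def
  proof (rule the_equality)
    show "\<exists>N. \<forall>k\<ge>N. poly p (real k) = real (?h k)" using p_eq by blast
    fix q :: "real poly" assume "\<exists>N. \<forall>k\<ge>N. poly q (real k) = real (?h k)"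
    then obtain M where M: "\<And>k. k \<ge> M \<Longrightarrow> poly q (real k) = real (?h k)" by blast
    show "q = p"
    proof (rule ccontr)
      assume "q \<noteq> p"
      then have "finite {x. poly (q - p) x = 0}" by (intro poly_roots_finite) simp
      moreover have "real ` {max M 1..} \<subseteq> {x. poly (q - p) x = 0}"
        using M p_eq by auto
      ultimately have "finite (real ` {max M 1..})" using finite_subset by blast
      then have "finite {max M 1..}" by (rule finite_imageD) (auto simp: inj_on_def)
      then show False by (simp add: infinite_Ici)
    qed
  qed
  then show "degree (hilbert_poly (ext_square (Sym r)) (plucker ` Sigma2 scale V r)) = 2 * N"
    and "lead_coeff (hilbert_poly (ext_square (Sym r)) (plucker ` Sigma2 scale V r)) =
      (real r ^ (2 * N) - (2 * real r - 1) ^ N) / (2 * (fact N)\<^sup>2)"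
    using deg by simp_all
qed

end

theorem lemmaB13:
  fixes scale :: "complex \<Rightarrow> 'v::ab_group_add \<Rightarrow> 'v" and V :: "'v set" and n r :: nat
  assumes "vector_space scale"
    and "module.subspace scale V"
    and "vector_space.dim scale V = n"
    and "n \<ge> 2" and "r \<ge> 2"
  shows "plucker_degree (sym_dual scale V r) (Sigma2 scale V r) =
    real ((2 * n - 3) choose (n - 1)) * (real r ^ (2 * n - 2) - (2 * real r - 1) ^ (n - 1))"
proof -
  interpret vs: vector_space scale by fact
  obtain B where B: "B \<subseteq> V" "vs.independent B" "V \<subseteq> vs.span B" "card B = vs.dim V"
    using vs.basis_exists by blast
  have "finite B" using B(4) assms(3,4) by (intro card_ge_0_finite) simp
  moreover have "vs.span B = V" using B(1,3) assms(2) by (meson vs.span_minimal subset_antisym)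
  ultimately interpret fin_space scale V B
    by unfold_locales (use B(2) in auto)
  define N where "N = n - 1"
  have N: "card B = Suc N" "N \<ge> 1" "n = Suc N" using B(4) assms(3,4) by (auto simp: N_def)
  \<comment> \<open>The degree is (2N)! times the leading coefficient. Half of the central binomial
    coefficient is (2N - 1 choose N), by Pascal's rule and symmetry.\<close>
  have "real ((2 * N) choose N) = fact (2 * N) / (fact N)\<^sup>2"
    by (simp add: binomial_fact power2_eq_square)
  moreover have "(2 * N) choose N = 2 * ((2 * N - 1) choose N)"
  proof -
    obtain M where M: "N = Suc M" using N(2) by (cases N) auto
    have "(2 * N - 1) choose N = (2 * N - 1) choose M"
      using binomial_symmetric[of N "2 * N - 1"] M by simp
    then show ?thesis using M by simp
  qed
  ultimately have "fact (2 * N) / (2 * (fact N)\<^sup>2) = real ((2 * N - 1) choose N)" by simp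
  then have "fact (2 * N) * (x / (2 * (fact N)\<^sup>2)) = real ((2 * N - 1) choose N) * x" for x :: real
    by (metis times_divide_eq_left times_divide_eq_right mult.commute)
  moreover have "2 * n - 3 = 2 * N - 1" "n - 1 = N" "2 * n - 2 = 2 * N" using N(3) by auto
  ultimately show ?thesis
    unfolding plucker_degree_def proj_degree_def hilbert_poly_Sigma2(2)[OF N(1,2) assms(5)]
    by (simp only: hilbert_poly_Sigma2(1)[OF N(1,2) assms(5)])
qed

end
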